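(* Let $X$ be a Coxeter graph satisfying the projection property. Let $x,w\in W_c(X)$ be such that $x<w$. If there exists $s\in S(X)$ such that $sw<w$ and $x<sx\in W_c(X)$, then $$L_{x,w}=q^{-\frac12}L_{sx,w}.$$
   Context: Let $X$ be a Coxeter graph, $W(X)$ its Coxeter group with generating set $S(X)$, length function $\ell$, Bruhat order $\le$ and identity $e$. Let $\mathcal A=\mathbb Z[q^{1/2},q^{-1/2}]$. The Hecke algebra $\mathcal H(X)$ is the associative $\mathcal A$-algebra with linear basis $\{T_w: w\in W(X)\}$, identity $T_e$, and $T_wT_s=T_{ws}$ if $\ell(ws)>\ell(w)$, $T_wT_s=qT_{ws}+(q-1)T_w$ if $\ell(ws)<\ell(w)$ ($s\in S(X)$). Let $J(X)$ be the two-sided ideal generated by all $\sum_{w\in\langle s_i,s_j\rangle}T_w$, where $(s_i,s_j)$ runs over pairs of non-commuting generators in $S(X)$ such that $s_is_j$ has finite order. The generalized Temperley--Lieb algebra is $TL(X)=\mathcal H(X)/J(X)$; let $\sigma$ be the canonical projection and $t_w=\sigma(T_w)$ for $w\in W(X)$. An element $w$ is fully commutative if any reduced expression for $w$ can be obtained from any other by using only Coxeter relations involving commuting generators; $W_c(X)$ is the set of such elements. It is known that $\{t_w: w\in W_c(X)\}$ is an $\mathcal A$-basis of $TL(X)$. Basis $c_w$ and polynomials $L_{x,w}$: let $\iota$ be the ring involution of $TL(X)$ with $\iota(t_w)=(t_{w^{-1}})^{-1}$ and $\iota(q^{1/2})=q^{-1/2}$. There is a unique basis $\{c_w: w\in W_c(X)\}$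 of $TL(X)$ with $\iota(c_w)=c_w$ and $c_w=\sum_{x\in W_c(X),\,x\le w}q^{-\ell(x)/2}L_{x,w}(q^{-1/2})\,t_x$, where $L_{w,w}=1$, $L_{x,w}=L_{x,w}(q^{-1/2})\in q^{-1/2}\mathbb Z[q^{-1/2}]$ for $x\ne w$, and $L_{x,w}=0$ if $x\not\le w$. Let $P_{x,w}(q)$ be the Kazhdan--Lusztig polynomials of $W(X)$ and $C'_w=q^{-\ell(w)/2}\sum_{x\le w}P_{x,w}(q)T_x$ the Kazhdan--Lusztig basis of $\mathcal H(X)$. $X$ is said to satisfy the projection property if $\sigma(C'_w)=c_w$ for all $w\in W_c(X)$ and $\sigma(C'_w)=0$ for all $w\in W(X)\setminus W_c(X)$. (For finite irreducible or affine $X$ this holds if and only if $X$ is non-branching and $X\ne\widetilde{F_4}$.) *)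

theory Defs
  imports
    "HOL-Algebra.QuotRing"
    "HOL-Algebra.Generated_Groups"
    "HOL-Computational_Algebra.Polynomial"
    "HOL-Library.Poly_Mapping"
    "HOL-Library.Extended_Nat"
begin

section \<open>Coxeter graphs and Coxeter groups\<close>

text \<open>
  A Coxeter graph is encoded by its Coxeter matrix: two distinct nodes are joined by an edge iff
  their label is at least 3 (possibly infinite); label 2 means that they are not joined.
\<close>

record 's coxeter_graph =
  nodes :: "'s set"
  label :: "'s \<Rightarrow> 's \<Rightarrow> enat"

definition is_coxeter_graph :: "'s coxeter_graph \<Rightarrow> bool" where
  "is_coxeter_graph X \<longleftrightarrow>
     (\<forall>i\<in>nodes X. label X i i = 1) \<and>
     (\<forall>i\<in>nodes X. \<forall>j\<in>nodes X. i \<noteq> j \<longrightarrow> label X i j = label X j i \<and> 2 \<le> label X i j)"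

text \<open>
  The Coxeter group is the group presented by generators the nodes and relations
  \<open>(i j)\<^sup>k = 1\<close> for each finite label \<open>k\<close> of \<open>i\<close>, \<open>j\<close>. Because of the relations \<open>i i = 1\<close>
  (label 1) no formal inverses are needed, so that it is the monoid of words in the nodes modulo
  the congruence generated by the relations.
\<close>

inductive cox_eq :: "'s coxeter_graph \<Rightarrow> 's list \<Rightarrow> 's list \<Rightarrow> bool" for X where
  refl: "set u \<subseteq> nodes X \<Longrightarrow> cox_eq X u u"
| sym: "cox_eq X u v \<Longrightarrow> cox_eq X v u"
| trans: "cox_eq X u v \<Longrightarrow> cox_eq X v w \<Longrightarrow> cox_eq X u w"
| rel: "\<lbrakk>set u \<subseteq> nodes X; set v \<subseteq> nodes X; i \<in> nodes X; j \<in> nodes X; label X i j = enat k\<rbrakk>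
        \<Longrightarrow> cox_eq X (u @ concat (replicate k [i, j]) @ v) (u @ v)"

definition cox_class :: "'s coxeter_graph \<Rightarrow> 's list \<Rightarrow> 's list set" where
  "cox_class X u = {v. cox_eq X u v}"

definition coxeter_group :: "'s coxeter_graph \<Rightarrow> 's list set monoid" where
  "coxeter_group X =
     \<lparr>carrier = cox_class X ` {u. set u \<subseteq> nodes X},
      monoid.mult = (\<lambda>A B. \<Union>u\<in>A. \<Union>v\<in>B. cox_class X (u @ v)),
      one = cox_class X []\<rparr>"

definition cox_gens :: "'s coxeter_graph \<Rightarrow> 's list set set" where
  "cox_gens X = (\<lambda>i. cox_class X [i]) ` nodes X"

text \<open>From here on, expressions are words in the generating set \<open>cox_gens X\<close> of the group.\<close>

definition word_prod :: "'s coxeter_graph \<Rightarrow> 's list set list \<Rightarrow> 's list set" where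
  "word_prod X ss = foldr (monoid.mult (coxeter_group X)) ss \<one>\<^bsub>coxeter_group X\<^esub>"

definition cox_length :: "'s coxeter_graph \<Rightarrow> 's list set \<Rightarrow> nat" where
  "cox_length X w = (LEAST n. \<exists>ss. set ss \<subseteq> cox_gens X \<and> length ss = n \<and> word_prod X ss = w)"

definition reduced_expr :: "'s coxeter_graph \<Rightarrow> 's list set \<Rightarrow> 's list set list \<Rightarrow> bool" where
  "reduced_expr X w ss \<longleftrightarrow>
     set ss \<subseteq> cox_gens X \<and> word_prod X ss = w \<and> length ss = cox_length X w"

definition cox_reflections :: "'s coxeter_graph \<Rightarrow> 's list set set" where
  "cox_reflections X =
     {g \<otimes>\<^bsub>coxeter_group X\<^esub> s \<otimes>\<^bsub>coxeter_group X\<^esub> inv\<^bsub>coxeter_group X\<^esub> g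
        | g s. g \<in> carrier (coxeter_group X) \<and> s \<in> cox_gens X}"

definition bruhat_le :: "'s coxeter_graph \<Rightarrow> 's list set \<Rightarrow> 's list set \<Rightarrow> bool" where
  "bruhat_le X x w \<longleftrightarrow>
     (x, w) \<in> {(y, y \<otimes>\<^bsub>coxeter_group X\<^esub> r) | y r.
                 y \<in> carrier (coxeter_group X) \<and> r \<in> cox_reflections X \<and>
                 cox_length X y < cox_length X (y \<otimes>\<^bsub>coxeter_group X\<^esub> r)}\<^sup>*"

definition bruhat_less :: "'s coxeter_graph \<Rightarrow> 's list set \<Rightarrow> 's list set \<Rightarrow> bool" where
  "bruhat_less X x w \<longleftrightarrow> bruhat_le X x w \<and> x \<noteq> w"

definition commutation_moves :: "'s coxeter_graph \<Rightarrow> ('s list set list \<times> 's list set list) set" where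
  "commutation_moves X =
     {(us @ [s, t] @ vs, us @ [t, s] @ vs) | us vs s t.
        s \<in> cox_gens X \<and> t \<in> cox_gens X \<and>
        s \<otimes>\<^bsub>coxeter_group X\<^esub> t = t \<otimes>\<^bsub>coxeter_group X\<^esub> s}"

text \<open>The set \<open>W\<^sub>c(X)\<close> of fully commutative elements.\<close>

definition fully_commutative :: "'s coxeter_graph \<Rightarrow> 's list set set" where
  "fully_commutative X =
     {w \<in> carrier (coxeter_group X).
        \<forall>ss ts. reduced_expr X w ss \<longrightarrow> reduced_expr X w ts \<longrightarrow> (ss, ts) \<in> (commutation_moves X)\<^sup>*}"


section \<open>Laurent polynomials\<close>

text \<open>
  The ring \<open>\<int>[q\<^sup>1\<^sup>/\<^sup>2, q\<^sup>-\<^sup>1\<^sup>/\<^sup>2]\<close> is the group ring of the additive group of integers, with exponents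
  counted in units of one half: \<open>qh k\<close> is \<open>q\<close> to the power \<open>k/2\<close>.
\<close>

type_synonym laurent = "int \<Rightarrow>\<^sub>0 int"

definition qh :: "int \<Rightarrow> laurent" where
  "qh k = Poly_Mapping.single k 1"

definition poly_in_q :: "int poly \<Rightarrow> laurent" where
  "poly_in_q p = (\<Sum>i\<le>degree p. Poly_Mapping.single (2 * int i) (coeff p i))"


section \<open>The Hecke algebra\<close>

text \<open>
  The Hecke algebra has as underlying module the free module on the elements of the group. The
  multiplication is the only possible associative one: right multiplication of a basis element by
  the element \<open>T\<^sub>s\<close> of a generator is prescribed, and right multiplication by \<open>T\<^sub>w\<close> is obtained by
  multiplying successively by the elements of the generators in a reduced expression of \<open>w\<close>.
  The result does not depend on the reduced expression chosen.
\<close>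

type_synonym 's hecke = "'s list set \<Rightarrow>\<^sub>0 laurent"

definition hT :: "'s list set \<Rightarrow> 's hecke" where
  "hT w = Poly_Mapping.single w 1"

definition hscale :: "laurent \<Rightarrow> 's hecke \<Rightarrow> 's hecke" where
  "hscale a f = Poly_Mapping.map (\<lambda>b. a * b) f"

definition hecke_times_gen :: "'s coxeter_graph \<Rightarrow> 's hecke \<Rightarrow> 's list set \<Rightarrow> 's hecke" where
  "hecke_times_gen X f s =
     (\<Sum>w\<in>Poly_Mapping.keys f. hscale (Poly_Mapping.lookup f w)
        (if cox_length X w < cox_length X (w \<otimes>\<^bsub>coxeter_group X\<^esub> s)
         then hT (w \<otimes>\<^bsub>coxeter_group X\<^esub> s)
         else hscale (qh 2) (hT (w \<otimes>\<^bsub>coxeter_group X\<^esub> s)) + hscale (qh 2 - 1) (hT w)))"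

definition hecke_times :: "'s coxeter_graph \<Rightarrow> 's hecke \<Rightarrow> 's hecke \<Rightarrow> 's hecke" where
  "hecke_times X f g =
     (\<Sum>w\<in>Poly_Mapping.keys g. hscale (Poly_Mapping.lookup g w)
        (foldl (hecke_times_gen X) f (SOME ss. reduced_expr X w ss)))"

definition hecke :: "'s coxeter_graph \<Rightarrow> 's hecke ring" where
  "hecke X =
     \<lparr>carrier = {f. Poly_Mapping.keys f \<subseteq> carrier (coxeter_group X)},
      monoid.mult = hecke_times X,
      one = hT \<one>\<^bsub>coxeter_group X\<^esub>,
      zero = 0,
      add = (+)\<rparr>"


section \<open>The generalized Temperley--Lieb algebra\<close>

definition tl_ideal :: "'s coxeter_graph \<Rightarrow> 's hecke set" where
  "tl_ideal X = Idl\<^bsub>hecke X\<^esub>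
     {\<Sum>w\<in>generate (coxeter_group X) {s, t}. hT w | s t.
        s \<in> cox_gens X \<and> t \<in> cox_gens X \<and>
        s \<otimes>\<^bsub>coxeter_group X\<^esub> t \<noteq> t \<otimes>\<^bsub>coxeter_group X\<^esub> s \<and>
        (\<exists>n::nat. n > 0 \<and>
           (s \<otimes>\<^bsub>coxeter_group X\<^esub> t) [^]\<^bsub>coxeter_group X\<^esub> n = \<one>\<^bsub>coxeter_group X\<^esub>)}"

definition tl :: "'s coxeter_graph \<Rightarrow> 's hecke set ring" where
  "tl X = hecke X Quot tl_ideal X"

definition tl_proj :: "'s coxeter_graph \<Rightarrow> 's hecke \<Rightarrow> 's hecke set" where
  "tl_proj X f = tl_ideal X +>\<^bsub>hecke X\<^esub> f"

definition tl_t :: "'s coxeter_graph \<Rightarrow> 's list set \<Rightarrow> 's hecke set" where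
  "tl_t X w = tl_proj X (hT w)"

definition tl_scale :: "'s coxeter_graph \<Rightarrow> laurent \<Rightarrow> 's hecke set \<Rightarrow> 's hecke set" where
  "tl_scale X a y = tl_proj X (hscale a (hT \<one>\<^bsub>coxeter_group X\<^esub>)) \<otimes>\<^bsub>tl X\<^esub> y"


section \<open>Bar involutions, the Kazhdan--Lusztig basis and the basis of the quotient\<close>

text \<open>
  The bar involution of \<open>R\<close>, where \<open>R\<close> is the Hecke algebra or its quotient, and \<open>\<phi>\<close> is the
  identity or the canonical projection, respectively. It exists and is unique on \<open>carrier R\<close>; on
  scalars it is determined by inverting \<open>q\<^sup>1\<^sup>/\<^sup>2\<close>.
\<close>

definition bar_involution ::
    "'s coxeter_graph \<Rightarrow> 'r ring \<Rightarrow> ('s hecke \<Rightarrow> 'r) \<Rightarrow> ('r \<Rightarrow> 'r) \<Rightarrow> bool" where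
  "bar_involution X R \<phi> \<iota> \<longleftrightarrow>
     \<iota> \<in> ring_hom R R \<and>
     (\<forall>y\<in>carrier R. \<iota> (\<iota> y) = y) \<and>
     (\<forall>w\<in>carrier (coxeter_group X).
        \<iota> (\<phi> (hT w)) = inv\<^bsub>R\<^esub> (\<phi> (hT (inv\<^bsub>coxeter_group X\<^esub> w)))) \<and>
     \<iota> (\<phi> (hscale (qh 1) (hT \<one>\<^bsub>coxeter_group X\<^esub>))) =
       \<phi> (hscale (qh (- 1)) (hT \<one>\<^bsub>coxeter_group X\<^esub>))"

text \<open>The element \<open>C'\<^sub>w\<close> formed with a family \<open>P\<close> of polynomials \<open>P\<^sub>x\<^sub>,\<^sub>w\<close> in \<open>q\<close>.\<close>

definition kl_element ::
    "'s coxeter_graph \<Rightarrow> ('s list set \<Rightarrow> 's list set \<Rightarrow> int poly) \<Rightarrow> 's list set \<Rightarrow> 's hecke" where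
  "kl_element X P w = hscale (qh (- int (cox_length X w)))
     (\<Sum>x | x \<in> carrier (coxeter_group X) \<and> bruhat_le X x w. hscale (poly_in_q (P x w)) (hT x))"

text \<open>
  The defining properties of the Kazhdan--Lusztig polynomials, which determine \<open>P\<^sub>x\<^sub>,\<^sub>w\<close> uniquely
  for all \<open>x\<close>, \<open>w\<close> in the group. The degree of \<open>P\<^sub>x\<^sub>,\<^sub>w\<close> is at most \<open>(\<ell>(w) - \<ell>(x) - 1)/2\<close>.
\<close>

definition kazhdan_lusztig_polys ::
    "'s coxeter_graph \<Rightarrow> ('s list set \<Rightarrow> 's list set \<Rightarrow> int poly) \<Rightarrow> bool" where
  "kazhdan_lusztig_polys X P \<longleftrightarrow>
     (\<exists>\<iota>. bar_involution X (hecke X) (\<lambda>f. f) \<iota> \<and>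
       (\<forall>w\<in>carrier (coxeter_group X).
          \<iota> (kl_element X P w) = kl_element X P w \<and>
          P w w = 1 \<and>
          (\<forall>x\<in>carrier (coxeter_group X).
             (bruhat_less X x w \<longrightarrow>
                2 * degree (P x w) + cox_length X x + 1 \<le> cox_length X w) \<and>
             (\<not> bruhat_le X x w \<longrightarrow> P x w = 0))))"

text \<open>
  \<open>c\<close>, restricted to the fully commutative elements, is a basis of the quotient over the Laurent
  polynomials.
\<close>

definition tl_basis :: "'s coxeter_graph \<Rightarrow> ('s list set \<Rightarrow> 's hecke set) \<Rightarrow> bool" where
  "tl_basis X c \<longleftrightarrow>
     (\<forall>w\<in>fully_commutative X. c w \<in> carrier (tl X)) \<and>
     (\<forall>y\<in>carrier (tl X). \<exists>!a :: 's hecke.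
        Poly_Mapping.keys a \<subseteq> fully_commutative X \<and>
        y = (\<Oplus>\<^bsub>tl X\<^esub>w\<in>Poly_Mapping.keys a. tl_scale X (Poly_Mapping.lookup a w) (c w)))"

text \<open>
  \<open>c\<close> is the bar invariant basis of the quotient and \<open>L x w\<close> is the polynomial \<open>L\<^sub>x\<^sub>,\<^sub>w\<close>, written as
  an element of \<open>\<int>[q\<^sup>1\<^sup>/\<^sup>2, q\<^sup>-\<^sup>1\<^sup>/\<^sup>2]\<close>; it lies in \<open>q\<^sup>-\<^sup>1\<^sup>/\<^sup>2 \<int>[q\<^sup>-\<^sup>1\<^sup>/\<^sup>2]\<close> iff all its exponents are
  negative. On fully commutative elements, \<open>c\<close> and \<open>L\<close> are uniquely determined.
\<close>

definition tl_canonical_basis ::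
    "'s coxeter_graph \<Rightarrow> ('s list set \<Rightarrow> 's hecke set) \<Rightarrow>
      ('s list set \<Rightarrow> 's list set \<Rightarrow> laurent) \<Rightarrow> bool" where
  "tl_canonical_basis X c L \<longleftrightarrow>
     tl_basis X c \<and>
     (\<exists>\<iota>. bar_involution X (tl X) (tl_proj X) \<iota> \<and>
       (\<forall>w\<in>fully_commutative X.
          \<iota> (c w) = c w \<and>
          c w = (\<Oplus>\<^bsub>tl X\<^esub>x\<in>{x \<in> fully_commutative X. bruhat_le X x w}.
                   tl_scale X (qh (- int (cox_length X x)) * L x w) (tl_t X x)) \<and>
          L w w = 1 \<and>
          (\<forall>x\<in>fully_commutative X.
             (x \<noteq> w \<longrightarrow> Poly_Mapping.keys (L x w) \<subseteq> {..<0}) \<and>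
             (\<not> bruhat_le X x w \<longrightarrow> L x w = 0))))"

text \<open>
  The existential quantifiers only name the Kazhdan--Lusztig polynomials and the bar invariant
  basis, both of which exist and are unique.
\<close>

definition projection_property :: "'s coxeter_graph \<Rightarrow> bool" where
  "projection_property X \<longleftrightarrow>
     (\<exists>P c L. kazhdan_lusztig_polys X P \<and> tl_canonical_basis X c L \<and>
       (\<forall>w\<in>fully_commutative X. tl_proj X (kl_element X P w) = c w) \<and>
       (\<forall>w\<in>carrier (coxeter_group X) - fully_commutative X.
          tl_proj X (kl_element X P w) = \<zero>\<^bsub>tl X\<^esub>))"

end

theory Submission
  imports Defs
begin

text \<open>
  If \<open>sw < w\<close>, then \<open>T\<^sub>s C'\<^sub>w = q C'\<^sub>w\<close> in the Hecke algebra. By the projection property the same holds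
  for \<open>c\<^sub>w\<close> in the quotient, so that \<open>(1 + q) c\<^sub>w = (1 + t\<^sub>s) c\<^sub>w\<close>. The theorem says that the coefficients of
  \<open>t\<^sub>x\<close> and \<open>t\<^sub>s\<^sub>x\<close> in \<open>c\<^sub>w\<close> agree, and the point is that this holds for every multiple of \<open>1 + t\<^sub>s\<close>, whenever
  \<open>x < sx\<close> are both fully commutative.

  For this it suffices that the elements \<open>t\<^sub>y + t\<^sub>s\<^sub>y\<close>, with \<open>y < sy\<close> both fully commutative, span
  \<open>(1 + t\<^sub>s) TL\<close>, which is proved by induction on the length of \<open>z\<close> for \<open>(1 + t\<^sub>s) t\<^sub>z\<close>
  (\<open>hT_symmetrizable\<close>). An element \<open>z\<close> that is not fully commutative contains a long braid, and \<open>t\<^sub>z\<close> is a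
  combination of basis elements of smaller length (\<open>not_fc_long_braid_factor\<close>, \<open>long_braid_reduces\<close>). If
  \<open>z\<close> is fully commutative but \<open>sz > z\<close> is not, then the braid created in \<open>sz\<close> begins with \<open>s\<close>, up to a
  prefix that commutes with \<open>s\<close> (\<open>gen_times_not_fc_cases\<close>). The sum of all \<open>T\<^sub>u\<close> over a dihedral group
  \<open>\<langle>s, t\<rangle>\<close> is \<open>1 + T\<^sub>s\<close> times the sum over those \<open>u\<close> with \<open>u < su\<close>, and it vanishes in the quotient.
  Hence \<open>(1 + t\<^sub>s) t\<^sub>z\<close> is again \<open>1 + t\<^sub>s\<close> times a combination of shorter elements.

  The eigenvalue property of \<open>C'\<^sub>w\<close> (\<open>kl_element_descent\<close>) and the uniqueness of the polynomials \<open>L\<^sub>x\<^sub>,\<^sub>w\<close>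
  (\<open>canonical_basis_unique\<close>) both rest on the fact that a bar invariant element with only negative
  exponents is zero (\<open>bar_invariant_neg_eq_0\<close>). Uniqueness is used because the projection property
  only provides some canonical basis.

  All this presupposes that the Hecke algebra is a ring and that lengths in the Coxeter group, which
  is given by a presentation, behave as expected. The latter is derived from one invariant of words:
  the parity with which a reflection occurs among the reflections of a word depends only on the
  product of the word (\<open>cox_eq_parity\<close>). Associativity in the Hecke algebra follows from the fact that
  left and right multiplication by generators commute (\<open>lgen_rgen_commute\<close>).
\<close>

section \<open>The Coxeter group as a group of words\<close>

lemma cox_eq_nodes: "cox_eq X u v \<Longrightarrow> set u \<subseteq> nodes X \<and> set v \<subseteq> nodes X"
  by (induction rule: cox_eq.induct) (auto simp: set_replicate_conv_if split: if_splits)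

lemma cox_eq_append:
  assumes "cox_eq X u v" "set p \<subseteq> nodes X" "set r \<subseteq> nodes X"
  shows "cox_eq X (p @ u @ r) (p @ v @ r)"
  using assms
proof (induction rule: cox_eq.induct)
  case (rel u v i j k)
  then show ?case using cox_eq.rel[of "p @ u" X "v @ r" i j k] by simp
next
  case (refl u)
  then show ?case by (intro cox_eq.refl) auto
qed (auto intro: cox_eq.sym cox_eq.trans)

lemma cox_class_eq_iff:
  assumes "set u \<subseteq> nodes X"
  shows "cox_class X u = cox_class X v \<longleftrightarrow> cox_eq X u v"
  using assms unfolding cox_class_def
  by (auto intro: cox_eq.intros dest: cox_eq_nodes)

lemma cox_mult:
  assumes "set u \<subseteq> nodes X" "set v \<subseteq> nodes X"
  shows "cox_class X u \<otimes>\<^bsub>coxeter_group X\<^esub> cox_class X v = cox_class X (u @ v)"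
proof -
  have *: "cox_class X (u' @ v') = cox_class X (u @ v)" if "cox_eq X u u'" "cox_eq X v v'" for u' v'
  proof -
    have "cox_eq X (u @ v) (u' @ v')"
      using cox_eq_append[OF that(1), of "[]" v] cox_eq_append[OF that(2), of u' "[]"] that
      by (auto dest: cox_eq_nodes intro: cox_eq.trans)
    then show ?thesis using assms by (subst eq_commute) (simp add: cox_class_eq_iff)
  qed
  have "u \<in> cox_class X u" "v \<in> cox_class X v"
    using assms by (auto simp: cox_class_def intro: cox_eq.refl)
  then have "(\<Union>u'\<in>cox_class X u. \<Union>v'\<in>cox_class X v. cox_class X (u' @ v')) = cox_class X (u @ v)"
    using * unfolding cox_class_def[of X u] cox_class_def[of X v] by blast
  then show ?thesis
    by (simp add: coxeter_group_def) 
qed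

locale coxeter =
  fixes X :: "'s coxeter_graph"
  assumes graph: "is_coxeter_graph X"
begin

abbreviation W where "W \<equiv> coxeter_group X"
abbreviation S where "S \<equiv> cox_gens X"

abbreviation mlt (infixl "\<odot>" 70) where "g \<odot> h \<equiv> g \<otimes>\<^bsub>coxeter_group X\<^esub> h"
abbreviation iv where "iv g \<equiv> inv\<^bsub>coxeter_group X\<^esub> g"
abbreviation e where "e \<equiv> \<one>\<^bsub>coxeter_group X\<^esub>"

lemma label_self: "i \<in> nodes X \<Longrightarrow> label X i i = enat 1"
  using graph by (simp add: is_coxeter_graph_def one_enat_def)

lemma carrier_W: "carrier W = cox_class X ` {u. set u \<subseteq> nodes X}"
  by (simp add: coxeter_group_def)

lemma one_W: "e = cox_class X []"
  by (simp add: coxeter_group_def)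

text \<open>
  The relation \<open>i i = 1\<close> coming from the label 1 on the diagonal makes reversal of words an
  inverse, so the monoid of words modulo the relations is a group.
\<close>

lemma cox_class_rev:
  "set u \<subseteq> nodes X \<Longrightarrow> cox_class X (rev u) \<odot> cox_class X u = e"
proof (induction u)
  case Nil
  then show ?case by (simp add: one_W cox_mult)
next
  case (Cons i u)
  then have "cox_eq X (rev u @ concat (replicate 1 [i, i]) @ u) (rev u @ u)"
    using label_self[of i] by (intro cox_eq.rel) auto
  moreover have "cox_class X (rev u @ u) = e" using Cons by (simp add: cox_mult)
  ultimately show ?case
    using Cons.prems by (simp add: cox_mult flip: cox_class_eq_iff)
qed

lemma group_W: "group W"
proof (rule groupI)
  show "\<exists>y\<in>carrier W. y \<odot> x = e" if "x \<in> carrier W" for x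
  proof -
    from that obtain u where u: "set u \<subseteq> nodes X" "x = cox_class X u" by (auto simp: carrier_W)
    then show ?thesis
      using cox_class_rev[of u] by (intro bexI[of _ "cox_class X (rev u)"]) (auto simp: carrier_W)
  qed
qed (auto simp: carrier_W one_W cox_mult)

end

sublocale coxeter \<subseteq> group "coxeter_group X"
  by (rule group_W)

context coxeter
begin

lemma gen_in [simp]: "s \<in> S \<Longrightarrow> s \<in> carrier W"
  by (auto simp: cox_gens_def carrier_W)

lemma gen_sq [simp]: "s \<in> S \<Longrightarrow> s \<odot> s = e"
proof -
  assume "s \<in> S"
  then obtain i where i: "i \<in> nodes X" "s = cox_class X [i]" by (auto simp: cox_gens_def)
  then show ?thesis using cox_class_rev[of "[i]"] by simp
qed

lemma gen_inv [simp]: "s \<in> S \<Longrightarrow> iv s = s"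
  by (simp add: inv_equality)

lemma gen_cancel [simp]:
  "s \<in> S \<Longrightarrow> g \<in> carrier W \<Longrightarrow> s \<odot> (s \<odot> g) = g"
  by (simp flip: m_assoc)

lemma gen_cancel_right [simp]:
  "s \<in> S \<Longrightarrow> g \<in> carrier W \<Longrightarrow> g \<odot> s \<odot> s = g"
  by (simp add: m_assoc)

lemma word_prod_simps [simp]: "word_prod X [] = e" "word_prod X (s # ss) = s \<odot> word_prod X ss"
  by (simp_all add: word_prod_def)

lemma word_prod_closed [simp]: "set ss \<subseteq> S \<Longrightarrow> word_prod X ss \<in> carrier W"
  by (induction ss) auto

lemma word_prod_append [simp]:
  "set ss \<subseteq> S \<Longrightarrow> set ts \<subseteq> S \<Longrightarrow> word_prod X (ss @ ts) = word_prod X ss \<odot> word_prod X ts"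
  by (induction ss) (auto simp: m_assoc)

abbreviation gens_of :: "'s list \<Rightarrow> 's list set list" where
  "gens_of u \<equiv> map (\<lambda>i. cox_class X [i]) u"

lemma word_prod_gens: "set u \<subseteq> nodes X \<Longrightarrow> word_prod X (gens_of u) = cox_class X u"
  by (induction u) (auto simp: one_W cox_mult)

lemma words_are_gens: "set ss \<subseteq> S \<Longrightarrow> \<exists>u. set u \<subseteq> nodes X \<and> ss = gens_of u"
proof (induction ss)
  case (Cons s ss)
  then obtain u i where "set u \<subseteq> nodes X" "ss = gens_of u" "i \<in> nodes X" "s = cox_class X [i]"
    by (auto simp: cox_gens_def)
  then show ?case by (intro exI[of _ "i # u"]) auto
qed auto

lemma gens_of_subset: "set u \<subseteq> nodes X \<Longrightarrow> set (gens_of u) \<subseteq> S"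
  by (auto simp: cox_gens_def)

lemma ex_word: "w \<in> carrier W \<Longrightarrow> \<exists>ss. set ss \<subseteq> S \<and> word_prod X ss = w"
  unfolding carrier_W using word_prod_gens gens_of_subset by blast

section \<open>Reflections of words and inversions of elements\<close>

definition conj_by where "conj_by g r = g \<odot> r \<odot> iv g"

lemma conj_by_closed [simp]: "g \<in> carrier W \<Longrightarrow> r \<in> carrier W \<Longrightarrow> conj_by g r \<in> carrier W"
  by (simp add: conj_by_def)

lemma conj_by_one [simp]: "r \<in> carrier W \<Longrightarrow> conj_by e r = r"
  by (simp add: conj_by_def)

lemma conj_by_mult:
  "g \<in> carrier W \<Longrightarrow> h \<in> carrier W \<Longrightarrow> r \<in> carrier W \<Longrightarrow>
   conj_by (g \<odot> h) r = conj_by g (conj_by h r)"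
  by (simp add: conj_by_def m_assoc inv_mult_group)

lemma conj_by_mult_right:
  "g \<in> carrier W \<Longrightarrow> r \<in> carrier W \<Longrightarrow> conj_by g r \<odot> g = g \<odot> r"
  by (simp add: conj_by_def m_assoc)

lemma conj_by_inv_cancel [simp]:
  "g \<in> carrier W \<Longrightarrow> r \<in> carrier W \<Longrightarrow> conj_by (iv g) (conj_by g r) = r"
  "g \<in> carrier W \<Longrightarrow> r \<in> carrier W \<Longrightarrow> conj_by g (conj_by (iv g) r) = r"
  by (simp_all flip: conj_by_mult)

lemma conj_by_eq_iff:
  "g \<in> carrier W \<Longrightarrow> r \<in> carrier W \<Longrightarrow> r' \<in> carrier W \<Longrightarrow> conj_by g r = conj_by g r' \<longleftrightarrow> r = r'"
  by (metis conj_by_inv_cancel(1))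

text \<open>
  The reflections \<open>s\<^sub>1 \<cdots> s\<^sub>i\<^sub>-\<^sub>1 s\<^sub>i s\<^sub>i\<^sub>-\<^sub>1 \<cdots> s\<^sub>1\<close> of a word. Multiplying the word on the left by
  the \<open>i\<close>-th of them deletes its \<open>i\<close>-th letter.
\<close>

fun refl_list :: "'s list set list \<Rightarrow> 's list set list" where
  "refl_list [] = []"
| "refl_list (s # ss) = s # map (conj_by s) (refl_list ss)"

lemma length_refl_list [simp]: "length (refl_list ss) = length ss"
  by (induction ss) auto

lemma refl_list_carrier: "set ss \<subseteq> S \<Longrightarrow> set (refl_list ss) \<subseteq> carrier W"
  by (induction ss) auto

lemma refl_list_append:
  "set ss \<subseteq> S \<Longrightarrow> set ts \<subseteq> S \<Longrightarrow>
   refl_list (ss @ ts) = refl_list ss @ map (conj_by (word_prod X ss)) (refl_list ts)"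
proof (induction ss)
  case Nil
  then have "map (conj_by e) (refl_list ts) = map id (refl_list ts)"
    using refl_list_carrier[of ts] by (intro map_cong) auto
  then show ?case by simp
next
  case (Cons s ss)
  then have "map (conj_by (s \<odot> word_prod X ss)) (refl_list ts)
      = map (conj_by s \<circ> conj_by (word_prod X ss)) (refl_list ts)"
    using refl_list_carrier[of ts] by (intro map_cong) (auto simp: conj_by_mult)
  then show ?case using Cons by simp
qed

lemma count_map_conj:
  "g \<in> carrier W \<Longrightarrow> set rs \<subseteq> carrier W \<Longrightarrow> r \<in> carrier W \<Longrightarrow>
   count_list (map (conj_by g) rs) (conj_by g r) = count_list rs r"
  by (induction rs) (auto simp: conj_by_eq_iff)

lemma count_map_conj':
  assumes "g \<in> carrier W" "set rs \<subseteq> carrier W" "r \<in> carrier W"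
  shows "count_list (map (conj_by g) rs) r = count_list rs (conj_by (iv g) r)"
  using count_map_conj[of g rs "conj_by (iv g) r"] assms by simp

fun alt_word :: "'a \<Rightarrow> 'a \<Rightarrow> nat \<Rightarrow> 'a list" where
  "alt_word a b 0 = []"
| "alt_word a b (Suc k) = a # alt_word b a k"

lemma length_alt_word [simp]: "length (alt_word a b k) = k"
  by (induction k arbitrary: a b) auto

lemma alt_word_in: "a \<in> A \<Longrightarrow> b \<in> A \<Longrightarrow> set (alt_word a b k) \<subseteq> A"
  by (induction k arbitrary: a b) auto

lemma relator_alt_word: "concat (replicate k [a, b]) = alt_word a b (2 * k)"
  by (induction k) auto

lemma pow_gen_swap:
  assumes "s \<in> S" "t \<in> S"
  shows "s \<odot> (t \<odot> s) [^]\<^bsub>W\<^esub> n = (s \<odot> t) [^]\<^bsub>W\<^esub> (n::nat) \<odot> s"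
proof (induction n)
  case (Suc n)
  have "s \<odot> (t \<odot> s) [^]\<^bsub>W\<^esub> Suc n = s \<odot> (t \<odot> s) [^]\<^bsub>W\<^esub> n \<odot> (t \<odot> s)"
    using assms by (simp add: m_assoc)
  also have "\<dots> = (s \<odot> t) [^]\<^bsub>W\<^esub> Suc n \<odot> s"
    unfolding Suc using assms by (simp add: m_assoc)
  finally show ?case .
qed (use assms in simp)

lemma nth_refl_list_alt_word:
  assumes "s \<in> S" "t \<in> S" "n < k"
  shows "refl_list (alt_word s t k) ! n = (s \<odot> t) [^]\<^bsub>W\<^esub> n \<odot> s"
  using assms
proof (induction k arbitrary: s t n)
  case (Suc k)
  show ?case
  proof (cases n)
    case (Suc n')
    have "conj_by s ((t \<odot> s) [^]\<^bsub>W\<^esub> n' \<odot> t) = (s \<odot> (t \<odot> s) [^]\<^bsub>W\<^esub> n') \<odot> (t \<odot> s)"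
      using Suc.prems by (simp add: conj_by_def m_assoc)
    then show ?thesis using Suc Suc.IH[of t s n'] Suc.prems pow_gen_swap[of s t n']
      by (simp add: m_assoc)
  qed (use Suc.prems in simp)
qed simp

text \<open>
  The \<open>n\<close>-th reflection of the relator is \<open>(st)\<^sup>n s\<close>, which depends only on \<open>n\<close> modulo \<open>k\<close>. As the
  relator has \<open>2k\<close> letters, its list of reflections consists of two equal halves.
\<close>

lemma even_count_refl_list_relator:
  assumes "s \<in> S" "t \<in> S" "(s \<odot> t) [^]\<^bsub>W\<^esub> k = e"
  shows "even (count_list (refl_list (concat (replicate k [s, t]))) r)"
proof -
  let ?R = "refl_list (concat (replicate k [s, t]))"
  let ?f = "\<lambda>n. (s \<odot> t) [^]\<^bsub>W\<^esub> (n::nat) \<odot> s"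
  have "?R = map ?f [0..<2*k]"
    by (rule nth_equalityI) (use nth_refl_list_alt_word assms in \<open>auto simp: relator_alt_word\<close>)
  also have "\<dots> = map ?f [0..<k] @ map ?f [k..<k+k]"
    unfolding mult_2 by (subst upt_add_eq_append) simp_all
  also have "map ?f [k..<k+k] = map (\<lambda>n. ?f (n + k)) [0..<k]"
    by (rule nth_equalityI) (auto simp: add.commute)
  also have "\<dots> = map ?f [0..<k]"
    by (intro map_cong) (use assms in \<open>simp_all flip: nat_pow_mult\<close>)
  finally show ?thesis by (simp add: count_list_append)
qed

lemma count_refl_list_append:
  assumes "set ss \<subseteq> S" "set ts \<subseteq> S" "r \<in> carrier W"
  shows "count_list (refl_list (ss @ ts)) r =
    count_list (refl_list ss) r + count_list (refl_list ts) (conj_by (iv (word_prod X ss)) r)"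
  using assms by (simp add: refl_list_append count_map_conj' refl_list_carrier)

text \<open>
  The parity with which a reflection occurs in a word depends only on the group element, since
  inserting a relator adds each reflection an even number of times and leaves the later ones
  unchanged. Everything about lengths follows from this invariant.
\<close>

lemma cox_eq_parity:
  assumes "cox_eq X u v" "r \<in> carrier W"
  shows "odd (count_list (refl_list (gens_of u)) r) = odd (count_list (refl_list (gens_of v)) r)"
  using assms
proof (induction arbitrary: r rule: cox_eq.induct)
  case (rel u v i j k)
  let ?s = "cox_class X [i]" and ?t = "cox_class X [j]"
  have st: "?s \<in> S" "?t \<in> S" using rel by (auto simp: cox_gens_def)
  let ?c = "concat (replicate k [i, j])"
  have gc: "gens_of ?c = concat (replicate k [?s, ?t])" by (simp add: map_concat)
  have sub: "set (gens_of u) \<subseteq> S" "set (gens_of v) \<subseteq> S" "set ?c \<subseteq> nodes X"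
    using rel by (auto simp: cox_gens_def)
  have subc: "set (gens_of ?c) \<subseteq> S" using sub(3) by (rule gens_of_subset)
  have "cox_eq X ?c []"
    using cox_eq.rel[of "[]" X "[]" i j k] rel by simp
  then have one: "word_prod X (gens_of ?c) = e"
    using sub(3) by (simp only: word_prod_gens one_W cox_class_eq_iff)
  have "word_prod X (concat (replicate k [?s, ?t])) = (?s \<odot> ?t) [^]\<^bsub>W\<^esub> k" for k
  proof (induction k)
    case (Suc k)
    have "word_prod X (concat (replicate (Suc k) [?s, ?t])) = (?s \<odot> ?t) \<odot> (?s \<odot> ?t) [^]\<^bsub>W\<^esub> k"
      using st Suc by (simp add: m_assoc)
    also have "\<dots> = (?s \<odot> ?t) [^]\<^bsub>W\<^esub> Suc k"
      using nat_pow_Suc2[of "?s \<odot> ?t" k] st by simp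
    finally show ?case .
  qed simp
  then have k: "(?s \<odot> ?t) [^]\<^bsub>W\<^esub> k = e" using one gc by simp
  have "even (count_list (refl_list (gens_of ?c)) r)" for r
    unfolding gc by (rule even_count_refl_list_relator[OF st k])
  moreover have "conj_by (iv (word_prod X (gens_of u))) r \<in> carrier W" (is "?r \<in> _")
    using sub rel.prems by simp
  moreover have "set (gens_of ?c @ gens_of v) \<subseteq> S" using sub subc by (simp only: set_append Un_subset_iff)
  ultimately show ?case
    using count_refl_list_append[OF sub(1), of "gens_of ?c @ gens_of v" r]
      count_refl_list_append[OF subc sub(2), of ?r]
      count_refl_list_append[OF sub(1,2) rel.prems] rel.prems 
    unfolding map_append one by (simp only: conj_by_one inv_one even_add simp_thms)
qed auto

text \<open>
  The set usually written \<open>N(w)\<close>; by parity it may be computed from any word for \<open>w\<close>.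
\<close>

definition inversions :: "'s list set \<Rightarrow> 's list set set" where
  "inversions w = {r \<in> carrier W. \<exists>ss. set ss \<subseteq> S \<and> word_prod X ss = w \<and> odd (count_list (refl_list ss) r)}"

lemma inversions_word:
  assumes "set ss \<subseteq> S"
  shows "inversions (word_prod X ss) = {r. odd (count_list (refl_list ss) r)}"
proof -
  have "odd (count_list (refl_list ts) r) = odd (count_list (refl_list ss) r)"
    if th: "set ts \<subseteq> S" "word_prod X ts = word_prod X ss" "r \<in> carrier W" for ts r
  proof -
    obtain u where u: "set u \<subseteq> nodes X" "ts = gens_of u"
      using words_are_gens[OF th(1)] by blast
    moreover obtain v where v: "set v \<subseteq> nodes X" "ss = gens_of v"
      using words_are_gens[OF assms] by blast
    ultimately have uv: "set u \<subseteq> nodes X" "ts = gens_of u" "set v \<subseteq> nodes X" "ss = gens_of v" by simp_all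
    then have "cox_eq X u v"
      using th(2) word_prod_gens[OF u(1)] word_prod_gens[OF v(1)] cox_class_eq_iff[OF u(1)] by simp
    then show ?thesis using cox_eq_parity[OF _ th(3)] uv by simp
  qed
  moreover have "r \<in> carrier W" if "odd (count_list (refl_list ss) r)" for r
    using refl_list_carrier[OF assms] that count_notin[of r "refl_list ss"] by fastforce
  ultimately show ?thesis unfolding inversions_def using assms by auto
qed

lemma inversions_one [simp]: "inversions e = {}"
  using inversions_word[of "[]"] by simp

lemma inversions_gen: "s \<in> S \<Longrightarrow> inversions s = {s}"
  using inversions_word[of "[s]"] by simp

text \<open>
  The cocycle rule \<open>N(gh) = N(g) \<Delta> g N(h) g\<^sup>-\<^sup>1\<close> for sets of inversions.
\<close>

lemma inversions_mult:
  assumes "g \<in> carrier W" "h \<in> carrier W" "r \<in> carrier W"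
  shows "r \<in> inversions (g \<odot> h) \<longleftrightarrow> (r \<in> inversions g) \<noteq> (conj_by (iv g) r \<in> inversions h)"
proof -
  obtain ss ts where "set ss \<subseteq> S" "word_prod X ss = g" "set ts \<subseteq> S" "word_prod X ts = h"
    using ex_word assms by metis
  then show ?thesis
    using inversions_word[of ss] inversions_word[of ts] inversions_word[of "ss @ ts"] assms
      count_refl_list_append[of ss ts r] by auto
qed

section \<open>Length and the exchange condition\<close>

abbreviation len where "len \<equiv> cox_length X"

lemma len_le: "set ss \<subseteq> S \<Longrightarrow> len (word_prod X ss) \<le> length ss"
  unfolding cox_length_def by (rule Least_le) auto

lemma ex_reduced:
  assumes "w \<in> carrier W"
  obtains ss where "reduced_expr X w ss"
proof -
  have "\<exists>n ss. set ss \<subseteq> S \<and> length ss = n \<and> word_prod X ss = w" using ex_word[OF assms] by auto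
  from LeastI_ex[OF this] show ?thesis using that unfolding cox_length_def reduced_expr_def by auto
qed

lemma reducedD:
  assumes "reduced_expr X w ss"
  shows "set ss \<subseteq> S" "word_prod X ss = w" "length ss = len w" "w \<in> carrier W"
  using assms word_prod_closed by (auto simp: reduced_expr_def)

lemma refl_list_delete:
  assumes "set ss \<subseteq> S" "i < length ss"
  shows "refl_list ss ! i \<odot> word_prod X ss = word_prod X (take i ss @ drop (Suc i) ss)"
  using assms
proof (induction ss arbitrary: i)
  case (Cons s ss)
  show ?case
  proof (cases i)
    case (Suc j)
    with Cons have "refl_list ss ! j \<in> carrier W"
      using refl_list_carrier[of ss] nth_mem[of j "refl_list ss"] by auto
    then show ?thesis using Cons Suc by (simp add: conj_by_def m_assoc)
  qed (use Cons in simp)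
qed simp

text \<open>
  If two reflections of a word coincide, then deleting both letters does not change the product,
  so the word was not reduced.
\<close>

lemma distinct_refl_list:
  assumes "reduced_expr X w ss"
  shows "distinct (refl_list ss)"
proof (rule ccontr)
  note d = reducedD[OF assms]
  assume "\<not> distinct (refl_list ss)"
  then obtain i j where ij: "i < length ss" "j < length ss" "i \<noteq> j" "refl_list ss ! i = refl_list ss ! j"
    by (auto simp: distinct_conv_nth)
  obtain i j where ij: "i < j" "j < length ss" "refl_list ss ! i = refl_list ss ! j"
  proof (cases "i < j")
    case False
    then show ?thesis using that[of j i] ij by simp
  qed (use that ij in simp)
  define r where "r = refl_list ss ! i"
  let ?ts = "take j ss @ drop (Suc j) ss"
  have ts: "set ?ts \<subseteq> S"
    using d(1) set_take_subset[of j ss] set_drop_subset[of "Suc j" ss] by auto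
  have tj: "set (take j ss) \<subseteq> S" "set (drop j ss) \<subseteq> S" "set (drop (Suc j) ss) \<subseteq> S"
    using d(1) set_take_subset[of j ss] set_drop_subset by fast+
  have w: "r \<odot> w = word_prod X ?ts"
    using refl_list_delete[OF d(1) ij(2)] ij d r_def by simp
  have "refl_list ?ts ! i = refl_list ss ! i"
    using refl_list_append[OF tj(1,3)] refl_list_append[OF tj(1,2)] ij by (simp add: nth_append)
  then have *: "r \<odot> (r \<odot> w) = word_prod X (take i ?ts @ drop (Suc i) ?ts)"
    using refl_list_delete[OF ts, of i] ij w r_def by simp
  have rc: "r \<in> carrier W" using refl_list_carrier[OF d(1)] ij r_def
    by (metis dual_order.strict_trans length_refl_list nth_mem subsetD)
  have "refl_list ss ! i \<odot> refl_list ss ! i = e" if "set ss \<subseteq> S" "i < length ss" for i ss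
    using that
  proof (induction ss arbitrary: i)
    case (Cons s ss)
    show ?case
    proof (cases i)
      case (Suc j)
      with Cons have "refl_list ss ! j \<in> carrier W"
        using refl_list_carrier[of ss] nth_mem[of j "refl_list ss"] by auto
      moreover have "refl_list ss ! j \<odot> refl_list ss ! j = e" using Cons Suc by simp
      then have "refl_list ss ! j \<odot> (refl_list ss ! j \<odot> s) = s"
        using calculation Cons by (simp flip: m_assoc)
      ultimately show ?thesis using Cons Suc by (simp add: conj_by_def m_assoc)
    qed (use Cons in simp)
  qed simp
  then have "r \<odot> r = e" using d(1) ij r_def by simp
  then have "w = word_prod X (take i ?ts @ drop (Suc i) ?ts)" using * d(4) rc
    by (simp flip: m_assoc)
  moreover have "set (take i ?ts @ drop (Suc i) ?ts) \<subseteq> S"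
    using ts set_take_subset[of i ?ts] set_drop_subset[of "Suc i" ?ts] by (simp only: set_append) blast
  ultimately have "len w \<le> length (take i ?ts @ drop (Suc i) ?ts)" using len_le by metis
  also have "\<dots> < length ss" using ij by simp
  finally show False using d by simp
qed

lemma odd_count_distinct: "distinct xs \<Longrightarrow> odd (count_list xs x) \<longleftrightarrow> x \<in> set xs"
  by (induction xs) (auto simp: count_notin)

lemma inversions_reduced:
  assumes "reduced_expr X w ss"
  shows "inversions w = set (refl_list ss)"
  using inversions_word[OF reducedD(1)[OF assms]] reducedD(2)[OF assms]
    distinct_refl_list[OF assms] by (simp add: odd_count_distinct)

text \<open>
  Both the given word and any reduced word of the same element have distinct reflections, hence
  both lengths equal the number of inversions.
\<close>

lemma reduced_iff_distinct:
  assumes "set ss \<subseteq> S"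
  shows "reduced_expr X (word_prod X ss) ss \<longleftrightarrow> distinct (refl_list ss)"
proof
  assume dist: "distinct (refl_list ss)"
  obtain ts where ts: "reduced_expr X (word_prod X ss) ts"
    using ex_reduced[of "word_prod X ss"] assms by auto
  have "inversions (word_prod X ss) = set (refl_list ss)"
    using inversions_word[OF assms] dist by (auto simp: odd_count_distinct)
  then have "card (set (refl_list ss)) = card (set (refl_list ts))"
    using inversions_reduced[OF ts] by simp
  then have "length ss = length ts"
    using dist distinct_refl_list[OF ts] by (simp add: distinct_card)
  then show "reduced_expr X (word_prod X ss) ss"
    using assms ts by (simp add: reduced_expr_def)
qed (rule distinct_refl_list)

lemma reflection_exchange:
  assumes "set ss \<subseteq> S" "r \<in> inversions (word_prod X ss)"
  obtains i where "i < length ss" "r = refl_list ss ! i"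
    "r \<odot> word_prod X ss = word_prod X (take i ss @ drop (Suc i) ss)"
proof -
  have "count_list (refl_list ss) r \<noteq> 0" using inversions_word[OF assms(1)] assms(2) by (auto intro: odd_pos)
  then have "r \<in> set (refl_list ss)" by (metis count_notin)
  then obtain i where "i < length ss" "r = refl_list ss ! i" by (auto simp: in_set_conv_nth)
  then show ?thesis using that refl_list_delete[OF assms(1)] by blast
qed

lemma set_delete: "set ss \<subseteq> A \<Longrightarrow> set (take i ss @ drop j ss) \<subseteq> A"
  using set_take_subset[of i ss] set_drop_subset[of j ss] by auto

lemma len_inversion_less:
  assumes "w \<in> carrier W" "r \<in> inversions w"
  shows "len (r \<odot> w) < len w"
proof -
  obtain ss where ss: "reduced_expr X w ss" using ex_reduced assms by auto
  note d = reducedD[OF ss]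
  obtain i where i: "i < length ss" "r \<odot> w = word_prod X (take i ss @ drop (Suc i) ss)"
    using reflection_exchange[of ss r] d(1,2) assms(2) by blast
  then have "len (r \<odot> w) \<le> length (take i ss @ drop (Suc i) ss)"
    using len_le[OF set_delete[OF d(1)], of i "Suc i"] by simp
  then show ?thesis using i(1) d(3) by simp
qed

lemma len_mult_le:
  assumes "g \<in> carrier W" "h \<in> carrier W"
  shows "len (g \<odot> h) \<le> len g + len h"
proof -
  obtain ss ts where "reduced_expr X g ss" "reduced_expr X h ts" using ex_reduced assms by metis
  from this[THEN reducedD(1)] this[THEN reducedD(2)] this[THEN reducedD(3)]
  show ?thesis using len_le[of "ss @ ts"] by simp
qed

lemma len_gen [simp]: "s \<in> S \<Longrightarrow> len s = 1"
  using reduced_iff_distinct[of "[s]"] reducedD(3)[of s "[s]"] by simp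

lemma len_one [simp]: "len e = 0"
  using len_le[of "[]"] by simp

lemma conj_gen_self [simp]: "s \<in> S \<Longrightarrow> conj_by s s = s"
  by (simp add: conj_by_def)

lemma gen_inversion_iff:
  assumes "s \<in> S" "w \<in> carrier W"
  shows "s \<in> inversions (s \<odot> w) \<longleftrightarrow> s \<notin> inversions w"
  using inversions_mult[of s w s] assms by (simp add: inversions_gen)

lemma len_left_gen:
  assumes "s \<in> S" "w \<in> carrier W"
  shows "s \<in> inversions w \<Longrightarrow> len w = Suc (len (s \<odot> w))"
    and "s \<notin> inversions w \<Longrightarrow> len (s \<odot> w) = Suc (len w)"
proof -
  have *: "len w = Suc (len (s \<odot> w))" if "s \<in> inversions w" "w \<in> carrier W" for w
    using len_inversion_less[OF that(2,1)] len_mult_le[of s "s \<odot> w"] assms that by simp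
  show "s \<in> inversions w \<Longrightarrow> len w = Suc (len (s \<odot> w))" using * assms by simp
  show "s \<notin> inversions w \<Longrightarrow> len (s \<odot> w) = Suc (len w)"
    using *[of "s \<odot> w"] gen_inversion_iff assms by simp
qed

lemma len_left_less_iff:
  assumes "s \<in> S" "w \<in> carrier W"
  shows "len w < len (s \<odot> w) \<longleftrightarrow> s \<notin> inversions w"
    and "len (s \<odot> w) < len w \<longleftrightarrow> s \<in> inversions w"
  using len_left_gen[OF assms] by (metis less_Suc_eq less_asym)+

definition is_reflection where "is_reflection r \<longleftrightarrow> (\<exists>g\<in>carrier W. \<exists>s\<in>S. r = conj_by g s)"

text \<open>
  A reflection is an inversion of itself: writing it as \<open>g s g\<^sup>-\<^sup>1\<close>, the contributions of \<open>g\<close> and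
  \<open>g\<^sup>-\<^sup>1\<close> in the cocycle rule cancel and the one of \<open>s\<close> remains.
\<close>

lemma refl_inversion_iff:
  assumes "is_reflection r" "w \<in> carrier W"
  shows "r \<in> inversions (r \<odot> w) \<longleftrightarrow> r \<notin> inversions w"
    and "r \<odot> r = e" "r \<in> carrier W"
proof -
  obtain g s where g: "g \<in> carrier W" "s \<in> S" "r = conj_by g s"
    using assms by (auto simp: is_reflection_def)
  then show rc: "r \<in> carrier W" by simp
  show rr: "r \<odot> r = e" using g by (simp add: conj_by_def m_assoc) (simp flip: m_assoc)
  have "conj_by (iv g) r = s" using g by simp
  then have "r \<in> inversions g \<longleftrightarrow> s \<in> inversions (iv g)"
    using inversions_mult[of g "iv g" r] g by simp
  moreover have "r = g \<odot> (s \<odot> iv g)" using g by (simp add: conj_by_def m_assoc)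
  ultimately have "r \<in> inversions r"
    using inversions_mult[of g "s \<odot> iv g" r] gen_inversion_iff[of s "iv g"] g rc \<open>conj_by (iv g) r = s\<close>
    by simp
  moreover have "conj_by (iv r) r = r" using rc by (simp add: conj_by_def)
  ultimately show "r \<in> inversions (r \<odot> w) \<longleftrightarrow> r \<notin> inversions w"
    using inversions_mult[of r w r] assms rc by simp
qed

lemma len_refl_less_iff:
  assumes "is_reflection r" "w \<in> carrier W"
  shows "len (r \<odot> w) < len w \<longleftrightarrow> r \<in> inversions w"
    and "len w < len (r \<odot> w) \<longleftrightarrow> r \<notin> inversions w"
proof -
  have 1: "len (r \<odot> w) < len w" if "r \<in> inversions w"
    using that len_inversion_less assms by blast
  have 2: "len w < len (r \<odot> w)" if "r \<notin> inversions w"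
  proof -
    have "len (r \<odot> (r \<odot> w)) < len (r \<odot> w)"
      using that refl_inversion_iff[OF assms] assms by (intro len_inversion_less) auto
    then show ?thesis using refl_inversion_iff[OF assms] assms by (simp flip: m_assoc)
  qed
  show "len (r \<odot> w) < len w \<longleftrightarrow> r \<in> inversions w" "len w < len (r \<odot> w) \<longleftrightarrow> r \<notin> inversions w"
    using 1 2 by force+
qed

lemma len_right_less_iff:
  assumes "w \<in> carrier W" "t \<in> S"
  shows "len w < len (w \<odot> t) \<longleftrightarrow> conj_by w t \<notin> inversions w"
  using len_refl_less_iff(2)[of "conj_by w t" w] assms
  by (auto simp: is_reflection_def conj_by_mult_right)

lemma len_right_gen:
  assumes "w \<in> carrier W" "t \<in> S"
  shows "len w < len (w \<odot> t) \<Longrightarrow> len (w \<odot> t) = Suc (len w)"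
    and "\<not> len w < len (w \<odot> t) \<Longrightarrow> len w = Suc (len (w \<odot> t))"
proof -
  show "len w < len (w \<odot> t) \<Longrightarrow> len (w \<odot> t) = Suc (len w)"
    using len_mult_le[of w t] assms by simp
  assume "\<not> len w < len (w \<odot> t)"
  then have "len (w \<odot> t) < len w"
    using len_refl_less_iff[of "conj_by w t" w] assms
    by (auto simp: is_reflection_def conj_by_mult_right)
  then show "len w = Suc (len (w \<odot> t))" using len_mult_le[of "w \<odot> t" t] assms by simp
qed

text \<open>
  Together with the mirror image below, this is the form of the exchange condition by which the
  left and right operators of the Hecke algebra commute: right multiplication by \<open>t\<close> changes
  whether \<open>s\<close> is a left descent only in the degenerate case \<open>sw = wt\<close>.
\<close>

lemma left_descent_right_mult:
  assumes "s \<in> S" "t \<in> S" "w \<in> carrier W"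
  shows "s \<in> inversions (w \<odot> t) \<longleftrightarrow> (s \<in> inversions w) \<noteq> (s \<odot> w = w \<odot> t)"
proof -
  have "conj_by (iv w) s = t \<longleftrightarrow> s = conj_by w t"
    using assms conj_by_inv_cancel by (metis gen_in)
  also have "\<dots> \<longleftrightarrow> s \<odot> w = w \<odot> t"
    using right_cancel[of w s "conj_by w t"] conj_by_mult_right[of w t] assms by simp
  finally show ?thesis
    using inversions_mult[of w t s] assms by (simp add: inversions_gen)
qed

lemma right_ascent_left_mult:
  assumes "s \<in> S" "t \<in> S" "w \<in> carrier W"
  shows "len (s \<odot> w) < len (s \<odot> w \<odot> t) \<longleftrightarrow> (len w < len (w \<odot> t)) \<noteq> (s \<odot> w = w \<odot> t)"
proof -
  have eq: "conj_by (s \<odot> w) t = s \<longleftrightarrow> s \<odot> w = w \<odot> t"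
  proof -
    have "conj_by (s \<odot> w) t = s \<longleftrightarrow> s \<odot> w \<odot> t = w"
      using right_cancel[of "s \<odot> w" "conj_by (s \<odot> w) t" s] conj_by_mult_right[of "s \<odot> w" t] assms
      by simp
    also have "\<dots> \<longleftrightarrow> s \<odot> w = w \<odot> t"
      using right_cancel[of t "s \<odot> w \<odot> t" w] assms by (auto simp del: right_cancel)
    finally show ?thesis .
  qed
  have "conj_by s (conj_by (s \<odot> w) t) = conj_by w t"
    using assms by (simp flip: conj_by_mult)
  then have "conj_by (s \<odot> w) t \<in> inversions (s \<odot> w) \<longleftrightarrow> (s \<odot> w = w \<odot> t) \<noteq> (conj_by w t \<in> inversions w)"
    using inversions_mult[of s w "conj_by (s \<odot> w) t"] assms eq by (simp add: inversions_gen)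
  then show ?thesis using assms by (auto simp: len_right_less_iff)
qed

section \<open>Finiteness of lower Bruhat intervals\<close>

lemma bruhat_le_cases:
  assumes "bruhat_le X x w" "w \<in> carrier W"
  shows "x \<in> carrier W \<and> (x = w \<or> len x < len w)"
proof -
  have "x \<in> carrier W \<and> len x \<le> len w \<and> (x = w \<or> len x < len w)"
    using assms(1) unfolding bruhat_le_def
    by (induction rule: converse_rtrancl_induct) (use assms(2) in auto)
  then show ?thesis by simp
qed

lemma bruhat_refl [simp]: "bruhat_le X x x"
  by (simp add: bruhat_le_def)

text \<open>
  Going down in the Bruhat order deletes a letter from any given word of the larger element. The
  conclusion only records the letters and the length, which is enough to make lower intervals
  finite.
\<close>

lemma bruhat_subword:
  assumes "bruhat_le X x w" "set ss \<subseteq> S" "word_prod X ss = w"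
  shows "\<exists>ts. set ts \<subseteq> set ss \<and> length ts \<le> length ss \<and> word_prod X ts = x"
  using assms(1) unfolding bruhat_le_def
proof (induction rule: converse_rtrancl_induct)
  case (step y z)
  then obtain r where r: "y \<in> carrier W" "z = y \<odot> r" "r \<in> cox_reflections X" "len y < len z" by auto
  obtain ts where ts: "set ts \<subseteq> set ss" "length ts \<le> length ss" "word_prod X ts = z" using step by auto
  obtain g s where g: "g \<in> carrier W" "s \<in> S" "r = conj_by g s"
    using r(3) by (auto simp: cox_reflections_def conj_by_def)
  then have rr: "is_reflection r" by (auto simp: is_reflection_def)
  \<comment> \<open>Right multiplication by \<open>r\<close> is left multiplication by the conjugate reflection \<open>r'\<close>.\<close>
  define r' where "r' = conj_by y r"
  have r': "is_reflection r'" unfolding is_reflection_def r'_def using g r(1) conj_by_mult[of y g s] by (metis gen_in m_closed)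
  have zy: "z = r' \<odot> y" using r(1,2) g by (simp add: r'_def conj_by_mult_right)
  then have "r' \<odot> z = y" using refl_inversion_iff[OF r' r(1)] r(1) by (simp flip: m_assoc)
  then have "r' \<in> inversions z" using len_refl_less_iff(1)[OF r', of z] r g by simp
  then obtain i where "y = word_prod X (take i ts @ drop (Suc i) ts)"
    using reflection_exchange[of ts r'] ts assms(2) \<open>r' \<odot> z = y\<close> by (metis subset_trans)
  moreover have "set (take i ts @ drop (Suc i) ts) \<subseteq> set ss" using set_delete ts by blast
  moreover have "length (take i ts @ drop (Suc i) ts) \<le> length ss" using ts by simp
  ultimately show ?case by metis
qed (use assms in auto)

lemma finite_bruhat:
  assumes "w \<in> carrier W"
  shows "finite {x. bruhat_le X x w}"
proof -
  obtain ss where ss: "set ss \<subseteq> S" "word_prod X ss = w" using ex_word assms by auto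
  have "{x. bruhat_le X x w} \<subseteq> word_prod X ` {ts. set ts \<subseteq> set ss \<and> length ts \<le> length ss}"
    using bruhat_subword[OF _ ss] by blast
  then show ?thesis using finite_lists_length_le[of "set ss"] by (auto intro: finite_subset)
qed

section \<open>Braids in dihedral subgroups\<close>

abbreviation alt_prod where "alt_prod s t k \<equiv> word_prod X (alt_word s t k)"

lemma alt_prod_closed [simp]: "s \<in> S \<Longrightarrow> t \<in> S \<Longrightarrow> alt_prod s t k \<in> carrier W"
  using alt_word_in by (intro word_prod_closed)

lemma pow_eq_alt_prod:
  assumes "s \<in> S" "t \<in> S"
  shows "(s \<odot> t) [^]\<^bsub>W\<^esub> k = alt_prod s t k \<odot> iv (alt_prod t s k)"
  using assms
proof (induction k arbitrary: s t)
  case (Suc k)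
  have "(t \<odot> s) [^]\<^bsub>W\<^esub> k \<odot> t = t \<odot> (s \<odot> t) [^]\<^bsub>W\<^esub> k"
    using pow_gen_swap[of t s k] Suc.prems by simp
  then have "(s \<odot> t) [^]\<^bsub>W\<^esub> Suc k = s \<odot> ((t \<odot> s) [^]\<^bsub>W\<^esub> k \<odot> t)"
    using nat_pow_Suc2[of "s \<odot> t" k] Suc.prems by (simp add: m_assoc)
  then show ?case using Suc.prems Suc.IH[of t s] by (simp add: inv_mult_group m_assoc)
qed simp

lemma pow_eq_one_iff:
  assumes "s \<in> S" "t \<in> S"
  shows "(s \<odot> t) [^]\<^bsub>W\<^esub> (k::nat) = e \<longleftrightarrow> alt_prod s t k = alt_prod t s k"
proof -
  have "alt_prod s t k \<odot> iv (alt_prod t s k) = e \<longleftrightarrow> alt_prod s t k \<odot> iv (alt_prod t s k) \<odot> alt_prod t s k = alt_prod t s k"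
    using assms right_cancel[of "alt_prod t s k" "alt_prod s t k \<odot> iv (alt_prod t s k)" e] by (auto simp del: right_cancel)
  then show ?thesis using pow_eq_alt_prod[OF assms, of k] assms by (simp add: m_assoc)
qed

definition braid :: "'s list set \<Rightarrow> 's list set \<Rightarrow> nat \<Rightarrow> bool" where
  "braid s t m \<longleftrightarrow> s \<in> S \<and> t \<in> S \<and> s \<noteq> t \<and> 0 < m \<and> alt_prod s t m = alt_prod t s m \<and>
     (\<forall>k. 0 < k \<and> k < m \<longrightarrow> alt_prod s t k \<noteq> alt_prod t s k)"

lemma braid_sym: "braid s t m \<longleftrightarrow> braid t s m"
  by (auto simp: braid_def)

lemma braidD:
  assumes "braid s t m"
  shows "s \<in> S" "t \<in> S" "s \<noteq> t" "0 < m" "alt_prod s t m = alt_prod t s m" "1 < m"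
    "0 < k \<Longrightarrow> k < m \<Longrightarrow> alt_prod s t k \<noteq> alt_prod t s k"
  using assms by (auto simp: braid_def nat_neq_iff intro!: Suc_lessI)

lemma braid_reduced:
  assumes "braid s t m" "k \<le> m"
  shows "reduced_expr X (alt_prod s t k) (alt_word s t k)"
proof -
  note b = braidD[OF assms(1)]
  have "refl_list (alt_word s t k) ! i \<noteq> refl_list (alt_word s t k) ! j" if "i < j" "j < k" for i j
  proof
    assume "refl_list (alt_word s t k) ! i = refl_list (alt_word s t k) ! j"
    then have "(s \<odot> t) [^]\<^bsub>W\<^esub> i \<odot> s = (s \<odot> t) [^]\<^bsub>W\<^esub> j \<odot> s"
      using nth_refl_list_alt_word[OF b(1,2)] that by simp
    also have "(s \<odot> t) [^]\<^bsub>W\<^esub> j = (s \<odot> t) [^]\<^bsub>W\<^esub> i \<odot> (s \<odot> t) [^]\<^bsub>W\<^esub> (j - i)"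
      using b that by (simp add: nat_pow_mult)
    finally have "(s \<odot> t) [^]\<^bsub>W\<^esub> i = (s \<odot> t) [^]\<^bsub>W\<^esub> i \<odot> (s \<odot> t) [^]\<^bsub>W\<^esub> (j - i)"
      using b by (simp add: right_cancel)
    then have "(s \<odot> t) [^]\<^bsub>W\<^esub> (j - i) = e"
      using b by (metis m_closed gen_in nat_pow_closed l_cancel_one')
    then show False using pow_eq_one_iff[OF b(1,2)] b(7)[of "j - i"] that assms by simp
  qed
  then have "distinct (refl_list (alt_word s t k))"
    by (simp add: distinct_conv_nth) (metis nat_neq_iff)
  then show ?thesis using reduced_iff_distinct alt_word_in b by metis
qed

lemma len_braid: "braid s t m \<Longrightarrow> k \<le> m \<Longrightarrow> len (alt_prod s t k) = k"
  using reducedD(3)[OF braid_reduced] by simp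

text \<open>
  The left descent \<open>t\<close> deletes a letter from the word (alternating word) @ (word of \<open>r\<close>). If the
  letter lies in the second part, then the alternating prefix can be made longer. Otherwise \<open>t\<close>
  is a reflection \<open>(st)\<^sup>i s\<close> of the prefix, so that \<open>st\<close> has finite order; distinctness of the
  reflections of a reduced word shows that this order is exactly \<open>k\<close>.
\<close>

lemma dihedral_prefix:
  assumes "s \<in> S" "t \<in> S" "s \<noteq> t" "w \<in> carrier W" "t \<in> inversions w"
    and "r \<in> carrier W" "w = alt_prod s t k \<odot> r" "len w = k + len r"
    and maximal: "\<And>r. r \<in> carrier W \<Longrightarrow> w = alt_prod t s (Suc k) \<odot> r \<Longrightarrow> len w \<noteq> Suc k + len r"
  shows "braid s t k"
proof -
  obtain ss where ss: "reduced_expr X r ss" using ex_reduced assms by auto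
  note d = reducedD[OF ss]
  let ?u = "alt_word s t k @ ss"
  have u: "set (alt_word s t k) \<subseteq> S" using alt_word_in assms by metis
  then have su: "set ?u \<subseteq> S" using d by simp
  have pu: "word_prod X ?u = w" using d u assms by simp
  have red: "reduced_expr X w ?u" using su pu d assms by (simp add: reduced_expr_def)
  obtain i where i: "i < length ?u" "t = refl_list ?u ! i"
    "t \<odot> w = word_prod X (take i ?u @ drop (Suc i) ?u)"
    using reflection_exchange[OF su] pu assms(5) by metis
  show ?thesis
  proof (cases "i < k")
    case False
    let ?v = "take (i - k) ss @ drop (Suc i - k) ss"
    have v: "set ?v \<subseteq> S" using set_delete d by blast
    have "take i ?u @ drop (Suc i) ?u = alt_word s t k @ ?v" using False by simp
    then have "t \<odot> w = alt_prod s t k \<odot> word_prod X ?v" using i(3) word_prod_append[OF u v] by argo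
    then have "t \<odot> (t \<odot> w) = alt_prod t s (Suc k) \<odot> word_prod X ?v"
      using v assms by (simp add: m_assoc)
    then have w: "w = alt_prod t s (Suc k) \<odot> word_prod X ?v" using assms by simp
    have "len (word_prod X ?v) \<le> length ?v" using len_le v by blast
    also have "Suc (length ?v) \<le> len r" using False i d by auto
    finally have le: "Suc k + len (word_prod X ?v) \<le> len w" using assms by simp
    have "len w \<le> len (alt_prod t s (Suc k)) + len (word_prod X ?v)"
      using w v len_mult_le[of "alt_prod t s (Suc k)" "word_prod X ?v"] assms by simp
    moreover have "len (alt_prod t s (Suc k)) \<le> Suc k"
      using len_le[of "alt_word t s (Suc k)"] alt_word_in[of t S s "Suc k"] assms by simp
    ultimately show ?thesis using maximal[OF _ w] v le by auto
  next
    case True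
    have dist: "distinct (refl_list (alt_word s t k))"
      using distinct_refl_list[OF red] refl_list_append[OF u d(1)] by simp
    have "t = (s \<odot> t) [^]\<^bsub>W\<^esub> i \<odot> s"
      using i(2) True refl_list_append[OF u d(1)] nth_refl_list_alt_word[OF assms(1,2) True]
      by (simp add: nth_append)
    then have "(s \<odot> t) [^]\<^bsub>W\<^esub> i \<odot> s \<odot> t = e" using assms by (metis gen_sq)
    then have "(s \<odot> t) [^]\<^bsub>W\<^esub> Suc i = e" using assms by (simp add: m_assoc)
    then have ex: "0 < Suc i \<and> alt_prod s t (Suc i) = alt_prod t s (Suc i)"
      using pow_eq_one_iff assms by blast
    define m where "m = (LEAST m. 0 < m \<and> alt_prod s t m = alt_prod t s m)"
    have m: "0 < m \<and> alt_prod s t m = alt_prod t s m" unfolding m_def by (rule LeastI[of _ "Suc i"]) (rule ex)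
    have least: "m \<le> k'" if "0 < k'" "alt_prod s t k' = alt_prod t s k'" for k'
      unfolding m_def using that by (intro Least_le) auto
    have "m \<le> Suc i" using least ex by blast
    moreover have "\<not> m < k"
    proof
      assume mk: "m < k"
      have "(s \<odot> t) [^]\<^bsub>W\<^esub> m = e" using m pow_eq_one_iff assms by blast
      then have "refl_list (alt_word s t k) ! m = refl_list (alt_word s t k) ! 0"
        using mk m nth_refl_list_alt_word[OF assms(1,2)] assms by simp
      then show False using dist mk m by (simp add: nth_eq_iff_index_eq)
    qed
    ultimately have "m = k" using True by simp
    then show ?thesis using m least assms unfolding braid_def by (metis not_le)
  qed
qed

text \<open>
  Two distinct left descents generate a finite dihedral group, whose longest element splits off
  on the left: apply the previous lemma to an alternating prefix of maximal length.
\<close>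

lemma two_descents:
  assumes "s \<in> S" "t \<in> S" "s \<noteq> t" "w \<in> carrier W" "s \<in> inversions w" "t \<in> inversions w"
  obtains m r where "braid s t m" "r \<in> carrier W" "w = alt_prod s t m \<odot> r" "len w = m + len r"
proof -
  define D where "D s t k \<longleftrightarrow> (\<exists>r\<in>carrier W. w = alt_prod s t k \<odot> r \<and> len w = k + len r)" for s t k
  \<comment> \<open>The maximum is over prefixes of both kinds, so that neither kind can be extended.\<close>
  define k where "k = Max {k. D s t k \<or> D t s k}"
  have fin: "finite {k. D s t k \<or> D t s k}"
    by (rule finite_subset[of _ "{..len w}"]) (auto simp: D_def)
  have "D s t 1" unfolding D_def
    using assms len_left_gen(1)[of s w] by (intro bexI[of _ "s \<odot> w"]) auto
  then have ne: "{k. D s t k \<or> D t s k} \<noteq> {}" by auto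
  have k: "D s t k \<or> D t s k" using Max_in[OF fin ne] by (simp add: k_def)
  have "Suc k \<notin> {k. D s t k \<or> D t s k}" using Max_ge[OF fin, of "Suc k"] by (auto simp: k_def)
  then have max: "\<not> D s t (Suc k)" "\<not> D t s (Suc k)" by auto
  from k show ?thesis
  proof
    assume "D s t k"
    then obtain r where r: "r \<in> carrier W" "w = alt_prod s t k \<odot> r" "len w = k + len r" by (auto simp: D_def)
    have "braid s t k"
      using max by (intro dihedral_prefix[OF assms(1-4,6) r]) (auto simp: D_def)
    then show ?thesis using that r by blast
  next
    assume "D t s k"
    then obtain r where r: "r \<in> carrier W" "w = alt_prod t s k \<odot> r" "len w = k + len r" by (auto simp: D_def)
    have "braid t s k"
      using max assms by (intro dihedral_prefix[OF _ _ _ _ _ r]) (auto simp: D_def)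
    \<comment> \<open>The two alternating words of length \<open>k\<close> have the same product, so the prefix may start with \<open>s\<close>.\<close>
    then show ?thesis using that[of k r] r braid_sym braidD(5) by metis
  qed
qed

section \<open>Elements that are not fully commutative\<close>

lemma reduced_ConsD:
  assumes "reduced_expr X w (s # ss)"
  shows "s \<in> S" "reduced_expr X (s \<odot> w) ss" "s \<in> inversions w" "len w = Suc (len (s \<odot> w))"
    "w = s \<odot> (s \<odot> w)"
proof -
  note d = reducedD[OF assms]
  show s: "s \<in> S" using d by simp
  have w: "s \<odot> w = word_prod X ss" using d s by auto
  show ws: "w = s \<odot> (s \<odot> w)" using s d by simp
  have "len (s \<odot> w) \<le> length ss" using w len_le d by simp
  moreover have "len w \<le> Suc (len (s \<odot> w))"
    using ws len_mult_le[of s "s \<odot> w"] d s by simp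
  ultimately show l: "len w = Suc (len (s \<odot> w))" using d by simp
  then show "reduced_expr X (s \<odot> w) ss" using d w by (simp add: reduced_expr_def)
  show "s \<in> inversions w" using l len_left_less_iff(2)[OF s d(4)] by simp
qed

lemma reduced_ConsI:
  assumes "s \<in> S" "reduced_expr X w ss" "len (s \<odot> w) = Suc (len w)"
  shows "reduced_expr X (s \<odot> w) (s # ss)"
  using assms by (auto simp: reduced_expr_def)

abbreviation fc where "fc \<equiv> fully_commutative X"
abbreviation comm_rel where "comm_rel \<equiv> (commutation_moves X)\<^sup>*"

lemma comm_sym:
  assumes "(ss, ts) \<in> comm_rel" shows "(ts, ss) \<in> comm_rel"
proof -
  have "sym (commutation_moves X)"
    unfolding sym_def commutation_moves_def by clarify blast
  then show ?thesis using assms by (metis sym_rtrancl symD)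
qed

lemma comm_Cons:
  assumes "(ss, ts) \<in> comm_rel" shows "(s # ss, s # ts) \<in> comm_rel"
  using assms
proof (induction rule: rtrancl_induct)
  case (step us vs)
  have "(s # us, s # vs) \<in> commutation_moves X"
    using step(2) unfolding commutation_moves_def
    by clarsimp (metis append_Cons)
  then show ?case using step by simp
qed simp

lemma comm_swap:
  assumes "s \<in> S" "t \<in> S" "s \<odot> t = t \<odot> s"
  shows "(s # t # ss, t # s # ss) \<in> comm_rel"
proof -
  have "([] @ [s, t] @ ss, [] @ [t, s] @ ss) \<in> commutation_moves X"
    using assms unfolding commutation_moves_def by blast
  then show ?thesis by auto
qed

lemma fcD: "w \<in> fc \<Longrightarrow> reduced_expr X w ss \<Longrightarrow> reduced_expr X w ts \<Longrightarrow> (ss, ts) \<in> comm_rel"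
  "w \<in> fc \<Longrightarrow> w \<in> carrier W"
  by (auto simp: fully_commutative_def)

lemma braid_2:
  assumes "braid s t m" "s \<odot> t = t \<odot> s"
  shows "m = 2"
proof (rule ccontr)
  assume "m \<noteq> 2"
  then have "2 < m" using braidD(6)[OF assms(1)] by simp
  moreover have "alt_prod s t 2 = alt_prod t s 2"
    using assms braidD[OF assms(1)] by (simp add: numeral_2_eq_2)
  ultimately show False using braidD(7)[OF assms(1), of 2] by simp
qed

text \<open>
  If \<open>w\<close> has such a factor, then \<open>T\<^sub>w\<close> is a combination of shorter basis elements modulo the ideal.
\<close>

definition long_braid_factor :: "'s list set \<Rightarrow> bool" where
  "long_braid_factor w \<longleftrightarrow> (\<exists>p a b m r. p \<in> carrier W \<and> r \<in> carrier W \<and> braid a b m \<and>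
     a \<odot> b \<noteq> b \<odot> a \<and> w = p \<odot> alt_prod a b m \<odot> r \<and> len w = len p + m + len r)"

lemma long_braid_factor_mult:
  assumes "long_braid_factor w" "s \<in> S" "w \<in> carrier W" "len (s \<odot> w) = Suc (len w)"
  shows "long_braid_factor (s \<odot> w)"
proof -
  obtain p a b m r where *: "p \<in> carrier W" "r \<in> carrier W" "braid a b m" "a \<odot> b \<noteq> b \<odot> a"
    "w = p \<odot> alt_prod a b m \<odot> r" "len w = len p + m + len r"
    using assms(1) unfolding long_braid_factor_def by blast
  note b = braidD[OF *(3)]
  have eq: "s \<odot> w = (s \<odot> p) \<odot> alt_prod a b m \<odot> r" using * b assms by (simp add: m_assoc)
  have "len (s \<odot> w) \<le> len ((s \<odot> p) \<odot> alt_prod a b m) + len r"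
    unfolding eq using * b assms by (intro len_mult_le) auto
  moreover have "len ((s \<odot> p) \<odot> alt_prod a b m) \<le> len (s \<odot> p) + m"
    using len_mult_le[of "s \<odot> p" "alt_prod a b m"] len_braid[OF *(3), of m] * b assms by simp
  moreover have "len (s \<odot> p) \<le> Suc (len p)" using len_mult_le[of s p] * assms by simp
  ultimately have "len (s \<odot> w) = len (s \<odot> p) + m + len r" using *(6) assms(4) by simp
  then show ?thesis unfolding long_braid_factor_def using eq * assms(2) by (metis gen_in m_closed)
qed

lemma long_braid_factorI:
  assumes "braid a b m" "a \<odot> b \<noteq> b \<odot> a" "r \<in> carrier W" "w = alt_prod a b m \<odot> r" "len w = m + len r"
  shows "long_braid_factor w"
  unfolding long_braid_factor_def
  using assms braidD(1,2)[OF assms(1)] by (intro exI[of _ e] exI[of _ a] exI[of _ b] exI[of _ m] exI[of _ r]) auto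

text \<open>
  If the two descents commute, then the dihedral group has order 4 and both generators can be
  moved to the front.
\<close>

lemma commuting_descents:
  assumes "braid s t m" "s \<odot> t = t \<odot> s" "r \<in> carrier W" "w = alt_prod s t m \<odot> r" "len w = m + len r"
  shows "w = s \<odot> (t \<odot> r)" "w = t \<odot> (s \<odot> r)" "s \<odot> w = t \<odot> r" "t \<odot> w = s \<odot> r"
    "len (s \<odot> r) = Suc (len r)" "len (t \<odot> r) = Suc (len r)" "len w = Suc (Suc (len r))"
proof -
  note b = braidD[OF assms(1)]
  have m: "m = 2" by (rule braid_2[OF assms(1,2)])
  show w: "w = s \<odot> (t \<odot> r)" using assms(3,4) b(1,2) m by (simp add: numeral_2_eq_2 m_assoc)
  then show w': "w = t \<odot> (s \<odot> r)"
    using m_assoc[of s t r] m_assoc[of t s r] assms(2,3) b(1,2) by simp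
  show "s \<odot> w = t \<odot> r" unfolding w using b(1,2) assms(3) by simp
  show "t \<odot> w = s \<odot> r" unfolding w' using b(2) b(1) assms(3) by simp
  show l: "len w = Suc (Suc (len r))" using assms m by simp
  show "len (s \<odot> r) = Suc (len r)" "len (t \<odot> r) = Suc (len r)"
    using len_mult_le[of t "s \<odot> r"] len_mult_le[of s "t \<odot> r"] len_mult_le[of t r] len_mult_le[of s r]
      arg_cong[OF w, of len] arg_cong[OF w', of len] l b(1,2) assms(3) by auto
qed

text \<open>
  Induction on the length. Take two reduced expressions that commutations do not connect. If they
  have the same first letter, then the letter is removed. If the first letters differ, then they are
  two descents, so either a long braid splits off, or they commute and both expressions are compared
  with one that starts with both letters.
\<close>

lemma not_fc_long_braid_factor:
  assumes "w \<in> carrier W" "w \<notin> fc"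
  shows "long_braid_factor w"
  using assms
proof (induction "len w" arbitrary: w rule: less_induct)
  case less
  obtain ss ts where st: "reduced_expr X w ss" "reduced_expr X w ts" "(ss, ts) \<notin> comm_rel"
    using less.prems by (auto simp: fully_commutative_def)
  obtain s ss' where ss: "ss = s # ss'"
    using st by (cases ss) (auto simp: reduced_expr_def)
  obtain t ts' where ts: "ts = t # ts'"
    using st by (cases ts) (auto simp: reduced_expr_def)
  note s = reduced_ConsD[OF st(1)[unfolded ss]] and t = reduced_ConsD[OF st(2)[unfolded ts]]
  have fc_or: "v \<in> fc \<or> long_braid_factor w" if "u \<in> S" "u \<in> inversions w" "v = u \<odot> w" for u v
  proof -
    have "len w = Suc (len v)" using that len_left_gen(1) less.prems by simp
    moreover have v: "v \<in> carrier W" "w = u \<odot> v" using that less.prems by simp_all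
    ultimately have "v \<in> fc \<or> long_braid_factor v" using less.hyps[of v] by auto
    then show ?thesis
      using long_braid_factor_mult[OF _ that(1) v(1)] v(2) \<open>len w = Suc (len v)\<close> by auto
  qed
  show ?case
  proof (cases "s = t")
    case True
    then have "(ss', ts') \<notin> comm_rel" using st ss ts comm_Cons by metis
    then have "s \<odot> w \<notin> fc" using s(2) t(2) True fcD by blast
    then show ?thesis using fc_or[of s "s \<odot> w"] s by blast
  next
    case False
    obtain m r where r: "braid s t m" "r \<in> carrier W" "w = alt_prod s t m \<odot> r" "len w = m + len r"
      using two_descents[OF s(1) t(1) False less.prems(1) s(3) t(3)] by metis
    show ?thesis
    proof (cases "s \<odot> t = t \<odot> s")
      case False
      then show ?thesis using long_braid_factorI r by blast
    next
      case True
      note c = commuting_descents[OF r(1) True r(2-4)]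
      obtain rw where rw: "reduced_expr X r rw" using ex_reduced r by auto
      have "reduced_expr X (s \<odot> w) (t # rw)" "reduced_expr X (t \<odot> w) (s # rw)"
        using reduced_ConsI[OF t(1) rw] reduced_ConsI[OF s(1) rw] c by simp_all
      moreover have "(s # t # rw, t # s # rw) \<in> comm_rel" using comm_swap s t True by blast
      ultimately have "s \<odot> w \<notin> fc \<or> t \<odot> w \<notin> fc"
        using fcD(1)[of "s \<odot> w" ss' "t # rw"] fcD(1)[of "t \<odot> w" "s # rw" ts'] s(2) t(2) st(3) ss ts
          comm_Cons by (meson rtrancl_trans)
      then show ?thesis using fc_or s t by blast
    qed
  qed
qed

text \<open>
  If \<open>z\<close> is fully commutative and \<open>sz\<close> is not, then a new braid word appears. It starts with the new
  letter \<open>s\<close>, which has been moved across a prefix \<open>p\<close> that commutes with it.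
  The induction is on the length of \<open>z\<close>. A reduced expression of \<open>sz\<close> that commutations do not
  connect to the one starting with \<open>s\<close> must start with some \<open>t \<noteq> s\<close>. If \<open>s\<close> and \<open>t\<close> do not commute,
  then \<open>p\<close> is trivial; otherwise \<open>t\<close> is moved into \<open>p\<close>. The first alternative of
  the conclusion allows the induction to be applied to any shorter element.
\<close>

lemma gen_times_not_fc_cases:
  assumes "z \<in> carrier W" "s \<in> S" "s \<notin> inversions z" "s \<odot> z \<notin> fc"
  shows "long_braid_factor z \<or>
    (\<exists>p t m r. p \<in> carrier W \<and> r \<in> carrier W \<and> braid s t m \<and> s \<odot> t \<noteq> t \<odot> s \<and>
       s \<odot> p = p \<odot> s \<and> s \<notin> inversions p \<and>
       z = p \<odot> alt_prod t s (m - 1) \<odot> r \<and> len z = len p + (m - 1) + len r)"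
  using assms
proof (induction "len z" arbitrary: z rule: less_induct)
  case less
  show ?case
  proof (cases "long_braid_factor z")
    case False
    then have zfc: "z \<in> fc" using not_fc_long_braid_factor less.prems by blast
    obtain ss where ss: "reduced_expr X z ss" using ex_reduced less.prems by metis
    have sz: "len (s \<odot> z) = Suc (len z)" using len_left_gen less.prems by blast
    have sss: "reduced_expr X (s \<odot> z) (s # ss)" using reduced_ConsI ss sz less.prems by blast
    obtain ts where ts: "reduced_expr X (s \<odot> z) ts" "(s # ss, ts) \<notin> comm_rel"
    proof -
      obtain us vs where "reduced_expr X (s \<odot> z) us" "reduced_expr X (s \<odot> z) vs" "(us, vs) \<notin> comm_rel"
        using less.prems by (auto simp: fully_commutative_def)
      then show ?thesis using that comm_sym by (meson rtrancl_trans)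
    qed
    obtain t ts' where tts: "ts = t # ts'"
      using ts sz by (cases ts) (auto simp: reduced_expr_def)
    note t = reduced_ConsD[OF ts(1)[unfolded tts]]
    have "s \<noteq> t"
    proof
      assume "s = t"
      then have "reduced_expr X z ts'" using t less.prems by simp
      then have "(ss, ts') \<in> comm_rel" using fcD zfc ss by blast
      then show False using ts(2) tts comm_Cons \<open>s = t\<close> by blast
    qed
    have sin: "s \<in> inversions (s \<odot> z)" using gen_inversion_iff less.prems by blast
    obtain m r where r: "braid s t m" "r \<in> carrier W" "s \<odot> z = alt_prod s t m \<odot> r" "len (s \<odot> z) = m + len r"
      using two_descents[OF less.prems(2) t(1) \<open>s \<noteq> t\<close> _ sin t(3)] less.prems by auto
    show ?thesis
    proof (cases "s \<odot> t = t \<odot> s")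
      case False
      obtain m' where m': "m = Suc m'" using braidD(4)[OF r(1)] gr0_implies_Suc by blast
      then have "s \<odot> (s \<odot> z) = alt_prod t s m' \<odot> r"
        unfolding r(3) using braidD(1,2)[OF r(1)] r(2) m' by (simp add: m_assoc)
      then have "z = e \<odot> alt_prod t s (m - 1) \<odot> r" using less.prems m' t(1) by simp
      moreover have "len z = len e + (m - 1) + len r" using sz r m' by simp
      moreover have "s \<odot> e = e \<odot> s" "s \<notin> inversions e" using less.prems by simp_all
      ultimately show ?thesis using r(1,2) False one_closed by blast
    next
      case True
      note c = commuting_descents[OF r(1) True r(2-4)]
      obtain rw where rw: "reduced_expr X r rw" using ex_reduced r by auto
      have zr: "z = t \<odot> r" using c(3) less.prems by simp
      have sr: "s \<notin> inversions r" using len_left_less_iff(1)[of s r] c(5) r(2) less.prems by simp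
      have "reduced_expr X z (t # rw)" using reduced_ConsI[OF t(1) rw] c zr by simp
      then have 1: "(ss, t # rw) \<in> comm_rel" using fcD zfc ss by blast
      have 2: "reduced_expr X (s \<odot> r) (s # rw)" using reduced_ConsI[OF less.prems(2) rw] c by simp
      have 3: "reduced_expr X (s \<odot> r) ts'" using t(2) c by simp
      have "(s # t # rw, t # s # rw) \<in> comm_rel" using comm_swap less.prems t True by blast
      then have "s \<odot> r \<notin> fc"
        using fcD(1)[OF _ 2 3] comm_Cons[OF 1, of s] comm_Cons[of "s # rw" ts' t] ts(2) tts
        by (meson rtrancl_trans)
      moreover have "len r < len z" using c(7) sz by simp
      moreover have "\<not> long_braid_factor r"
        using long_braid_factor_mult[of r t] False zr c t(1) r(2) by auto
      ultimately obtain p t' m' r' where p: "p \<in> carrier W" "r' \<in> carrier W" "braid s t' m'"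
        "s \<odot> t' \<noteq> t' \<odot> s" "s \<odot> p = p \<odot> s" "s \<notin> inversions p"
        "r = p \<odot> alt_prod t' s (m' - 1) \<odot> r'" "len r = len p + (m' - 1) + len r'"
        using less.hyps[of r] sr r(2) less.prems(2) by blast
      note b = braidD[OF p(3)]
      have a: "alt_prod t' s (m' - 1) \<in> carrier W" "len (alt_prod t' s (m' - 1)) = m' - 1"
        using b len_braid[of t' s m' "m' - 1"] p(3) braid_sym by auto
      have z: "z = (t \<odot> p) \<odot> alt_prod t' s (m' - 1) \<odot> r'" using zr p t(1) a by (simp add: m_assoc)
      have "len z \<le> len ((t \<odot> p) \<odot> alt_prod t' s (m' - 1)) + len r'"
        unfolding z using p t a by (intro len_mult_le) auto
      moreover have "len ((t \<odot> p) \<odot> alt_prod t' s (m' - 1)) \<le> len (t \<odot> p) + (m' - 1)"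
        using len_mult_le[of "t \<odot> p" "alt_prod t' s (m' - 1)"] p t a by simp
      moreover have "len (t \<odot> p) \<le> Suc (len p)" using len_mult_le[of t p] p t by simp
      ultimately have lz: "len z = len (t \<odot> p) + (m' - 1) + len r'"
        using c(6) zr p(8) by simp
      have "s \<odot> (t \<odot> p) = (s \<odot> t) \<odot> p" using p(1) t(1) less.prems by (simp add: m_assoc)
      also have "\<dots> = t \<odot> (s \<odot> p)" unfolding True using p(1) t(1) less.prems by (simp add: m_assoc)
      also have "\<dots> = t \<odot> p \<odot> s" unfolding p(5) using p(1) t(1) less.prems by (simp add: m_assoc)
      finally have comm: "s \<odot> (t \<odot> p) = t \<odot> p \<odot> s" .
      have "conj_by (iv t) s = s"
        using True t(1) less.prems by (simp add: conj_by_def flip: True)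
      then have "s \<notin> inversions (t \<odot> p)"
        using inversions_mult[of t p s] p t(1) less.prems \<open>s \<noteq> t\<close> by (simp add: inversions_gen)
      then show ?thesis using z lz comm p t(1) by (metis gen_in m_closed)
    qed
  qed simp
qed

end

section \<open>Linear algebra over Laurent polynomials\<close>

lemma lookup_hscale: "Poly_Mapping.lookup (hscale a f) w = a * Poly_Mapping.lookup f w"
  by (simp add: hscale_def Poly_Mapping.map.rep_eq when_def)

interpretation hmod: module "hscale :: laurent \<Rightarrow> 's hecke \<Rightarrow> 's hecke"
  by unfold_locales
    (auto intro!: poly_mapping_eqI simp: lookup_hscale lookup_add algebra_simps)

interpretation hpair: module_pair "hscale :: laurent \<Rightarrow> 's hecke \<Rightarrow> 's hecke" "hscale :: laurent \<Rightarrow> 's hecke \<Rightarrow> 's hecke" ..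

lemma lookup_hT: "Poly_Mapping.lookup (hT w) x = (if x = w then 1 else 0)"
  by (simp add: hT_def lookup_single when_def)

lemma keys_hscale: "Poly_Mapping.keys (hscale a f) \<subseteq> Poly_Mapping.keys f"
  by (auto simp: in_keys_iff lookup_hscale)

lemma keys_hT [simp]: "Poly_Mapping.keys (hT w) = {w}"
  by (simp add: hT_def)

lemma hecke_expand: "finite A \<Longrightarrow> Poly_Mapping.keys f \<subseteq> A \<Longrightarrow> f = (\<Sum>w\<in>A. hscale (Poly_Mapping.lookup f w) (hT w))"
  by (rule poly_mapping_eqI)
    (auto simp: lookup_sum lookup_hscale lookup_hT in_keys_iff if_distrib cong: if_cong)

text \<open>
  The induction principle used throughout: membership in a submodule may be checked on the basis
  elements that occur.
\<close>

lemma subspace_keysI: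
  assumes "hmod.subspace A" "\<And>w. w \<in> Poly_Mapping.keys f \<Longrightarrow> hT w \<in> A"
  shows "f \<in> A"
  by (subst hecke_expand[OF finite_keys subset_refl])
    (use assms in \<open>auto intro: hmod.subspace_sum hmod.subspace_scale\<close>)

lemma subspace_keys: "hmod.subspace {f :: 's hecke. Poly_Mapping.keys f \<subseteq> A}"
proof (rule hmod.subspaceI)
  show "x + y \<in> {f. Poly_Mapping.keys f \<subseteq> A}"
    if "x \<in> {f. Poly_Mapping.keys f \<subseteq> A}" "y \<in> {f. Poly_Mapping.keys f \<subseteq> A}" for x y :: "'s hecke"
    using keys_add[of x y] that by blast
  show "hscale c x \<in> {f. Poly_Mapping.keys f \<subseteq> A}"
    if "x \<in> {f. Poly_Mapping.keys f \<subseteq> A}" for x :: "'s hecke" and c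
    using keys_hscale[of c x] that by blast
qed simp

abbreviation hlinear :: "('s hecke \<Rightarrow> 's hecke) \<Rightarrow> bool" where
  "hlinear \<equiv> module_hom hscale hscale"

text \<open>
  Both multiplications on the Hecke algebra are instances of linear extension from the basis.
\<close>

definition lin_ext :: "('s list set \<Rightarrow> 's hecke) \<Rightarrow> 's hecke \<Rightarrow> 's hecke" where
  "lin_ext F f = (\<Sum>w\<in>Poly_Mapping.keys f. hscale (Poly_Mapping.lookup f w) (F w))"

lemma lin_ext_superset:
  "finite A \<Longrightarrow> Poly_Mapping.keys f \<subseteq> A \<Longrightarrow> lin_ext F f = (\<Sum>w\<in>A. hscale (Poly_Mapping.lookup f w) (F w))"
  unfolding lin_ext_def by (intro sum.mono_neutral_left) (auto simp: in_keys_iff)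

lemma hlinear_lin_ext: "hlinear (lin_ext F)"
proof -
  have "lin_ext F (f + g) = lin_ext F f + lin_ext F g" for f g
  proof -
    let ?A = "Poly_Mapping.keys f \<union> Poly_Mapping.keys g"
    have "lin_ext F h = (\<Sum>w\<in>?A. hscale (Poly_Mapping.lookup h w) (F w))"
      if "Poly_Mapping.keys h \<subseteq> ?A" for h
      using that by (intro lin_ext_superset) auto
    then show ?thesis using keys_add[of f g]
      by (simp add: lookup_add hmod.scale_left_distrib sum.distrib)
  qed
  moreover have "lin_ext F (hscale a f) = hscale a (lin_ext F f)" for a f
    using lin_ext_superset[OF _ keys_hscale[of a f], of F]
    by (simp add: lookup_hscale hmod.scale_sum_right lin_ext_def)
  ultimately show ?thesis by (simp add: module_hom_iff hmod.module_axioms)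
qed

lemma lin_ext_hT [simp]: "lin_ext F (hT w) = F w"
  by (simp add: lin_ext_def lookup_hT)

lemma hlinear_eqI:
  assumes "hlinear \<phi>" "hlinear \<psi>" "\<And>w. w \<in> Poly_Mapping.keys f \<Longrightarrow> \<phi> (hT w) = \<psi> (hT w)"
  shows "\<phi> f = \<psi> f"
proof -
  interpret d: module_hom hscale hscale "\<lambda>f. \<phi> f - \<psi> f" by (rule hpair.module_hom_sub[OF assms(1,2)])
  have "f \<in> {f. \<phi> f - \<psi> f = 0}"
    by (rule subspace_keysI) (use assms(3) d.subspace_kernel in auto)
  then show ?thesis by simp
qed

lemma hlinear_compose: "hlinear \<phi> \<Longrightarrow> hlinear \<psi> \<Longrightarrow> hlinear (\<lambda>f. \<phi> (\<psi> f))"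
  by (auto simp: module_hom_iff)

lemma hlinearD:
  assumes "hlinear \<phi>"
  shows "\<phi> (f + g) = \<phi> f + \<phi> g" "\<phi> (hscale a f) = hscale a (\<phi> f)" "\<phi> 0 = 0"
    "\<phi> (f - g) = \<phi> f - \<phi> g" "\<phi> (- f) = - \<phi> f" "\<phi> (sum F A) = (\<Sum>x\<in>A. \<phi> (F x))"
proof -
  interpret module_hom hscale hscale \<phi> by fact
  show "\<phi> (f + g) = \<phi> f + \<phi> g" "\<phi> (hscale a f) = hscale a (\<phi> f)" "\<phi> 0 = 0"
    "\<phi> (f - g) = \<phi> f - \<phi> g" "\<phi> (- f) = - \<phi> f" "\<phi> (sum F A) = (\<Sum>x\<in>A. \<phi> (F x))"
    by (rule add scale zero diff neg sum)+
qed

lemma qh_mult: "qh a * qh b = qh (a + b)"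
  by (simp add: qh_def mult_single)

lemma qh_0 [simp]: "qh 0 = 1"
  by (simp add: qh_def)

context coxeter
begin

section \<open>Left and right multiplication by generators\<close>

abbreviation H where "H \<equiv> carrier (hecke X)"
abbreviation q :: laurent where "q \<equiv> qh 2"

lemma H_iff: "f \<in> H \<longleftrightarrow> Poly_Mapping.keys f \<subseteq> carrier W"
  by (simp add: hecke_def)

lemma H_subspace: "hmod.subspace H"
  using subspace_keys[of "carrier W"] by (simp add: hecke_def)

lemma H_closed [simp]:
  "f \<in> H \<Longrightarrow> g \<in> H \<Longrightarrow> f + g \<in> H" "f \<in> H \<Longrightarrow> hscale a f \<in> H" "0 \<in> H"
  "f \<in> H \<Longrightarrow> g \<in> H \<Longrightarrow> f - g \<in> H" "f \<in> H \<Longrightarrow> - f \<in> H"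
  using H_subspace by (auto intro: hmod.subspace_add hmod.subspace_scale hmod.subspace_0 hmod.subspace_diff hmod.subspace_neg)

lemma H_sum: "(\<And>x. x \<in> A \<Longrightarrow> F x \<in> H) \<Longrightarrow> sum F A \<in> H"
  using H_subspace hmod.subspace_sum by blast

lemma hT_H [simp]: "w \<in> carrier W \<Longrightarrow> hT w \<in> H"
  by (simp add: H_iff)

lemma hlinear_closed:
  assumes "hlinear \<phi>" "f \<in> H" "\<And>w. w \<in> carrier W \<Longrightarrow> \<phi> (hT w) \<in> H"
  shows "\<phi> f \<in> H"
proof -
  interpret module_hom hscale hscale \<phi> by fact
  have "f \<in> {f. \<phi> f \<in> H}"
  proof (rule subspace_keysI)
    show "hmod.subspace {f. \<phi> f \<in> H}" by (rule subspace_linear_preimage[OF H_subspace])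
  qed (use assms in \<open>auto simp: H_iff\<close>)
  then show ?thesis by simp
qed

abbreviation rgen where "rgen s f \<equiv> hecke_times_gen X f s"

lemma rgen_lin_ext: "rgen s f = lin_ext (\<lambda>w. 
   if len w < len (w \<odot> s) then hT (w \<odot> s) else hscale q (hT (w \<odot> s)) + hscale (q - 1) (hT w)) f"
  by (simp add: hecke_times_gen_def lin_ext_def)

lemma rgen_hT:
  "len w < len (w \<odot> s) \<Longrightarrow> rgen s (hT w) = hT (w \<odot> s)"
  "\<not> len w < len (w \<odot> s) \<Longrightarrow> rgen s (hT w) = hscale q (hT (w \<odot> s)) + hscale (q - 1) (hT w)"
  by (simp_all add: rgen_lin_ext)

lemma hlinear_rgen: "hlinear (rgen s)"
  unfolding rgen_lin_ext by (rule hlinear_lin_ext)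

definition lgen where "lgen s = lin_ext (\<lambda>w.
   if s \<notin> inversions w then hT (s \<odot> w) else hscale q (hT (s \<odot> w)) + hscale (q - 1) (hT w))"

lemma lgen_hT:
  "s \<notin> inversions w \<Longrightarrow> lgen s (hT w) = hT (s \<odot> w)"
  "s \<in> inversions w \<Longrightarrow> lgen s (hT w) = hscale q (hT (s \<odot> w)) + hscale (q - 1) (hT w)"
  by (simp_all add: lgen_def)

lemma hlinear_lgen: "hlinear (lgen s)"
  unfolding lgen_def by (rule hlinear_lin_ext)

lemma rgen_closed [simp]: "s \<in> S \<Longrightarrow> f \<in> H \<Longrightarrow> rgen s f \<in> H"
  by (rule hlinear_closed[OF hlinear_rgen]) (auto simp: rgen_lin_ext)

lemma lgen_closed [simp]: "s \<in> S \<Longrightarrow> f \<in> H \<Longrightarrow> lgen s f \<in> H"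
  by (rule hlinear_closed[OF hlinear_lgen]) (auto simp: lgen_def)

lemmas lin_simps = hlinearD[OF hlinear_rgen] hlinearD[OF hlinear_lgen]

text \<open>
  Associativity in its simplest form. If \<open>sw \<noteq> wt\<close>, then each of the two operators acts as if the
  other were absent; if \<open>sw = wt\<close>, then both raise or both lower \<open>w\<close> and agree on it.
\<close>

lemma lgen_rgen_commute:
  assumes "s \<in> S" "t \<in> S" "f \<in> H"
  shows "lgen s (rgen t f) = rgen t (lgen s f)"
proof (rule hlinear_eqI[of "\<lambda>f. lgen s (rgen t f)" "\<lambda>f. rgen t (lgen s f)" f])
  fix w assume "w \<in> Poly_Mapping.keys f"
  then have w: "w \<in> carrier W" using assms by (auto simp: H_iff)
  note l = left_descent_right_mult[OF assms(1,2) w] and r = right_ascent_left_mult[OF assms(1,2) w]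
  have a: "s \<odot> (w \<odot> t) = s \<odot> w \<odot> t" using assms w by (simp add: m_assoc)
  have up: "len w < len (w \<odot> t) \<longleftrightarrow> s \<notin> inversions w" if "s \<odot> w = w \<odot> t"
    using len_left_less_iff(1)[OF assms(1) w] that by simp
  show "lgen s (rgen t (hT w)) = rgen t (lgen s (hT w))"
  proof (cases "s \<odot> w = w \<odot> t")
    case True
    then have "s \<odot> w \<odot> t = w" using assms w by simp
    moreover have "s \<odot> (w \<odot> t) = w" using assms w by (simp flip: True)
    ultimately have st: "s \<odot> w \<odot> t = w" "s \<odot> (w \<odot> t) = w" .
    define u where "u = w \<odot> t"
    have "s \<odot> w = u" "w \<odot> t = u" "s \<odot> u = w" "u \<odot> t = w"
      using True st by (simp_all add: u_def)
    moreover have "s \<in> inversions u \<longleftrightarrow> s \<notin> inversions w" "len w < len u \<longleftrightarrow> s \<notin> inversions w"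
      "len u < len w \<longleftrightarrow> s \<in> inversions w"
      using l r up[OF True] True st by (auto simp: u_def)
    ultimately show ?thesis
      by (cases "s \<in> inversions w") (simp_all add: rgen_hT lgen_hT lin_simps algebra_simps)
  next
    case False
    then show ?thesis using l r a
      by (cases "s \<in> inversions w"; cases "len w < len (w \<odot> t)")
        (simp_all add: rgen_hT lgen_hT lin_simps algebra_simps)
  qed
qed (rule hlinear_compose[OF hlinear_lgen hlinear_rgen] hlinear_compose[OF hlinear_rgen hlinear_lgen])+

lemma rgen_quadratic:
  assumes "s \<in> S" "f \<in> H"
  shows "rgen s (rgen s f) = hscale q f + hscale (q - 1) (rgen s f)"
proof (rule hlinear_eqI[of "\<lambda>f. rgen s (rgen s f)" "\<lambda>f. hscale q f + hscale (q - 1) (rgen s f)" f])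
  fix w assume "w \<in> Poly_Mapping.keys f"
  then have w: "w \<in> carrier W" using assms by (auto simp: H_iff)
  have "len (w \<odot> s) < len w \<longleftrightarrow> \<not> len w < len (w \<odot> s)"
    using len_right_gen[OF w assms(1)] by linarith
  then show "rgen s (rgen s (hT w)) = hscale q (hT w) + hscale (q - 1) (rgen s (hT w))"
    using w assms by (cases "len w < len (w \<odot> s)") (simp_all add: rgen_hT lin_simps algebra_simps)
qed (rule hlinear_compose[OF hlinear_rgen hlinear_rgen]
    hpair.module_hom_add[OF hmod.module_hom_scale_self hpair.module_hom_scale[OF hlinear_rgen]])+

section \<open>The Hecke algebra is a ring\<close>

abbreviation rfold where "rfold ss f \<equiv> foldl (hecke_times_gen X) f ss"

lemma hlinear_rfold: "hlinear (rfold ss)"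
proof (induction ss)
  case (Cons s ss)
  then show ?case using hlinear_compose[OF Cons hlinear_rgen[of s]] by simp
qed (simp add: hmod.module_hom_ident)

lemma rfold_closed [simp]: "set ss \<subseteq> S \<Longrightarrow> f \<in> H \<Longrightarrow> rfold ss f \<in> H"
  by (induction ss arbitrary: f) auto

lemma lgen_rfold_commute: "s \<in> S \<Longrightarrow> set ss \<subseteq> S \<Longrightarrow> f \<in> H \<Longrightarrow> lgen s (rfold ss f) = rfold ss (lgen s f)"
  by (induction ss arbitrary: f) (auto simp: lgen_rgen_commute)

lemma reduced_appendD:
  assumes "reduced_expr X w (ss @ ts)"
  shows "reduced_expr X (word_prod X ss) ss"
proof -
  note d = reducedD[OF assms]
  have "distinct (refl_list (ss @ ts))" by (rule distinct_refl_list[OF assms])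
  then show ?thesis using reduced_iff_distinct[of ss] refl_list_append[of ss ts] d by simp
qed

lemma rfold_one: "reduced_expr X w ss \<Longrightarrow> rfold ss (hT e) = hT w"
proof (induction ss arbitrary: w rule: rev_induct)
  case Nil
  then show ?case by (simp add: reduced_expr_def)
next
  case (snoc s ss)
  note d = reducedD[OF snoc.prems] and ss = reduced_appendD[OF snoc.prems]
  have "w = word_prod X ss \<odot> s" using d by auto
  moreover have "len w = Suc (len (word_prod X ss))" using d(3) reducedD(3)[OF ss] by simp
  ultimately show ?case using snoc.IH[OF ss] by (simp add: rgen_hT)
qed

text \<open>
  Each \<open>T\<^sub>x\<close> is obtained from \<open>T\<^sub>1\<close> by left operators, which commute with the right ones. So it is
  enough to compare the two compositions on \<open>T\<^sub>1\<close>, where both give \<open>T\<^sub>w\<close>.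
\<close>

lemma reduced_word_indep:
  assumes "reduced_expr X w ss" "reduced_expr X w ts" "f \<in> H"
  shows "rfold ss f = rfold ts f"
proof (rule hlinear_eqI[OF hlinear_rfold hlinear_rfold, of f ss ts])
  fix x assume "x \<in> Poly_Mapping.keys f"
  then have "x \<in> carrier W" using assms by (auto simp: H_iff)
  then obtain us where us: "reduced_expr X x us" using ex_reduced by metis
  then show "rfold ss (hT x) = rfold ts (hT x)"
  proof (induction us arbitrary: x)
    case Nil
    then have "x = e" by (simp add: reduced_expr_def)
    then show ?case using rfold_one assms by simp
  next
    case (Cons u us)
    note d = reduced_ConsD[OF Cons.prems]
    have x: "u \<odot> x \<in> carrier W" using reducedD[OF d(2)] by simp
    have "u \<notin> inversions (u \<odot> x)" using gen_inversion_iff[OF d(1) x] d(3,5) by simp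
    then have "hT x = lgen u (hT (u \<odot> x))" using d(5) by (simp add: lgen_hT)
    then show ?case
      using Cons.IH[OF d(2)] x
        lgen_rfold_commute[OF d(1) reducedD(1)[OF assms(1)] hT_H[OF x]]
        lgen_rfold_commute[OF d(1) reducedD(1)[OF assms(2)] hT_H[OF x]] by simp
  qed
qed

abbreviation star (infixl "\<star>" 70) where "f \<star> g \<equiv> hecke_times X f g"

lemma star_lin_ext: "(\<star>) f = lin_ext (\<lambda>w. rfold (SOME ss. reduced_expr X w ss) f)"
  by (simp add: fun_eq_iff hecke_times_def lin_ext_def)

lemma hlinear_star_right: "hlinear (\<lambda>g. f \<star> g)"
  unfolding star_lin_ext by (rule hlinear_lin_ext)

lemma hlinear_star_left: "hlinear (\<lambda>f. f \<star> g)"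
  unfolding hecke_times_def
  by (intro hpair.module_hom_sum hpair.module_hom_scale hlinear_rfold)
    (auto intro: hmod.module_axioms)

lemmas star_simps = hlinearD[OF hlinear_star_left] hlinearD[OF hlinear_star_right]

lemma star_hT:
  assumes "f \<in> H" "reduced_expr X w ss"
  shows "f \<star> hT w = rfold ss f"
proof -
  have "reduced_expr X w (SOME ss. reduced_expr X w ss)" by (rule someI[of _ ss]) (rule assms)
  then show ?thesis
    unfolding star_lin_ext lin_ext_hT using assms by (intro reduced_word_indep)
qed

lemma star_closed [simp]: "f \<in> H \<Longrightarrow> g \<in> H \<Longrightarrow> f \<star> g \<in> H"
proof (rule hlinear_closed[OF hlinear_star_right])
  fix w assume "f \<in> H" "w \<in> carrier W"
  moreover from this obtain ss where "reduced_expr X w ss" using ex_reduced by blast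
  ultimately show "f \<star> hT w \<in> H" using reducedD(1)[of w ss] by (simp add: star_hT)
qed

lemma star_rgen:
  assumes "f \<in> H" "g \<in> H" "s \<in> S"
  shows "f \<star> rgen s g = rgen s (f \<star> g)"
proof (rule hlinear_eqI[of "\<lambda>g. f \<star> rgen s g" "\<lambda>g. rgen s (f \<star> g)" g])
  fix w assume "w \<in> Poly_Mapping.keys g"
  then have w: "w \<in> carrier W" using assms by (auto simp: H_iff)
  have up: "f \<star> rgen s (hT w) = rgen s (f \<star> hT w)"
    if w: "w \<in> carrier W" and l: "len w < len (w \<odot> s)" for w
  proof -
    obtain ss where ss: "reduced_expr X w ss" using ex_reduced w by metis
    have "reduced_expr X (w \<odot> s) (ss @ [s])"
      using len_right_gen(1)[OF w assms(3) l] reducedD[OF ss] assms(3)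
      by (simp add: reduced_expr_def)
    then show ?thesis using star_hT[OF assms(1)] ss l by (simp add: rgen_hT)
  qed
  show "f \<star> rgen s (hT w) = rgen s (f \<star> hT w)"
  proof (cases "len w < len (w \<odot> s)")
    case False
    have w': "w \<odot> s \<in> carrier W" "w \<odot> s \<odot> s = w" using w assms by simp_all
    have "len (w \<odot> s) < len w" using len_right_gen(2)[OF w assms(3) False] by simp
    then have Tw: "rgen s (hT (w \<odot> s)) = hT w" "f \<star> hT w = rgen s (f \<star> hT (w \<odot> s))"
      using up[OF w'(1)] w' by (simp_all add: rgen_hT)
    have "f \<star> rgen s (hT w) = hscale q (f \<star> hT (w \<odot> s)) + hscale (q - 1) (f \<star> hT w)"
      using False by (simp add: rgen_hT star_simps)
    also have "\<dots> = rgen s (f \<star> hT w)"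
      unfolding Tw(2) using rgen_quadratic[OF assms(3), of "f \<star> hT (w \<odot> s)"] assms w' by simp
    finally show ?thesis .
  qed (use up w in simp)
qed (rule hlinear_compose[OF hlinear_star_right hlinear_rgen] hlinear_compose[OF hlinear_rgen hlinear_star_right])+

lemma star_rfold: "f \<in> H \<Longrightarrow> g \<in> H \<Longrightarrow> set ss \<subseteq> S \<Longrightarrow> f \<star> rfold ss g = rfold ss (f \<star> g)"
  by (induction ss arbitrary: g) (auto simp: star_rgen)

lemma star_assoc:
  assumes "f \<in> H" "g \<in> H" "h \<in> H"
  shows "f \<star> g \<star> h = f \<star> (g \<star> h)"
proof (rule hlinear_eqI[of "\<lambda>h. f \<star> g \<star> h" "\<lambda>h. f \<star> (g \<star> h)" h])
  fix w assume "w \<in> Poly_Mapping.keys h"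
  then have "w \<in> carrier W" using assms by (auto simp: H_iff)
  then obtain ss where "reduced_expr X w ss" using ex_reduced by metis
  then show "f \<star> g \<star> hT w = f \<star> (g \<star> hT w)"
    using assms reducedD(1)[of w ss] by (simp add: star_hT star_rfold)
qed (rule hlinear_star_right hlinear_compose[OF hlinear_star_right hlinear_star_right])+

lemma reduced_Nil: "reduced_expr X e []"
  by (simp add: reduced_expr_def)

lemma star_one [simp]: "f \<in> H \<Longrightarrow> f \<star> hT e = f"
  using star_hT[OF _ reduced_Nil] by simp

lemma one_star [simp]: 
  assumes "f \<in> H" shows "hT e \<star> f = f"
proof (rule hlinear_eqI[of "\<lambda>f. hT e \<star> f" "\<lambda>f. f" f])
  fix w assume "w \<in> Poly_Mapping.keys f"
  then have "w \<in> carrier W" using assms by (auto simp: H_iff)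
  then obtain ss where "reduced_expr X w ss" using ex_reduced by metis
  then show "hT e \<star> hT w = hT w" using star_hT rfold_one by simp
qed (auto intro: hlinear_star_right hmod.module_hom_ident)

lemma gen_star:
  assumes "s \<in> S" "f \<in> H"
  shows "hT s \<star> f = lgen s f"
proof (rule hlinear_eqI[of "\<lambda>f. hT s \<star> f" "lgen s" f])
  fix w assume "w \<in> Poly_Mapping.keys f"
  then have "w \<in> carrier W" using assms by (auto simp: H_iff)
  then obtain ss where ss: "reduced_expr X w ss" using ex_reduced by metis
  have "hT s = lgen s (hT e)" using assms by (simp add: lgen_hT)
  then have "hT s \<star> hT w = rfold ss (lgen s (hT e))" using star_hT[OF _ ss, of "hT s"] assms by simp
  also have "\<dots> = lgen s (rfold ss (hT e))"
    using lgen_rfold_commute[of s ss "hT e"] assms reducedD(1)[OF ss] by simp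
  finally show "hT s \<star> hT w = lgen s (hT w)" using rfold_one[OF ss] by simp
qed (auto intro: hlinear_star_right hlinear_lgen)

lemma hT_mult:
  assumes "u \<in> carrier W" "v \<in> carrier W" "len (u \<odot> v) = len u + len v"
  shows "hT u \<star> hT v = hT (u \<odot> v)"
proof -
  obtain ss ts where r: "reduced_expr X u ss" "reduced_expr X v ts" using ex_reduced assms by metis
  note s = reducedD[OF r(1)] and t = reducedD[OF r(2)]
  have "reduced_expr X (u \<odot> v) (ss @ ts)" using s t assms by (simp add: reduced_expr_def)
  then have "rfold (ss @ ts) (hT e) = hT (u \<odot> v)" by (rule rfold_one)
  then show ?thesis using star_hT[OF _ r(2), of "hT u"] rfold_one[OF r(1)] assms by simp
qed

lemma hecke_simps [simp]:
  "x \<otimes>\<^bsub>hecke X\<^esub> y = x \<star> y" "\<one>\<^bsub>hecke X\<^esub> = hT e" "\<zero>\<^bsub>hecke X\<^esub> = 0" "x \<oplus>\<^bsub>hecke X\<^esub> y = x + y"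
  by (simp_all add: hecke_def)

lemma ring_hecke: "ring (hecke X)"
proof (rule ringI)
  show "abelian_group (hecke X)"
  proof (rule abelian_groupI)
    show "\<exists>y\<in>H. y \<oplus>\<^bsub>hecke X\<^esub> x = \<zero>\<^bsub>hecke X\<^esub>" if "x \<in> H" for x
      using that by (intro bexI[of _ "- x"]) auto
  qed (auto simp: algebra_simps)
  show "Group.monoid (hecke X)"
    by (rule monoidI) (auto simp: star_assoc)
qed (auto simp: star_simps)

section \<open>The ideal and reduction modulo it\<close>

text \<open>
  The two families are the elements without and with the left descent \<open>s\<close>; left multiplication by
  \<open>s\<close> interchanges them. This is why the sum over the dihedral group is divisible by \<open>1 + T\<^sub>s\<close>.
\<close>

lemma generate_braid:
  assumes "braid s t m"
  shows "generate W {s, t} = alt_prod t s ` {..<m} \<union> (\<lambda>k. alt_prod s t (Suc k)) ` {..<m}" (is "_ = ?A \<union> ?B")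
proof
  note b = braidD[OF assms]
  have inA: "alt_prod t s k \<in> ?A \<union> ?B" if "k < m" for k using that by blast
  have inB: "alt_prod s t (Suc k) \<in> ?A \<union> ?B" if "k < m" for k using that by blast
  have st: "s \<odot> h \<in> ?A \<union> ?B" if "h \<in> ?A \<union> ?B" for h
    using that
  proof
    assume "h \<in> ?B"
    then obtain k where "k < m" "h = alt_prod s t (Suc k)" by auto
    then show ?thesis using b(1,2) by simp
  qed auto
  have tt: "t \<odot> h \<in> ?A \<union> ?B" if "h \<in> ?A \<union> ?B" for h
    using that
  proof
    assume "h \<in> ?A"
    then obtain k where k: "k < m" "h = alt_prod t s k" by auto
    show ?thesis
    proof (cases k)
      case 0
      then have "t \<odot> h = alt_prod t s (Suc 0)" using k b(2) by simp
      then show ?thesis using inA[of "Suc 0"] b(6) by (metis One_nat_def)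
    next
      case (Suc j)
      then have th: "t \<odot> h = alt_prod s t j" using k b(1,2) by simp
      show ?thesis
      proof (cases j)
        case 0
        then have "t \<odot> h = alt_prod t s 0" using th by simp
        then show ?thesis using inA[of 0] b(4) by metis
      next
        case (Suc i)
        then have "i < m" using k \<open>k = Suc j\<close> by simp
        then show ?thesis using th Suc inB[of i] by metis
      qed
    qed
  next
    assume "h \<in> ?B"
    then obtain k where k: "k < m" "h = alt_prod s t (Suc k)" by auto
    show ?thesis
    proof (cases "Suc k < m")
      case True
      show ?thesis
      proof (cases "Suc (Suc k) < m")
        case True
        moreover have "t \<odot> h = alt_prod t s (Suc (Suc k))" using k by simp
        ultimately show ?thesis using inA by metis
      next
        case False
        then have "Suc (Suc k) = m" using True by simp
        then have "t \<odot> h = alt_prod s t (Suc (Suc k))" using k b(5) word_prod_simps(2) alt_word.simps(2) by metis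
        then show ?thesis using True inB by metis
      qed
    next
      case False
      then have m: "m = Suc k" using k by simp
      then have "h = t \<odot> alt_prod s t k" using k b(5) word_prod_simps(2) alt_word.simps(2) by metis
      then have th: "t \<odot> h = alt_prod s t k" using b(1,2) by simp
      obtain j where "k = Suc j" using b(6) m by (cases k) auto
      then show ?thesis using th k(1) inB[of j] Suc_lessD by metis
    qed
  qed
  have inW: "?A \<union> ?B \<subseteq> carrier W" using b(1,2) by auto
  define D where "D = ?A \<union> ?B"
  have sD: "s \<odot> h \<in> D" and tD: "t \<odot> h \<in> D" and DW: "h \<in> carrier W" if "h \<in> D" for h
    using st[of h] tt[of h] subsetD[OF inW, of h] that by (simp_all only: D_def)
  have gen: "g \<in> carrier W \<and> (\<forall>h\<in>D. g \<odot> h \<in> D)" if "g \<in> {s, t}" for g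
    using that sD tD b(1,2) by (elim insertE emptyE) simp_all
  have "e \<in> D" using inA[of 0] b(4) by (simp add: D_def)
  have "generate W {s, t} \<subseteq> D"
  proof
    fix g assume "g \<in> generate W {s, t}"
    then have "g \<in> carrier W \<and> (\<forall>h\<in>D. g \<odot> h \<in> D)"
    proof induction
      case one
      show ?case using DW by simp
    next
      case (incl g)
      then show ?case by (rule gen)
    next
      case (inv g)
      then have "iv g = g" using b(1,2) by auto
      then show ?case using gen[OF inv] by simp
    next
      case (eng g1 g2)
      then show ?case using DW by (simp add: m_assoc)
    qed
    then show "g \<in> D" using \<open>e \<in> D\<close> by (metis r_one)
  qed
  then show "generate W {s, t} \<subseteq> ?A \<union> ?B" by (simp only: D_def)
  have "alt_prod x y k \<in> generate W {s, t}" if "{x, y} \<subseteq> {s, t}" for x y k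
    using that
  proof (induction k arbitrary: x y)
    case (Suc k)
    then show ?case using generate.eng[OF generate.incl[of x "{s, t}" W] Suc.IH[of y x]] by simp
  qed (simp add: generate.one)
  then show "?A \<union> ?B \<subseteq> generate W {s, t}" by blast
qed

lemma sum_generate_braid:
  assumes "braid s t m"
  shows "(\<Sum>w\<in>generate W {s, t}. hT w) = (\<Sum>k<m. hT (alt_prod t s k)) + (\<Sum>k<m. hT (alt_prod s t (Suc k)))"
proof -
  note b = braidD[OF assms]
  have l1: "len (alt_prod t s k) = k" if "k \<le> m" for k using len_braid[of t s m k] assms that braid_sym by blast
  have l2: "len (alt_prod s t k) = k" if "k \<le> m" for k using len_braid[OF assms that] .
  have i1: "inj_on (alt_prod t s) {..<m}" using l1 by (intro inj_on_inverseI[of _ len]) auto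
  have i2: "inj_on (\<lambda>k. alt_prod s t (Suc k)) {..<m}"
    by (intro inj_on_inverseI[of _ "\<lambda>w. len w - 1"]) (use l2 in \<open>simp del: alt_word.simps\<close>)
  have "alt_prod t s k \<noteq> alt_prod s t (Suc j)" if "k < m" "j < m" for j k
  proof
    assume eq: "alt_prod t s k = alt_prod s t (Suc j)"
    then have "k = Suc j" using l1[of k] l2[of "Suc j"] that by simp
    then show False using b(7)[of k] eq that by simp
  qed
  then have "alt_prod t s ` {..<m} \<inter> (\<lambda>k. alt_prod s t (Suc k)) ` {..<m} = {}" by blast
  then show ?thesis unfolding generate_braid[OF assms]
    by (subst sum.union_disjoint) (simp_all only: finite_imageI finite_lessThan sum.reindex[OF i1] sum.reindex[OF i2] o_def)
qed

abbreviation J where "J \<equiv> tl_ideal X"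

lemma sum_generate_H:
  assumes "s \<in> S" "t \<in> S"
  shows "(\<Sum>w\<in>generate W {s, t}. hT w) \<in> H"
proof -
  have "generate W {s, t} \<subseteq> carrier W" using assms by (intro generate_incl) auto
  then show ?thesis by (intro H_sum) auto
qed

abbreviation dihedral_sums where "dihedral_sums \<equiv>
  {\<Sum>w\<in>generate W {s, t}. hT w | s t. s \<in> S \<and> t \<in> S \<and> s \<odot> t \<noteq> t \<odot> s \<and>
     (\<exists>n::nat. n > 0 \<and> (s \<odot> t) [^]\<^bsub>W\<^esub> n = e)}"

lemma dihedral_sums_H: "dihedral_sums \<subseteq> H"
  using sum_generate_H by blast

lemma ideal_J: "ideal J (hecke X)"
  unfolding tl_ideal_def by (rule ring.genideal_ideal[OF ring_hecke dihedral_sums_H])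

lemma J_H: "f \<in> J \<Longrightarrow> f \<in> H"
  by (rule ideal.Icarr[OF ideal_J])

lemma J_mult: "f \<in> J \<Longrightarrow> g \<in> H \<Longrightarrow> f \<star> g \<in> J" "f \<in> J \<Longrightarrow> g \<in> H \<Longrightarrow> g \<star> f \<in> J"
  using ideal.I_r_closed[OF ideal_J] ideal.I_l_closed[OF ideal_J] by simp_all

lemma scalar_star:
  "f \<in> H \<Longrightarrow> hscale a (hT e) \<star> f = hscale a f"
  by (simp add: star_simps)

lemma J_subspace: "hmod.subspace J"
proof (rule hmod.subspaceI)
  interpret additive_subgroup J "hecke X" by (rule ideal.axioms(1)[OF ideal_J])
  show "0 \<in> J" using zero_closed by simp
  show "x + y \<in> J" if "x \<in> J" "y \<in> J" for x y using a_closed that by simp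
  show "hscale a x \<in> J" if "x \<in> J" for a x
    using J_mult(2)[OF that, of "hscale a (hT e)"] scalar_star[of x a] J_H[OF that] by simp
qed

lemmas J_simps = hmod.subspace_0[OF J_subspace] hmod.subspace_add[OF J_subspace]
  hmod.subspace_diff[OF J_subspace] hmod.subspace_neg[OF J_subspace] hmod.subspace_scale[OF J_subspace]

lemma braid_sum_in_J:
  assumes "braid s t m" "s \<odot> t \<noteq> t \<odot> s"
  shows "(\<Sum>k<m. hT (alt_prod t s k)) + (\<Sum>k<m. hT (alt_prod s t (Suc k))) \<in> J"
proof -
  note b = braidD[OF assms(1)]
  have "(s \<odot> t) [^]\<^bsub>W\<^esub> m = e" using pow_eq_one_iff b by blast
  then have "(\<Sum>w\<in>generate W {s, t}. hT w) \<in> J"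
    unfolding tl_ideal_def using b(1,2,4) assms(2)
    by (intro subsetD[OF ring.genideal_self[OF ring_hecke dihedral_sums_H]]) blast
  then show ?thesis using sum_generate_braid[OF assms(1)] by simp
qed

lemma gen_sum_star_braid:
  assumes "braid s t m"
  shows "(hT e + hT s) \<star> (\<Sum>k<m. hT (alt_prod t s k)) = (\<Sum>k<m. hT (alt_prod t s k)) + (\<Sum>k<m. hT (alt_prod s t (Suc k)))"
proof -
  note b = braidD[OF assms]
  have "hT s \<star> hT (alt_prod t s k) = hT (alt_prod s t (Suc k))" if "k < m" for k
    using len_braid[OF assms, of "Suc k"] len_braid[of t s m k] assms that b(1,2) braid_sym
    by (subst hT_mult) auto
  moreover have "hT e \<star> hT (alt_prod t s k) = hT (alt_prod t s k)" for k using b(1,2) by simp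
  ultimately show ?thesis by (simp add: star_simps sum.distrib del: alt_word.simps)
qed

definition low :: "nat \<Rightarrow> 's hecke set" where
  "low n = {f. Poly_Mapping.keys f \<subseteq> {w \<in> carrier W. len w < n}}"

lemma low_subspace: "hmod.subspace (low n)"
  unfolding low_def by (rule subspace_keys)

lemmas low_simps = hmod.subspace_0[OF low_subspace] hmod.subspace_add[OF low_subspace]
  hmod.subspace_diff[OF low_subspace] hmod.subspace_neg[OF low_subspace] hmod.subspace_scale[OF low_subspace]
  hmod.subspace_sum[OF low_subspace]

lemma low_H: "f \<in> low n \<Longrightarrow> f \<in> H"
  by (auto simp: low_def H_iff)

lemma low_mono: "n \<le> m \<Longrightarrow> low n \<subseteq> low m"
  by (auto simp: low_def)

lemma hT_low: "hT w \<in> low n \<longleftrightarrow> w \<in> carrier W \<and> len w < n"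
  by (simp add: low_def)

lemma low_induct:
  assumes "hmod.subspace A" "f \<in> low n" "\<And>w. w \<in> carrier W \<Longrightarrow> len w < n \<Longrightarrow> hT w \<in> A"
  shows "f \<in> A"
  by (rule subspace_keysI[OF assms(1)]) (use assms in \<open>auto simp: low_def\<close>)

lemma hlinear_preimage: "hlinear \<phi> \<Longrightarrow> hmod.subspace A \<Longrightarrow> hmod.subspace {f. \<phi> f \<in> A}"
  by (rule module_hom.subspace_linear_preimage)

lemma lgen_low:
  assumes "s \<in> S" "f \<in> low n"
  shows "lgen s f \<in> low (Suc n)"
proof -
  have "f \<in> {f. lgen s f \<in> low (Suc n)}"
  proof (rule low_induct[OF hlinear_preimage[OF hlinear_lgen low_subspace] assms(2)])
    fix w assume w: "w \<in> carrier W" "len w < n"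
    then show "hT w \<in> {f. lgen s f \<in> low (Suc n)}"
      using len_left_gen[OF assms(1) w(1)] assms(1)
      by (cases "s \<in> inversions w") (auto simp: lgen_hT hT_low intro!: low_simps)
  qed
  then show ?thesis by simp
qed

lemma hT_star_low:
  assumes "u \<in> carrier W" "f \<in> low n"
  shows "hT u \<star> f \<in> low (len u + n)"
proof -
  obtain ss where "reduced_expr X u ss" using ex_reduced assms by metis
  then show ?thesis
  proof (induction ss arbitrary: u)
    case Nil
    then have "u = e" by (simp add: reduced_expr_def)
    then show ?case using assms(2) low_H[OF assms(2)] by simp
  next
    case (Cons s ss)
    note d = reduced_ConsD[OF Cons.prems]
    have v: "s \<odot> u \<in> carrier W" using reducedD[OF d(2)] by simp
    have "hT u = hT s \<star> hT (s \<odot> u)" using hT_mult[of s "s \<odot> u"] d v by simp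
    then have "hT u \<star> f = hT s \<star> (hT (s \<odot> u) \<star> f)"
      using d(1) v low_H[OF assms(2)] star_assoc by simp
    then have "hT u \<star> f = lgen s (hT (s \<odot> u) \<star> f)"
      using d(1) v low_H[OF assms(2)] by (simp add: gen_star)
    then show ?case using lgen_low[OF d(1) Cons.IH[OF d(2)]] d(4) by simp
  qed
qed

lemma hT_triple_low:
  assumes "p \<in> carrier W" "g \<in> carrier W" "r \<in> carrier W" "len p + len g + len r < n"
  shows "hT p \<star> hT g \<star> hT r \<in> low n"
proof -
  have "hT p \<star> (hT g \<star> hT r) \<in> low (len p + (len g + Suc (len r)))"
    using assms by (intro hT_star_low) (auto simp: hT_low)
  then show ?thesis
    using low_mono[of "len p + (len g + Suc (len r))" n] assms by (auto simp: star_assoc)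
qed

lemma hT_triple_exact:
  assumes "p \<in> carrier W" "g \<in> carrier W" "r \<in> carrier W" "len (p \<odot> g \<odot> r) = len p + len g + len r"
  shows "hT p \<star> hT g \<star> hT r = hT (p \<odot> g \<odot> r)"
proof -
  have "len (p \<odot> g) = len p + len g"
    using len_mult_le[of "p \<odot> g" r] len_mult_le[of p g] assms by simp
  then show ?thesis using assms by (simp add: hT_mult)
qed

text \<open>
  Multiply the sum over the dihedral group by \<open>T\<^sub>p\<close> and \<open>T\<^sub>r\<close>: the longest element contributes \<open>T\<^sub>z\<close>
  and all the others contribute shorter basis elements.
\<close>

lemma long_braid_reduces:
  assumes "z \<in> carrier W" "long_braid_factor z"
  obtains f where "f \<in> low (len z)" "hT z + f \<in> J"
proof -
  obtain p a b m r where *: "p \<in> carrier W" "r \<in> carrier W" "braid a b m" "a \<odot> b \<noteq> b \<odot> a"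
    "z = p \<odot> alt_prod a b m \<odot> r" "len z = len p + m + len r"
    using assms(2) unfolding long_braid_factor_def by blast
  note b = braidD[OF *(3)]
  obtain n where m: "m = Suc n" using b(4) gr0_implies_Suc by blast
  have l: "len (alt_prod a b k) = k" "len (alt_prod b a k) = k" if "k \<le> m" for k
    using len_braid[of a b m k] len_braid[of b a m k] that *(3) braid_sym by blast+
  let ?tr = "\<lambda>g. hT p \<star> hT g \<star> hT r"
  \<comment> \<open>All terms of the sum over the dihedral group except the one of the longest element.\<close>
  define f where "f = (\<Sum>k<m. ?tr (alt_prod b a k)) + (\<Sum>k<n. ?tr (alt_prod a b (Suc k)))"
  have "hT p \<star> ((\<Sum>k<m. hT (alt_prod b a k)) + (\<Sum>k<m. hT (alt_prod a b (Suc k)))) \<star> hT r \<in> J"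
    using braid_sum_in_J[OF *(3,4)] * by (intro J_mult) auto
  also have "hT p \<star> ((\<Sum>k<m. hT (alt_prod b a k)) + (\<Sum>k<m. hT (alt_prod a b (Suc k)))) \<star> hT r
      = (\<Sum>k<m. ?tr (alt_prod b a k)) + (\<Sum>k<Suc n. ?tr (alt_prod a b (Suc k)))"
    unfolding m by (simp only: star_simps)
  also have "\<dots> = ?tr (alt_prod a b m) + f"
    unfolding f_def m by (simp del: alt_word.simps add: algebra_simps)
  also have "?tr (alt_prod a b m) = hT z"
    using hT_triple_exact[of p "alt_prod a b m" r] * l[of m] b(1,2) by simp
  finally have "hT z + f \<in> J" .
  moreover have "f \<in> low (len z)"
    unfolding f_def using * l b(1,2) m
    by (intro low_simps hT_triple_low) (auto simp del: alt_word.simps)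
  ultimately show ?thesis using that by blast
qed

text \<open>
  This submodule contains the sums \<open>T\<^sub>y + T\<^sub>s\<^sub>y\<close> with both indices fully commutative. Describing it by
  equations between coefficients gives closure under linear combinations at once, and the equations
  are what the theorem is about.
\<close>

definition symmetric_part :: "'s list set \<Rightarrow> 's hecke set" where
  "symmetric_part s = {g. Poly_Mapping.keys g \<subseteq> fc \<and>
     (\<forall>y. y \<in> fc \<longrightarrow> s \<odot> y \<in> fc \<longrightarrow> s \<notin> inversions y \<longrightarrow>
        Poly_Mapping.lookup g y = Poly_Mapping.lookup g (s \<odot> y))}"

lemma symmetric_part_subspace: "hmod.subspace (symmetric_part s)"
proof -
  have "hmod.subspace {g :: 's hecke. Poly_Mapping.keys g \<subseteq> fc}" by (rule subspace_keys)
  moreover have "hmod.subspace {g. \<forall>y. y \<in> fc \<longrightarrow> s \<odot> y \<in> fc \<longrightarrow> s \<notin> inversions y \<longrightarrow>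
        Poly_Mapping.lookup g y = Poly_Mapping.lookup g (s \<odot> y)}"
    by (rule hmod.subspaceI) (auto simp: lookup_add lookup_hscale)
  ultimately show ?thesis
    unfolding symmetric_part_def Collect_conj_eq by (rule hmod.subspace_inter)
qed

lemmas symmetric_part_simps = hmod.subspace_0[OF symmetric_part_subspace] hmod.subspace_add[OF symmetric_part_subspace]
  hmod.subspace_scale[OF symmetric_part_subspace]

definition symmetrizable :: "'s list set \<Rightarrow> 's hecke set" where
  "symmetrizable s = {f \<in> H. \<exists>g\<in>symmetric_part s. (hT e + hT s) \<star> f - g \<in> J}"

lemma symmetrizable_subspace: "hmod.subspace (symmetrizable s)"
proof (rule hmod.subspaceI)
  show "0 \<in> symmetrizable s" unfolding symmetrizable_def using J_simps(1) symmetric_part_simps(1) 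
    by (auto simp: star_simps intro!: bexI[of _ 0])
next
  fix x y assume "x \<in> symmetrizable s" "y \<in> symmetrizable s"
  then obtain g h where *: "x \<in> H" "y \<in> H" "g \<in> symmetric_part s" "h \<in> symmetric_part s"
    "(hT e + hT s) \<star> x - g \<in> J" "(hT e + hT s) \<star> y - h \<in> J" unfolding symmetrizable_def by blast
  have "(hT e + hT s) \<star> (x + y) - (g + h) = ((hT e + hT s) \<star> x - g) + ((hT e + hT s) \<star> y - h)"
    by (simp add: star_simps)
  also have "\<dots> \<in> J" using *(5,6) by (rule J_simps(2))
  finally have "(hT e + hT s) \<star> (x + y) - (g + h) \<in> J" .
  moreover have "g + h \<in> symmetric_part s" using *(3,4) by (rule symmetric_part_simps(2))
  ultimately show "x + y \<in> symmetrizable s" unfolding symmetrizable_def using H_closed(1)[OF *(1,2)] by blast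
next
  fix a x assume "x \<in> symmetrizable s"
  then obtain g where *: "x \<in> H" "g \<in> symmetric_part s" "(hT e + hT s) \<star> x - g \<in> J"
    unfolding symmetrizable_def by blast
  have "(hT e + hT s) \<star> hscale a x - hscale a g = hscale a ((hT e + hT s) \<star> x - g)"
    by (simp only: star_simps(8) hmod.scale_right_diff_distrib)
  also have "\<dots> \<in> J" using *(3) by (rule J_simps(5))
  finally have "(hT e + hT s) \<star> hscale a x - hscale a g \<in> J" .
  moreover have "hscale a g \<in> symmetric_part s" using *(2) by (rule symmetric_part_simps(3))
  ultimately show "hscale a x \<in> symmetrizable s" unfolding symmetrizable_def using H_closed(2)[OF *(1)] by blast
qed

lemma symmetrizable_congruent:
  assumes "s \<in> S" "f \<in> symmetrizable s" "z \<in> H" "(hT e + hT s) \<star> z + (hT e + hT s) \<star> f \<in> J"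
  shows "z \<in> symmetrizable s"
proof -
  have f: "- f \<in> symmetrizable s" using hmod.subspace_neg[OF symmetrizable_subspace assms(2)] .
  then obtain g where g: "g \<in> symmetric_part s" "(hT e + hT s) \<star> (- f) - g \<in> J" by (auto simp: symmetrizable_def)
  have "((hT e + hT s) \<star> z + (hT e + hT s) \<star> f) + ((hT e + hT s) \<star> (- f) - g) \<in> J"
    using assms(4) g(2) J_simps(2) by blast
  then have "(hT e + hT s) \<star> z - g \<in> J" by (simp add: star_simps)
  then show ?thesis using g assms by (auto simp: symmetrizable_def)
qed

lemma gen_sum_star_commuting:
  assumes "s \<in> S" "p \<in> carrier W" "s \<odot> p = p \<odot> s" "s \<notin> inversions p" "f \<in> H"
  shows "(hT e + hT s) \<star> (hT p \<star> f) = hT p \<star> ((hT e + hT s) \<star> f)"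
proof -
  have l: "len (s \<odot> p) = len s + len p" using len_left_gen(2)[OF assms(1,2,4)] assms by simp
  have "hT s \<star> hT p = hT p \<star> hT s"
    using hT_mult[of s p] hT_mult[of p s] assms l by simp
  then show ?thesis using assms by (simp add: star_simps flip: star_assoc)
qed

text \<open>
  Induction on the length of \<open>z\<close>. If \<open>sz < z\<close>, then \<open>(1 + T\<^sub>s)T\<^sub>z\<close> is \<open>q(1 + T\<^sub>s)T\<^sub>s\<^sub>z\<close>. If \<open>z\<close> has a long braid
  factor, then \<open>T\<^sub>z\<close> itself reduces to shorter elements. If \<open>z\<close> and \<open>sz\<close> are fully commutative, then
  \<open>T\<^sub>z + T\<^sub>s\<^sub>z\<close> is visibly symmetric. In the remaining case \<open>sz\<close> acquires a braid starting with \<open>s\<close>, and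
  the sum over the dihedral group, being a multiple of \<open>1 + T\<^sub>s\<close>, turns \<open>(1 + T\<^sub>s)T\<^sub>z\<close> into \<open>1 + T\<^sub>s\<close> times
  a combination of shorter elements.
\<close>

lemma hT_symmetrizable:
  assumes "s \<in> S" "z \<in> carrier W"
  shows "hT z \<in> symmetrizable s"
  using assms(2)
proof (induction "len z" arbitrary: z rule: less_induct)
  case less
  note z = less.prems
  have low: "f \<in> symmetrizable s" if "f \<in> low (len z)" for f
    by (rule low_induct[OF symmetrizable_subspace that less.hyps])
  let ?M = "hT e + hT s"
  show ?case
  proof (cases "s \<in> inversions z")
    case True
    then have l: "len z = Suc (len (s \<odot> z))" using len_left_gen assms z by blast
    have "s \<notin> inversions (s \<odot> z)" using gen_inversion_iff assms True z by blast
    then have "?M \<star> hT z = hscale q (?M \<star> hT (s \<odot> z))"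
      using assms z True by (simp add: star_simps gen_star lgen_hT algebra_simps)
    also have "\<dots> = ?M \<star> hscale q (hT (s \<odot> z))" by (simp only: star_simps(8))
    finally have "?M \<star> hT z + ?M \<star> (- hscale q (hT (s \<odot> z))) \<in> J"
      using J_simps(1) by (simp add: star_simps(11))
    moreover have "- hscale q (hT (s \<odot> z)) \<in> symmetrizable s"
      using l z assms by (intro low low_simps) (auto simp: hT_low)
    ultimately show ?thesis using symmetrizable_congruent assms z by auto
  next
    case up: False
    show ?thesis
    proof (cases "long_braid_factor z")
      case True
      then obtain f where f: "f \<in> low (len z)" "hT z + f \<in> J" using long_braid_reduces z by blast
      have "?M \<star> (hT z + f) \<in> J" using f assms by (intro J_mult) auto
      then have "?M \<star> hT z + ?M \<star> f \<in> J" by (simp only: star_simps)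
      then show ?thesis using symmetrizable_congruent[OF assms(1) low[OF f(1)]] z by simp
    next
      case nlb: False
      then have zfc: "z \<in> fc" using not_fc_long_braid_factor z by blast
      show ?thesis
      proof (cases "s \<odot> z \<in> fc")
        case True
        have "hT z + hT (s \<odot> z) \<in> symmetric_part s"
          unfolding symmetric_part_def
        proof (intro CollectI conjI allI impI)
          show "Poly_Mapping.keys (hT z + hT (s \<odot> z)) \<subseteq> fc"
            using keys_add[of "hT z" "hT (s \<odot> z)"] zfc True by auto
          fix y assume y: "y \<in> fc" "s \<notin> inversions y"
          then have yW: "y \<in> carrier W" using fcD(2) by blast
          have "s \<in> inversions (s \<odot> z)" "s \<in> inversions (s \<odot> y)"
            using gen_inversion_iff assms yW z up y by blast+
          then have "y \<noteq> s \<odot> z" "s \<odot> y \<noteq> z" using up y by auto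
          moreover have "s \<odot> y = s \<odot> z \<longleftrightarrow> y = z" using assms(1) yW z by simp
          ultimately show "Poly_Mapping.lookup (hT z + hT (s \<odot> z)) y = Poly_Mapping.lookup (hT z + hT (s \<odot> z)) (s \<odot> y)"
            by (simp add: lookup_add lookup_hT)
        qed
        moreover have "?M \<star> hT z - (hT z + hT (s \<odot> z)) \<in> J"
          using assms z up J_simps(1) by (simp add: star_simps gen_star lgen_hT)
        ultimately show ?thesis unfolding symmetrizable_def using hT_H[OF z] by blast
      next
        case False
        obtain p t m r where *: "p \<in> carrier W" "r \<in> carrier W" "braid s t m" "s \<odot> t \<noteq> t \<odot> s"
          "s \<odot> p = p \<odot> s" "s \<notin> inversions p" "z = p \<odot> alt_prod t s (m - 1) \<odot> r" "len z = len p + (m - 1) + len r"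
          using gen_times_not_fc_cases[OF z assms(1) up False] nlb by blast
        note b = braidD[OF *(3)]
        obtain n where m: "m = Suc n" using b(4) gr0_implies_Suc by blast
        have l: "len (alt_prod t s k) = k" if "k \<le> m" for k
          using len_braid[of t s m k] that *(3) braid_sym by blast
        let ?tr = "\<lambda>g. hT p \<star> hT g \<star> hT r"
        define f where "f = (\<Sum>k<n. ?tr (alt_prod t s k))"
        have aH: "(\<Sum>k<m. hT (alt_prod t s k)) \<in> H" using b(1,2) by (intro H_sum) auto
        \<comment> \<open>The factor \<open>1 + T\<^sub>s\<close> of the sum over the dihedral group is moved to the left of \<open>T\<^sub>p\<close>.\<close>
        have "hT p \<star> (?M \<star> (\<Sum>k<m. hT (alt_prod t s k))) \<star> hT r \<in> J"
          using braid_sum_in_J[OF *(3,4)] * unfolding gen_sum_star_braid[OF *(3)]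
          by (intro J_mult) auto
        also have "hT p \<star> (?M \<star> (\<Sum>k<m. hT (alt_prod t s k))) \<star> hT r
          = ?M \<star> (hT p \<star> (\<Sum>k<m. hT (alt_prod t s k)) \<star> hT r)"
          using gen_sum_star_commuting[OF assms(1) *(1,5,6) aH, symmetric] aH * assms(1)
          by (simp add: star_assoc)
        also have "hT p \<star> (\<Sum>k<m. hT (alt_prod t s k)) \<star> hT r = ?tr (alt_prod t s n) + f"
          unfolding m f_def by (simp only: star_simps sum.lessThan_Suc add.commute)
        also have "?tr (alt_prod t s n) = hT z"
          using hT_triple_exact[of p "alt_prod t s n" r] * l[of n] b(1,2) m by simp
        finally have "?M \<star> hT z + ?M \<star> f \<in> J" by (simp only: star_simps)
        moreover have "f \<in> low (len z)"
          unfolding f_def using * l b(1,2) m by (intro low_simps hT_triple_low) auto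
        ultimately show ?thesis using symmetrizable_congruent[OF assms(1) low] z by simp
      qed
    qed
  qed
qed

lemma H_symmetrizable:
  assumes "s \<in> S" "f \<in> H"
  shows "\<exists>g\<in>symmetric_part s. (hT e + hT s) \<star> f - g \<in> J"
proof -
  have "f \<in> symmetrizable s"
    by (rule subspace_keysI[OF symmetrizable_subspace], rule hT_symmetrizable) (use assms in \<open>auto simp: H_iff\<close>)
  then show ?thesis by (simp add: symmetrizable_def)
qed

end

section \<open>Bar invariant elements\<close>

lemma laurent_expand: "(a::laurent) = (\<Sum>j\<in>Poly_Mapping.keys a. Poly_Mapping.single j (Poly_Mapping.lookup a j))"
  by (rule poly_mapping_eqI) (auto simp: lookup_sum lookup_single when_def in_keys_iff)

lemma lookup_single_mult:
  "Poly_Mapping.lookup (Poly_Mapping.single j c * (a::laurent)) n = c * Poly_Mapping.lookup a (n - j)"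
proof -
  have "Poly_Mapping.single j c * a = (\<Sum>i\<in>Poly_Mapping.keys a. Poly_Mapping.single (j + i) (c * Poly_Mapping.lookup a i))"
    by (subst (1) laurent_expand[of a]) (simp add: sum_distrib_left mult_single)
  moreover have "j + i = n \<longleftrightarrow> i = n - j" for i by auto
  ultimately show ?thesis by (simp add: lookup_sum lookup_single when_def in_keys_iff)
qed

lemma lookup_qh_mult: "Poly_Mapping.lookup (qh k * a) n = Poly_Mapping.lookup a (n - k)"
  by (simp add: qh_def lookup_single_mult)

lemma qh_mult_assoc: "qh a * (qh b * p) = qh (a + b) * p"
  by (simp add: qh_mult flip: mult.assoc)

definition bar_laurent :: "laurent \<Rightarrow> laurent" where
  "bar_laurent a = Poly_Mapping.map_key uminus a"

lemma lookup_bar_laurent: "Poly_Mapping.lookup (bar_laurent a) k = Poly_Mapping.lookup a (- k)"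
  by (simp add: bar_laurent_def map_key.rep_eq inj_on_def)

lemma bar_laurent_simps [simp]:
  "bar_laurent (a + b) = bar_laurent a + bar_laurent b"
  "bar_laurent (- a) = - bar_laurent a"
  "bar_laurent (Poly_Mapping.single k c) = Poly_Mapping.single (- k) c"
  "bar_laurent (qh k) = qh (- k)"
  "bar_laurent 0 = 0"
  "bar_laurent (qh k * a) = qh (- k) * bar_laurent a"
proof -
  show "bar_laurent (qh k * a) = qh (- k) * bar_laurent a"
    by (rule poly_mapping_eqI) (simp add: lookup_bar_laurent lookup_qh_mult)
qed (auto intro!: poly_mapping_eqI simp: lookup_bar_laurent lookup_add lookup_single qh_def when_def)

definition neg_laurent :: "laurent \<Rightarrow> bool" where
  "neg_laurent a \<longleftrightarrow> (\<forall>k\<ge>0. Poly_Mapping.lookup a k = 0)"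

lemma neg_laurent_iff: "neg_laurent a \<longleftrightarrow> Poly_Mapping.keys a \<subseteq> {..<0}"
  by (auto simp: neg_laurent_def in_keys_iff not_less subset_iff) (metis not_less)

lemma neg_laurent_simps:
  "neg_laurent 0" "neg_laurent a \<Longrightarrow> neg_laurent b \<Longrightarrow> neg_laurent (a + b)"
  "neg_laurent a \<Longrightarrow> neg_laurent b \<Longrightarrow> neg_laurent (a - b)"
  "neg_laurent a \<Longrightarrow> neg_laurent (Poly_Mapping.single 0 c * a)"
  by (auto simp: neg_laurent_def lookup_add lookup_minus lookup_single_mult)

lemma neg_bar_laurent_eq_0:
  assumes "neg_laurent a" "bar_laurent a = a"
  shows "a = 0"
proof (rule poly_mapping_eqI)
  fix k
  have "Poly_Mapping.lookup a k = Poly_Mapping.lookup a (- k)"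
    using lookup_bar_laurent[of a k] assms(2) by simp
  then show "Poly_Mapping.lookup a k = Poly_Mapping.lookup 0 k"
    using assms(1) by (cases "0 \<le> k") (auto simp: neg_laurent_def)
qed

lemma qh_nonzero [simp]: "qh k \<noteq> 0"
  by (simp add: qh_def)

text \<open>
  The bar involutions of the Hecke algebra and of its quotient are treated at once. Working with
  representatives in the Hecke algebra, via the relation \<open>bar_rel\<close> below, keeps all linear algebra
  in one type.
\<close>

locale bar_setting = coxeter X for X :: "'s coxeter_graph" +
  fixes R :: "'r ring" and \<phi> :: "'s hecke \<Rightarrow> 'r" and \<iota> :: "'r \<Rightarrow> 'r"
  assumes ring_R: "ring R" and hom: "\<phi> \<in> ring_hom (hecke X) R" and bar: "bar_involution X R \<phi> \<iota>"
begin

definition bar_rel :: "'s hecke \<Rightarrow> 's hecke \<Rightarrow> bool" where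
  "bar_rel f g \<longleftrightarrow> f \<in> H \<and> g \<in> H \<and> \<iota> (\<phi> f) = \<phi> g"

lemma iota_hom: "\<iota> \<in> ring_hom R R"
  using bar by (simp add: bar_involution_def)

lemma phi_simps:
  "f \<in> H \<Longrightarrow> \<phi> f \<in> carrier R"
  "f \<in> H \<Longrightarrow> g \<in> H \<Longrightarrow> \<phi> (f + g) = \<phi> f \<oplus>\<^bsub>R\<^esub> \<phi> g"
  "f \<in> H \<Longrightarrow> g \<in> H \<Longrightarrow> \<phi> (f \<star> g) = \<phi> f \<otimes>\<^bsub>R\<^esub> \<phi> g"
  "\<phi> (hT e) = \<one>\<^bsub>R\<^esub>" "\<phi> 0 = \<zero>\<^bsub>R\<^esub>"
  using ring_hom_closed[OF hom] ring_hom_add[OF hom] ring_hom_mult[OF hom] ring_hom_one[OF hom]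
    ring_hom_zero[OF hom ring_hecke ring_R] by simp_all

lemma iota_simps:
  "x \<in> carrier R \<Longrightarrow> y \<in> carrier R \<Longrightarrow> \<iota> (x \<oplus>\<^bsub>R\<^esub> y) = \<iota> x \<oplus>\<^bsub>R\<^esub> \<iota> y"
  "x \<in> carrier R \<Longrightarrow> y \<in> carrier R \<Longrightarrow> \<iota> (x \<otimes>\<^bsub>R\<^esub> y) = \<iota> x \<otimes>\<^bsub>R\<^esub> \<iota> y"
  "\<iota> \<one>\<^bsub>R\<^esub> = \<one>\<^bsub>R\<^esub>" "\<iota> \<zero>\<^bsub>R\<^esub> = \<zero>\<^bsub>R\<^esub>" "x \<in> carrier R \<Longrightarrow> \<iota> x \<in> carrier R"
  using ring_hom_closed[OF iota_hom] ring_hom_add[OF iota_hom] ring_hom_mult[OF iota_hom]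
    ring_hom_one[OF iota_hom] ring_hom_zero[OF iota_hom ring_R ring_R] by simp_all

lemma bar_rel_H: "bar_rel f g \<Longrightarrow> f \<in> H" "bar_rel f g \<Longrightarrow> g \<in> H"
  by (simp_all add: bar_rel_def)

lemma bar_rel_add: "bar_rel f g \<Longrightarrow> bar_rel f' g' \<Longrightarrow> bar_rel (f + f') (g + g')"
  by (auto simp: bar_rel_def phi_simps iota_simps)

lemma bar_rel_mult: "bar_rel f g \<Longrightarrow> bar_rel f' g' \<Longrightarrow> bar_rel (f \<star> f') (g \<star> g')"
  by (auto simp: bar_rel_def phi_simps iota_simps)

lemma bar_rel_0: "bar_rel 0 0"
  by (simp add: bar_rel_def phi_simps iota_simps)

lemma phi_neg: "f \<in> H \<Longrightarrow> \<phi> (- f) = \<ominus>\<^bsub>R\<^esub> \<phi> f"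
proof -
  interpret R: ring R by (rule ring_R)
  assume f: "f \<in> H"
  then have "\<phi> (- f) \<oplus>\<^bsub>R\<^esub> \<phi> f = \<zero>\<^bsub>R\<^esub>" using phi_simps(2)[of "- f" f] phi_simps(5) by simp
  then show ?thesis using R.minus_equality f phi_simps(1) by simp
qed

lemma bar_rel_neg: "bar_rel f g \<Longrightarrow> bar_rel (- f) (- g)"
proof -
  interpret R: ring R by (rule ring_R)
  assume fg: "bar_rel f g"
  then have "\<iota> (\<phi> (- f)) \<oplus>\<^bsub>R\<^esub> \<iota> (\<phi> f) = \<zero>\<^bsub>R\<^esub>"
    using iota_simps(1)[of "\<phi> (- f)" "\<phi> f"] phi_simps(2)[of "- f" f] phi_simps(1,5) iota_simps(4)
    by (simp add: bar_rel_def)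
  then have "\<iota> (\<phi> (- f)) = \<ominus>\<^bsub>R\<^esub> \<iota> (\<phi> f)"
    using R.minus_equality fg phi_simps(1) iota_simps(5) by (simp add: bar_rel_def)
  then show ?thesis using fg by (simp add: bar_rel_def phi_neg)
qed

lemma bar_rel_diff: "bar_rel f g \<Longrightarrow> bar_rel f' g' \<Longrightarrow> bar_rel (f - f') (g - g')"
  using bar_rel_add[of f g "- f'" "- g'"] bar_rel_neg by simp

lemma bar_rel_scalar_qh: "bar_rel (hscale (qh k) (hT e)) (hscale (qh (- k)) (hT e))"
proof -
  have 1: "bar_rel (hscale (qh 1) (hT e)) (hscale (qh (- 1)) (hT e))"
    using bar by (simp add: bar_rel_def bar_involution_def)
  have n: "bar_rel (hscale (qh (int n)) (hT e)) (hscale (qh (- int n)) (hT e))" for n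
  proof (induction n)
    case 0
    then show ?case by (simp add: bar_rel_def phi_simps iota_simps)
  next
    case (Suc n)
    then show ?case using bar_rel_mult[OF Suc 1] by (simp add: star_simps qh_mult algebra_simps)
  qed
  show ?thesis
  proof (cases "0 \<le> k")
    case True
    then show ?thesis using n[of "nat k"] by simp
  next
    case False
    then have r: "bar_rel (hscale (qh (- k)) (hT e)) (hscale (qh k) (hT e))" using n[of "nat (- k)"] by simp
    have "\<iota> (\<iota> x) = x" if "x \<in> carrier R" for x using bar that by (simp add: bar_involution_def)
    then have "\<iota> (\<phi> (hscale (qh k) (hT e))) = \<phi> (hscale (qh (- k)) (hT e))"
      using r phi_simps(1) unfolding bar_rel_def by metis
    then show ?thesis using r by (simp add: bar_rel_def)
  qed
qed

text \<open>
  The involution is only prescribed on \<open>q\<^sup>1\<^sup>/\<^sup>2\<close>; multiplicativity, the involution property and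
  additivity determine it on all scalars.
\<close>

lemma bar_rel_scalar: "bar_rel (hscale a (hT e)) (hscale (bar_laurent a) (hT e))"
proof -
  let ?P = "\<lambda>a. bar_rel (hscale a (hT e)) (hscale (bar_laurent a) (hT e))"
  have add: "?P (a + b)" if "?P a" "?P b" for a b
    using bar_rel_add[OF that] by (simp add: hmod.scale_left_distrib)
  have neg: "?P (- a)" if "?P a" for a
    using bar_rel_neg[OF that] by simp
  have n: "?P (Poly_Mapping.single k (int n))" for k n
  proof (induction n)
    case (Suc n)
    have "Poly_Mapping.single k (int (Suc n)) = qh k + Poly_Mapping.single k (int n)"
      by (simp add: qh_def flip: single_add)
    then show ?case using add[OF _ Suc, of "qh k"] bar_rel_scalar_qh[of k] by simp
  qed (simp add: bar_rel_0)
  have s: "?P (Poly_Mapping.single k c)" for k c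
  proof (cases "0 \<le> c")
    case True
    then show ?thesis using n[of k "nat c"] by simp
  next
    case False
    have "Poly_Mapping.single k c = - Poly_Mapping.single k (int (nat (- c)))"
      using False by (simp add: single_uminus)
    then show ?thesis using neg[OF n[of k "nat (- c)"]] by simp
  qed
  have "?P (\<Sum>j\<in>A. Poly_Mapping.single j (f j))" if "finite A" for A f
    using that
  proof (induction A rule: finite_induct)
    case empty
    show ?case by (simp add: bar_rel_0)
  next
    case (insert j A)
    then show ?case using add[OF s[of j "f j"] insert.IH] by (simp del: bar_laurent_simps)
  qed
  then show ?thesis by (subst (1 2) laurent_expand[of a]) simp
qed

lemma bar_rel_scale: "bar_rel f g \<Longrightarrow> bar_rel (hscale a f) (hscale (bar_laurent a) g)"
  using bar_rel_mult[OF bar_rel_scalar[of a]] scalar_star bar_rel_H by metis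

lemma bar_rel_gen:
  assumes "s \<in> S"
  shows "bar_rel (hT s) (hscale (qh (- 2)) (hT s - hscale (q - 1) (hT e)))"
proof -
  interpret R: ring R by (rule ring_R)
  let ?u = "hscale (qh (- 2)) (hT s - hscale (q - 1) (hT e))"
  have "s \<in> inversions s" using assms by (simp add: inversions_gen)
  then have ss: "hT s \<star> hT s = hscale q (hT e) + hscale (q - 1) (hT s)"
    using assms by (simp add: gen_star lgen_hT)
  have sH: "hT s \<in> H" "?u \<in> H" using assms by simp_all
  have "hT s \<star> ?u = hscale (qh (- 2)) (hT s \<star> hT s - hscale (q - 1) (hT s))"
    using sH by (simp add: star_simps del: hmod.scale_right_diff_distrib)
  then have 1: "hT s \<star> ?u = hT e" unfolding ss by (simp add: qh_mult)
  have "?u \<star> hT s = hscale (qh (- 2)) (hT s \<star> hT s - hscale (q - 1) (hT s))"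
    using sH by (simp add: star_simps del: hmod.scale_right_diff_distrib)
  then have 2: "?u \<star> hT s = hT e" unfolding ss by (simp add: qh_mult)
  have "inv\<^bsub>R\<^esub> (\<phi> (hT s)) = \<phi> ?u"
    using 1 2 sH phi_simps(1,4) phi_simps(3)[of "hT s" ?u] phi_simps(3)[of ?u "hT s"]
    by (intro R.inv_char) auto
  moreover have "\<iota> (\<phi> (hT s)) = inv\<^bsub>R\<^esub> (\<phi> (hT (iv s)))"
    using bar assms by (simp add: bar_involution_def)
  ultimately show ?thesis using assms sH by (simp add: bar_rel_def)
qed

lemma bar_rel_preimage_subspace:
  assumes "hmod.subspace Z"
  shows "hmod.subspace {f. \<exists>g\<in>Z. bar_rel f g}"
proof (rule hmod.subspaceI)
  show "0 \<in> {f. \<exists>g\<in>Z. bar_rel f g}" using bar_rel_0 hmod.subspace_0[OF assms] by auto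
  show "x + y \<in> {f. \<exists>g\<in>Z. bar_rel f g}" if "x \<in> {f. \<exists>g\<in>Z. bar_rel f g}" "y \<in> {f. \<exists>g\<in>Z. bar_rel f g}" for x y
    using that bar_rel_add hmod.subspace_add[OF assms] by blast
  show "hscale a x \<in> {f. \<exists>g\<in>Z. bar_rel f g}" if "x \<in> {f. \<exists>g\<in>Z. bar_rel f g}" for x a
    using that bar_rel_scale hmod.subspace_scale[OF assms] by blast
qed

text \<open>
  The uniqueness argument of Kazhdan and Lusztig. A bar invariant family that is unitriangular in
  the \<open>q\<^sup>-\<^sup>l\<^sup>(\<^sup>w\<^sup>)\<^sup>/\<^sup>2 T\<^sub>w\<close> forces the involution to be unitriangular in these elements as well. Hence the
  coefficient, in this basis, of a bar invariant element at an element of maximal length in its support is bar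
  invariant; if all its exponents are negative, then it vanishes.
\<close>

lemma bar_invariant_neg_eq_0:
  assumes BW: "B \<subseteq> carrier W"
    and b: "\<And>w. w \<in> B \<Longrightarrow> bar_rel (b w) (b w)" "\<And>w. w \<in> B \<Longrightarrow> Poly_Mapping.keys (b w) \<subseteq> B"
      "\<And>w. w \<in> B \<Longrightarrow> b w - hscale (qh (- int (len w))) (hT w) \<in> low (len w)"
    and indep: "\<And>g. Poly_Mapping.keys g \<subseteq> B \<Longrightarrow> \<phi> g = \<zero>\<^bsub>R\<^esub> \<Longrightarrow> g = 0"
    and h: "bar_rel h h" "Poly_Mapping.keys h \<subseteq> B"
      "\<And>w. w \<in> B \<Longrightarrow> neg_laurent (qh (int (len w)) * Poly_Mapping.lookup h w)"
  shows "h = 0"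
proof (rule ccontr)
  \<comment> \<open>The involution is first shown to be unitriangular on the basis, by induction on the length.\<close>
  define KB where "KB = {f :: 's hecke. Poly_Mapping.keys f \<subseteq> B}"
  have KB: "hmod.subspace KB" unfolding KB_def by (rule subspace_keys)
  note KBs = hmod.subspace_diff[OF KB] hmod.subspace_scale[OF KB] hmod.subspace_add[OF KB]
  have triangular: "\<exists>g\<in>KB. bar_rel (hT w) g \<and> g - hscale (qh (- 2 * int (len w))) (hT w) \<in> low (len w)"
    if "w \<in> B" for w
    using that
  proof (induction "len w" arbitrary: w rule: less_induct)
    case less
    let ?l = "int (len w)"
    define d where "d = b w - hscale (qh (- ?l)) (hT w)"
    have "hT w \<in> KB" "b w \<in> KB" using b(2) less.prems by (simp_all add: KB_def)
    then have d: "d \<in> low (len w)" "d \<in> KB"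
      unfolding d_def using b(3) less.prems by (blast intro: KBs)+
    have sub: "hmod.subspace (low (len w) \<inter> KB)" by (rule hmod.subspace_inter[OF low_subspace KB])
    have "d \<in> {f. \<exists>g\<in>low (len w) \<inter> KB. bar_rel f g}"
    proof (rule subspace_keysI[OF bar_rel_preimage_subspace[OF sub]])
      fix y assume "y \<in> Poly_Mapping.keys d"
      then have y: "len y < len w" "y \<in> B" "y \<in> carrier W" using d by (auto simp: low_def KB_def)
      then obtain g where g: "g \<in> KB" "bar_rel (hT y) g" "g - hscale (qh (- 2 * int (len y))) (hT y) \<in> low (len y)"
        using less.hyps by blast
      have "g - hscale (qh (- 2 * int (len y))) (hT y) \<in> low (len w)"
        using g(3) low_mono[of "len y" "len w"] y by auto
      moreover have "hscale (qh (- 2 * int (len y))) (hT y) \<in> low (len w)"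
        using y by (intro low_simps) (simp add: hT_low)
      ultimately have "g \<in> low (len w)" using low_simps(2) by fastforce
      then show "hT y \<in> {f. \<exists>g\<in>low (len w) \<inter> KB. bar_rel f g}" using g by blast
    qed
    then obtain d' where d': "d' \<in> low (len w)" "d' \<in> KB" "bar_rel d d'" by blast
    have "hT w = hscale (qh ?l) (b w - d)" by (simp add: d_def qh_mult)
    then have "bar_rel (hT w) (hscale (qh (- ?l)) (b w - d'))"
      using bar_rel_scale[OF bar_rel_diff[OF b(1)[OF less.prems] d'(3)], of "qh ?l"] by simp
    moreover have "hscale (qh (- ?l)) (b w - d') - hscale (qh (- 2 * ?l)) (hT w) = hscale (qh (- ?l)) (d - d')"
      by (simp add: d_def qh_mult hmod.scale_right_diff_distrib)
    then have "hscale (qh (- ?l)) (b w - d') - hscale (qh (- 2 * ?l)) (hT w) \<in> low (len w)"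
      using d d' low_simps by simp
    moreover have "hscale (qh (- ?l)) (b w - d') \<in> KB"
      using b(2)[OF less.prems] d' by (intro KBs) (auto simp: KB_def)
    ultimately show ?case by blast
  qed
  assume "h \<noteq> 0"
  then have ne: "Poly_Mapping.keys h \<noteq> {}" by simp
  \<comment> \<open>Only the coefficient at an element \<open>x\<close> of maximal length matters; the rest contributes nothing at \<open>x\<close>.\<close>
  define n where "n = Max (len ` Poly_Mapping.keys h)"
  have "n \<in> len ` Poly_Mapping.keys h" unfolding n_def using ne by (intro Max_in) auto
  then obtain x where x: "x \<in> Poly_Mapping.keys h" "len x = n" by auto
  have max: "len y \<le> n" if "y \<in> Poly_Mapping.keys h" for y
    unfolding n_def using that by (intro Max_ge) auto
  have xB: "x \<in> B" using x h by auto
  let ?hx = "Poly_Mapping.lookup h x"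
  define rest where "rest = h - hscale ?hx (hT x)"
  have rest_keys: "y \<noteq> x \<and> y \<in> Poly_Mapping.keys h" if "y \<in> Poly_Mapping.keys rest" for y
    using that by (auto simp: rest_def in_keys_iff lookup_minus lookup_hscale lookup_hT split: if_splits)
  define Z where "Z = {g \<in> KB. Poly_Mapping.lookup g x = 0}"
  have Z: "hmod.subspace Z"
    using KB unfolding Z_def hmod.subspace_def by (auto simp: lookup_add lookup_hscale)
  have low0: "Poly_Mapping.lookup f x = 0" if "f \<in> low (len x)" for f
    using that by (auto simp: low_def in_keys_iff)
  have "rest \<in> {f. \<exists>g\<in>Z. bar_rel f g}"
  proof (rule subspace_keysI[OF bar_rel_preimage_subspace[OF Z]])
    fix y assume "y \<in> Poly_Mapping.keys rest"
    then have y: "y \<noteq> x" "y \<in> B" "len y \<le> len x" using rest_keys max x h(2) by auto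
    then obtain g where g: "g \<in> KB" "bar_rel (hT y) g" "g - hscale (qh (- 2 * int (len y))) (hT y) \<in> low (len y)"
      using triangular by blast
    then have "Poly_Mapping.lookup (g - hscale (qh (- 2 * int (len y))) (hT y)) x = 0"
      using low_mono[OF y(3)] low0 by blast
    then have "Poly_Mapping.lookup g x = 0" using y by (simp add: lookup_minus lookup_hscale lookup_hT)
    then show "hT y \<in> {f. \<exists>g\<in>Z. bar_rel f g}" using g by (auto simp: Z_def)
  qed
  then obtain r' where r': "r' \<in> KB" "Poly_Mapping.lookup r' x = 0" "bar_rel rest r'" by (auto simp: Z_def)
  obtain g where g: "g \<in> KB" "bar_rel (hT x) g" "g - hscale (qh (- 2 * int (len x))) (hT x) \<in> low (len x)"
    using triangular xB by blast
  have gx: "Poly_Mapping.lookup g x = qh (- 2 * int (len x))"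
    using low0[OF g(3)] by (simp add: lookup_minus lookup_hscale lookup_hT)
  have "bar_rel h (hscale (bar_laurent ?hx) g + r')"
    using bar_rel_add[OF bar_rel_scale[OF g(2), of ?hx] r'(3)] by (simp add: rest_def)
  then have "bar_rel (h - h) (h - (hscale (bar_laurent ?hx) g + r'))" by (rule bar_rel_diff[OF h(1)])
  then have "\<phi> (h - (hscale (bar_laurent ?hx) g + r')) = \<zero>\<^bsub>R\<^esub>"
    by (simp add: bar_rel_def phi_simps iota_simps)
  moreover have "h - (hscale (bar_laurent ?hx) g + r') \<in> KB" using h r' g by (intro KBs) (auto simp: KB_def)
  ultimately have "h - (hscale (bar_laurent ?hx) g + r') = 0"
    using indep[of "h - (hscale (bar_laurent ?hx) g + r')"] by (simp only: KB_def mem_Collect_eq)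
  then have "h = hscale (bar_laurent ?hx) g + r'" by (simp only: right_minus_eq)
  then have "?hx = Poly_Mapping.lookup (hscale (bar_laurent ?hx) g + r') x" by simp
  also have "\<dots> = qh (- 2 * int (len x)) * bar_laurent ?hx"
    using gx r' by (simp add: lookup_add lookup_hscale mult.commute)
  finally have "qh (int (len x)) * ?hx = qh (int (len x)) * (qh (- 2 * int (len x)) * bar_laurent ?hx)" by simp
  also have "\<dots> = bar_laurent (qh (int (len x)) * ?hx)" by (simp add: qh_mult_assoc)
  finally have "qh (int (len x)) * ?hx = 0" using neg_bar_laurent_eq_0 h(3)[OF xB] by metis
  then show False using x by (simp add: in_keys_iff)
qed

end

text \<open>
  The involution is determined on scalars and on the basis, so any two choices agree.
\<close>

lemma bar_involution_unique:
  assumes "bar_setting X R \<phi> \<iota>" "bar_setting X R \<phi> \<kappa>" "f \<in> carrier (hecke X)"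
  shows "\<iota> (\<phi> f) = \<kappa> (\<phi> f)"
proof -
  interpret i: bar_setting X R \<phi> \<iota> by fact
  interpret k: bar_setting X R \<phi> \<kappa> by fact
  let ?A = "{f \<in> carrier (hecke X). \<iota> (\<phi> f) = \<kappa> (\<phi> f)}"
  have "hmod.subspace ?A"
  proof (rule hmod.subspaceI)
    show "0 \<in> ?A" using i.phi_simps(5) i.iota_simps(4) k.iota_simps(4) by simp
    show "x + y \<in> ?A" if "x \<in> ?A" "y \<in> ?A" for x y
      using that i.phi_simps(1,2) i.iota_simps(1) k.iota_simps(1) by simp
    show "hscale a x \<in> ?A" if "x \<in> ?A" for a x
    proof -
      let ?a = "hscale a (hT \<one>\<^bsub>coxeter_group X\<^esub>)"
      have "\<iota> (\<phi> ?a) = \<kappa> (\<phi> ?a)"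
        using i.bar_rel_scalar[of a] k.bar_rel_scalar[of a] by (simp add: i.bar_rel_def k.bar_rel_def)
      moreover have "\<phi> (hscale a x) = \<phi> ?a \<otimes>\<^bsub>R\<^esub> \<phi> x"
        using that i.phi_simps(3)[of ?a x] i.scalar_star[of x a] by simp
      ultimately show ?thesis
        using that i.phi_simps(1) i.iota_simps(2) k.iota_simps(2) by simp
    qed
  qed
  moreover have "hT w \<in> ?A" if "w \<in> carrier (coxeter_group X)" for w
    using i.bar k.bar that by (simp add: bar_involution_def)
  ultimately have "f \<in> ?A"
    by (rule subspace_keysI) (use assms(3) in \<open>auto simp: i.H_iff\<close>)
  then show ?thesis by simp
qed

context coxeter
begin

section \<open>Kazhdan--Lusztig elements and descents\<close>

text \<open>
  The coefficients with respect to the rescaled basis \<open>q\<^sup>-\<^sup>l\<^sup>(\<^sup>x\<^sup>)\<^sup>/\<^sup>2 T\<^sub>x\<close>.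
\<close>

definition normalised :: "'s hecke \<Rightarrow> 's list set \<Rightarrow> laurent" where
  "normalised f x = qh (int (len x)) * Poly_Mapping.lookup f x"

lemma lookup_lgen:
  assumes "s \<in> S" "f \<in> H" "x \<in> carrier W"
  shows "Poly_Mapping.lookup (lgen s f) x =
    (if s \<in> inversions x then Poly_Mapping.lookup f (s \<odot> x) + (q - 1) * Poly_Mapping.lookup f x
     else q * Poly_Mapping.lookup f (s \<odot> x))"
proof -
  let ?A = "{f. Poly_Mapping.lookup (lgen s f) x =
    (if s \<in> inversions x then Poly_Mapping.lookup f (s \<odot> x) + (q - 1) * Poly_Mapping.lookup f x
     else q * Poly_Mapping.lookup f (s \<odot> x))}"
  have "hmod.subspace ?A"
    by (rule hmod.subspaceI) (auto simp: lin_simps lookup_add lookup_hscale algebra_simps)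
  moreover have "hT w \<in> ?A" if "w \<in> carrier W" for w
  proof -
    have i: "s \<in> inversions (s \<odot> x) \<longleftrightarrow> s \<notin> inversions x" using gen_inversion_iff assms by blast
    then have ne: "s \<odot> x \<noteq> x" "x \<noteq> s \<odot> x" by auto
    consider "w = x" | "w = s \<odot> x" | "w \<noteq> x" "w \<noteq> s \<odot> x" by blast
    then show ?thesis
    proof cases
      case 1
      then show ?thesis using ne
        by (cases "s \<in> inversions x") (simp_all add: lgen_hT lookup_add lookup_hscale lookup_hT)
    next
      case 2
      have "s \<odot> (s \<odot> x) = x" using assms by simp
      then show ?thesis using 2 ne i
        by (cases "s \<in> inversions x") (simp_all add: lgen_hT lookup_add lookup_hscale lookup_hT)
    next
      case 3
      then have "s \<odot> w \<noteq> x" using assms that by auto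
      then show ?thesis using 3
        by (cases "s \<in> inversions w") (simp_all add: lgen_hT lookup_add lookup_hscale lookup_hT)
    qed
  qed
  ultimately have "f \<in> ?A" by (rule subspace_keysI) (use assms in \<open>auto simp: H_iff\<close>)
  then show ?thesis by simp
qed

lemma lookup_poly_in_q_high:
  assumes "2 * int (degree p) < k"
  shows "Poly_Mapping.lookup (poly_in_q p) k = 0"
  unfolding poly_in_q_def lookup_sum by (rule sum.neutral) (use assms in \<open>auto simp: lookup_single when_def\<close>)

lemma poly_in_q_1 [simp]: "poly_in_q 1 = 1"
  by (simp add: poly_in_q_def)

lemma lookup_kl_element:
  assumes "w \<in> carrier W"
  shows "Poly_Mapping.lookup (kl_element X P w) x =
    (if x \<in> carrier W \<and> bruhat_le X x w then qh (- int (len w)) * poly_in_q (P x w) else 0)"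
proof -
  have "finite {x. x \<in> carrier W \<and> bruhat_le X x w}"
    using finite_bruhat[OF assms] by (rule rev_finite_subset) auto
  then show ?thesis
    by (simp add: kl_element_def lookup_hscale lookup_sum lookup_hT if_distrib cong: if_cong)
qed

lemma kl_element_H: "w \<in> carrier W \<Longrightarrow> kl_element X P w \<in> H"
  by (auto simp: H_iff in_keys_iff lookup_kl_element split: if_splits)

lemma kl_element_lower:
  assumes "w \<in> carrier W" "x \<noteq> w" "Poly_Mapping.lookup (kl_element X P w) x \<noteq> 0"
  shows "x \<in> carrier W" "len x < len w"
  using assms bruhat_le_cases[of x w] by (auto simp: lookup_kl_element split: if_splits)

lemma kl_element_normalised:
  assumes "kazhdan_lusztig_polys X P" "w \<in> carrier W"
  shows "normalised (kl_element X P w) w = 1"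
    and "x \<in> carrier W \<Longrightarrow> x \<noteq> w \<Longrightarrow> neg_laurent (normalised (kl_element X P w) x)"
proof -
  have P: "P w w = 1" "\<And>x. x \<in> carrier W \<Longrightarrow> bruhat_less X x w \<Longrightarrow> 2 * degree (P x w) + len x + 1 \<le> len w"
    using assms by (auto simp: kazhdan_lusztig_polys_def)
  show "normalised (kl_element X P w) w = 1"
    using assms P by (simp add: normalised_def lookup_kl_element qh_mult)
  assume x: "x \<in> carrier W" "x \<noteq> w"
  show "neg_laurent (normalised (kl_element X P w) x)"
  proof (cases "bruhat_le X x w")
    case True
    then have "2 * degree (P x w) + len x + 1 \<le> len w" using P(2) x by (simp add: bruhat_less_def)
    then show ?thesis using x True assms(2)
      by (auto simp: neg_laurent_def normalised_def lookup_kl_element qh_mult_assoc lookup_qh_mult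
          intro!: lookup_poly_in_q_high)
  qed (use assms in \<open>simp add: normalised_def lookup_kl_element neg_laurent_simps\<close>)
qed

lemma normalised_simps:
  "normalised (f + g) x = normalised f x + normalised g x"
  "normalised (f - g) x = normalised f x - normalised g x"
  "normalised (hscale a f) x = a * normalised f x"
  "normalised (sum F A) x = (\<Sum>y\<in>A. normalised (F y) x)"
  by (simp_all add: normalised_def lookup_add lookup_minus lookup_hscale lookup_sum sum_distrib_left algebra_simps)

lemma gen_sum_square:
  assumes "s \<in> S" "f \<in> H"
  shows "(hT e + hT s) \<star> ((hT e + hT s) \<star> f) = hscale (1 + q) ((hT e + hT s) \<star> f)"
proof -
  have "s \<in> inversions s" using assms by (simp add: inversions_gen)
  then have ss: "hT s \<star> hT s = hscale q (hT e) + hscale (q - 1) (hT s)"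
    using assms by (simp add: gen_star lgen_hT)
  have "(hT e + hT s) \<star> (hT e + hT s) = hT e + hT s + hT s + hT s \<star> hT s"
    using assms by (simp add: star_simps)
  also have "\<dots> = hscale (1 + q) (hT e + hT s)" unfolding ss by (simp add: algebra_simps)
  finally have "(hT e + hT s) \<star> (hT e + hT s) = hscale (1 + q) (hT e + hT s)" .
  then have "(hT e + hT s) \<star> (hT e + hT s) \<star> f = hscale (1 + q) ((hT e + hT s) \<star> f)"
    by (simp only: star_simps(2))
  then show ?thesis using assms star_assoc[of "hT e + hT s" "hT e + hT s" f] by simp
qed

text \<open>
  This is the identity \<open>T\<^sub>s C'\<^sub>w = q C'\<^sub>w\<close> for \<open>sw < w\<close>, with 1 added to both factors. Consider the defect
  \<open>h = q\<^sup>-\<^sup>1\<^sup>/\<^sup>2 ((1 + T\<^sub>s) C'\<^sub>w - (1 + q) C'\<^sub>w)\<close>. It is bar invariant, and its normalised coefficients have no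
  positive exponents; at \<open>x\<close> with \<open>sx < x\<close> they even have only negative ones. Subtracting suitable
  integer multiples of \<open>C'\<^sub>x\<close>, where \<open>x < sx\<close>, therefore leaves an element that vanishes by uniqueness,
  so \<open>h\<close> is an integer combination of these \<open>C'\<^sub>x\<close>. But \<open>1 + T\<^sub>s\<close> annihilates \<open>h\<close>, because
  \<open>(1 + T\<^sub>s)\<^sup>2 = (1 + q)(1 + T\<^sub>s)\<close>, while it is injective on such combinations: for \<open>x\<close> of maximal
  length, \<open>T\<^sub>s\<^sub>x\<close> occurs only in \<open>(1 + T\<^sub>s) C'\<^sub>x\<close>.
\<close>

lemma kl_element_descent:
  assumes P: "kazhdan_lusztig_polys X P" and w: "w \<in> carrier W" and s: "s \<in> S" "s \<in> inversions w"
  shows "(hT e + hT s) \<star> kl_element X P w = hscale (1 + q) (kl_element X P w)"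
proof -
  obtain \<iota> where \<iota>: "bar_involution X (hecke X) (\<lambda>f. f) \<iota>"
    and C: "\<And>w. w \<in> carrier W \<Longrightarrow> \<iota> (kl_element X P w) = kl_element X P w"
    using P unfolding kazhdan_lusztig_polys_def by blast
  interpret b: bar_setting X "hecke X" "\<lambda>f. f" \<iota>
    by (intro bar_setting.intro bar_setting_axioms.intro coxeter_axioms ring_hecke \<iota> ring_hom_memI) simp_all
  let ?C = "kl_element X P" and ?M = "hT e + hT s"
  note kl = kl_element_normalised[OF P]
  have CH: "?C w \<in> H" if "w \<in> carrier W" for w using kl_element_H that .
  have Crel: "b.bar_rel (?C w) (?C w)" if "w \<in> carrier W" for w
    using C that CH by (simp add: b.bar_rel_def)
  have MH: "?M \<in> H" using s by simp
  define h where "h = hscale (qh (- 1)) (?M \<star> ?C w - hscale (1 + q) (?C w))"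
  have hH: "h \<in> H" using CH w MH by (simp add: h_def)
  have "b.bar_rel ?M (hT e + hscale (qh (- 2)) (hT s - hscale (q - 1) (hT e)))"
    using b.bar_rel_add[OF _ b.bar_rel_gen[OF s(1)], of "hT e" "hT e"] b.bar_rel_scalar_qh[of 0] by simp
  also have "hT e + hscale (qh (- 2)) (hT s - hscale (q - 1) (hT e)) = hscale (qh (- 2)) ?M"
    by (simp add: hmod.scale_right_diff_distrib hmod.scale_right_distrib hmod.scale_left_diff_distrib right_diff_distrib qh_mult)
  finally have Mrel: "b.bar_rel ?M (hscale (qh (- 2)) ?M)" .
  have "b.bar_rel h (hscale (qh 1) (hscale (qh (- 2)) ?M \<star> ?C w - hscale (bar_laurent (1 + q)) (?C w)))"
    unfolding h_def
    using b.bar_rel_scale[OF b.bar_rel_diff[OF b.bar_rel_mult[OF Mrel Crel[OF w]] b.bar_rel_scale[OF Crel[OF w], of "1 + q"]], of "qh (- 1)"]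
    by simp
  also have "bar_laurent (1 + q) = qh (- 2) * (1 + q)"
  proof -
    have "bar_laurent (1 + q) = bar_laurent (qh 0 + qh 2)" by simp
    also have "\<dots> = qh 0 + qh (- 2)" by (simp only: bar_laurent_simps minus_zero)
    also have "\<dots> = qh (- 2) * (1 + q)" by (simp add: distrib_left qh_mult)
    finally show ?thesis .
  qed
  also have "hscale (qh 1) (hscale (qh (- 2)) ?M \<star> ?C w - hscale (qh (- 2) * (1 + q)) (?C w)) = h"
    unfolding h_def star_simps(2) hmod.scale_scale[symmetric] hmod.scale_right_diff_distrib[symmetric]
    by (simp only: hmod.scale_scale qh_mult) simp
  finally have hrel: "b.bar_rel h h" .
  have norm_h: "normalised h x =
      (if s \<in> inversions x then normalised (?C w) (s \<odot> x) - qh (- 1) * normalised (?C w) x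
       else normalised (?C w) (s \<odot> x) - qh 1 * normalised (?C w) x)" if x: "x \<in> carrier W" for x
  proof -
    let ?f = "?C w"
    have Mf: "Poly_Mapping.lookup (?M \<star> ?f) x = Poly_Mapping.lookup ?f x + Poly_Mapping.lookup (lgen s ?f) x"
      using s CH w by (simp add: star_simps gen_star lookup_add)
    have hx: "normalised h x = qh (int (len x)) * (qh (- 1) *
        (Poly_Mapping.lookup ?f x + Poly_Mapping.lookup (lgen s ?f) x - (1 + q) * Poly_Mapping.lookup ?f x))"
      by (simp only: normalised_def h_def lookup_hscale lookup_minus Mf)
    show ?thesis
    proof (cases "s \<in> inversions x")
      case True
      have l: "int (len x) = int (len (s \<odot> x)) + 1" using len_left_gen(1)[OF s(1) x True] by simp
      have "normalised h x = qh (int (len x) - 1) * (Poly_Mapping.lookup ?f (s \<odot> x) - Poly_Mapping.lookup ?f x)"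
        unfolding hx using lookup_lgen[OF s(1) CH[OF w] x] True by (simp add: qh_mult_assoc algebra_simps)
      then show ?thesis using True l by (simp add: normalised_def qh_mult_assoc right_diff_distrib)
    next
      case False
      have l: "int (len (s \<odot> x)) = int (len x) + 1" using len_left_gen(2)[OF s(1) x False] by simp
      have "normalised h x = qh (int (len x) - 1) * (q * Poly_Mapping.lookup ?f (s \<odot> x) - q * Poly_Mapping.lookup ?f x)"
      proof -
        have "Poly_Mapping.lookup ?f x + Poly_Mapping.lookup (lgen s ?f) x - (1 + q) * Poly_Mapping.lookup ?f x
          = q * Poly_Mapping.lookup ?f (s \<odot> x) - q * Poly_Mapping.lookup ?f x"
          using lookup_lgen[OF s(1) CH[OF w] x] False by (simp add: algebra_simps)
        then show ?thesis unfolding hx by (simp only: qh_mult_assoc) simp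
      qed
      also have "\<dots> = qh (int (len (s \<odot> x))) * Poly_Mapping.lookup ?f (s \<odot> x) - qh 1 * (qh (int (len x)) * Poly_Mapping.lookup ?f x)"
        unfolding l right_diff_distrib qh_mult_assoc by (simp add: add.commute)
      finally show ?thesis using False by (simp add: normalised_def)
    qed
  qed
  have up_nonpos: "Poly_Mapping.lookup (normalised h x) k = 0" if "x \<in> carrier W" "s \<notin> inversions x" "0 < k" for x k
  proof -
    have "x \<noteq> w" using s that by auto
    then have "neg_laurent (normalised (?C w) x)" using kl(2)[OF w that(1)] by simp
    moreover have "Poly_Mapping.lookup (normalised (?C w) (s \<odot> x)) k = 0"
    proof (cases "s \<odot> x = w")
      case True
      then show ?thesis using kl(1)[OF w] that by (simp add: lookup_one)
    next
      case False
      then show ?thesis using kl(2)[OF w, of "s \<odot> x"] s that by (simp add: neg_laurent_def)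
    qed
    ultimately show ?thesis using norm_h[OF that(1)] that
      by (simp add: lookup_minus lookup_qh_mult neg_laurent_def)
  qed
  have down_neg: "neg_laurent (normalised h x)" if x: "x \<in> carrier W" "s \<in> inversions x" for x
  proof -
    have "s \<notin> inversions (s \<odot> x)" using gen_inversion_iff s x by blast
    then have "s \<odot> x \<noteq> w" using s by auto
    then have 1: "neg_laurent (normalised (?C w) (s \<odot> x))" using kl(2)[OF w, of "s \<odot> x"] s x by simp
    have "neg_laurent (qh (- 1) * normalised (?C w) x)"
    proof (cases "x = w")
      case True
      then show ?thesis using kl(1)[OF w] by (simp add: neg_laurent_def qh_def lookup_single)
    next
      case False
      then show ?thesis using kl(2)[OF w x(1)] by (simp add: neg_laurent_def lookup_qh_mult)
    qed
    then show ?thesis using norm_h[OF x(1)] x 1 neg_laurent_simps by simp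
  qed
  \<comment> \<open>The constant terms of the normalised coefficients, as constant Laurent polynomials.\<close>
  define n :: "'s list set \<Rightarrow> laurent"
    where "n x = Poly_Mapping.single 0 (Poly_Mapping.lookup (normalised h x) 0)" for x
  have n_down: "n x = 0" if "x \<in> carrier W" "s \<in> inversions x" for x
    using down_neg[OF that] by (simp add: n_def neg_laurent_def)
  define K where "K = Poly_Mapping.keys h"
  have KW: "K \<subseteq> carrier W" using hH by (simp add: K_def H_iff)
  have finK: "finite K" by (simp add: K_def)
  \<comment> \<open>Removing the constant terms leaves only negative exponents, because \<open>C'\<^sub>x\<close> has them away from \<open>x\<close>.\<close>
  define h' where "h' = h - (\<Sum>x\<in>K. hscale (n x) (?C x))"
  have sumrel: "b.bar_rel (\<Sum>x\<in>A. hscale (n x) (?C x)) (\<Sum>x\<in>A. hscale (n x) (?C x))"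
    if "finite A" "A \<subseteq> K" for A
    using that
  proof (induction A rule: finite_induct)
    case empty
    show ?case by (simp add: b.bar_rel_0)
  next
    case (insert x A)
    have "bar_laurent (n x) = n x" by (simp add: n_def)
    then have "b.bar_rel (hscale (n x) (?C x)) (hscale (n x) (?C x))"
      using b.bar_rel_scale[OF Crel, of x "n x"] insert KW by auto
    then show ?case using b.bar_rel_add insert by simp
  qed
  have h'rel: "b.bar_rel h' h'" unfolding h'_def by (rule b.bar_rel_diff[OF hrel sumrel[OF finK subset_refl]])
  have h'neg: "neg_laurent (normalised h' y)" if y: "y \<in> carrier W" for y
  proof -
    have ny: "neg_laurent (normalised h y - n y)"
    proof (cases "s \<in> inversions y")
      case True
      then show ?thesis using down_neg n_down y by simp
    next
      case False
      have "Poly_Mapping.lookup (normalised h y - n y) k = 0" if "0 \<le> k" for k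
        using up_nonpos[OF y False, of k] that by (cases "k = 0") (auto simp: lookup_minus n_def lookup_single)
      then show ?thesis by (simp add: neg_laurent_def)
    qed
    have sumneg: "neg_laurent (\<Sum>x\<in>A. n x * normalised (?C x) y)" if "A \<subseteq> K - {y}" for A
      using finite_subset[OF that] that finK
    proof (induction A rule: infinite_finite_induct)
      case (insert x A)
      then have "neg_laurent (normalised (?C x) y)" using kl(2)[of x y] KW y by auto
      then have "neg_laurent (n x * normalised (?C x) y)" unfolding n_def by (rule neg_laurent_simps)
      then show ?case using insert by (auto intro: neg_laurent_simps)
    qed (simp_all add: neg_laurent_simps)
    have "normalised h' y = normalised h y - (\<Sum>x\<in>K. n x * normalised (?C x) y)"
      by (simp add: h'_def normalised_simps)
    also have "(\<Sum>x\<in>K. n x * normalised (?C x) y) = n y + (\<Sum>x\<in>K - {y}. n x * normalised (?C x) y)"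
    proof (cases "y \<in> K")
      case True
      then show ?thesis using kl(1)[OF y] by (simp add: sum.remove[OF finK])
    next
      case False
      then have "n y = 0" by (simp add: n_def normalised_def K_def in_keys_iff)
      then show ?thesis using False by simp
    qed
    finally have "normalised h' y = (normalised h y - n y) - (\<Sum>x\<in>K - {y}. n x * normalised (?C x) y)" by simp
    then show ?thesis using ny sumneg[of "K - {y}"] neg_laurent_simps(3) by simp
  qed
  have "h' = 0"
  proof (rule b.bar_invariant_neg_eq_0[of "carrier W" ?C])
    show "Poly_Mapping.keys (?C w) \<subseteq> carrier W" if "w \<in> carrier W" for w
      using CH[OF that] by (simp add: H_iff)
    show "?C w - hscale (qh (- int (len w))) (hT w) \<in> low (len w)" if w: "w \<in> carrier W" for w
    proof -
      have "qh (- int (len w)) * normalised (?C w) w = qh (- int (len w))" using kl(1)[OF w] by simp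
      then have "Poly_Mapping.lookup (?C w) w = qh (- int (len w))"
        by (simp add: normalised_def qh_mult_assoc)
      then show ?thesis unfolding low_def
        using kl_element_lower[OF w]
        by (auto simp: in_keys_iff lookup_minus lookup_hscale lookup_hT split: if_splits)
    qed
    show "Poly_Mapping.keys h' \<subseteq> carrier W" using h'rel b.bar_rel_H by (auto simp: H_iff)
    show "neg_laurent (qh (int (len w)) * Poly_Mapping.lookup h' w)" if "w \<in> carrier W" for w
      using h'neg[OF that] by (simp add: normalised_def)
  qed (use Crel h'rel in auto)
  then have h_eq: "h = (\<Sum>x\<in>K. hscale (n x) (?C x))" by (simp add: h'_def)
  have "?M \<star> h = 0"
    unfolding h_def using gen_sum_square[OF s(1) CH[OF w]] by (simp add: star_simps(8,10))
  then have M0: "(\<Sum>x\<in>K. hscale (n x) (?M \<star> ?C x)) = 0" unfolding h_eq by (simp only: star_simps(8,12))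
  have "n x = 0" if "x \<in> K" for x
  proof (rule ccontr)
    assume "n x \<noteq> 0"
    \<comment> \<open>Compare coefficients of \<open>T\<^sub>s\<^sub>y\<close> for \<open>y\<close> of maximal length among the terms that occur.\<close>
    define N where "N = {x \<in> K. n x \<noteq> 0}"
    have N: "finite N" "N \<noteq> {}" using finK that \<open>n x \<noteq> 0\<close> by (auto simp: N_def)
    have "Max (len ` N) \<in> len ` N" using N by (intro Max_in) auto
    then obtain y where y: "y \<in> N" "len y = Max (len ` N)" by auto
    have max: "len x \<le> len y" if "x \<in> N" for x using y N that by simp
    have yK: "y \<in> K" "n y \<noteq> 0" "y \<in> carrier W" using y KW by (auto simp: N_def)
    have up: "s \<notin> inversions y" using n_down yK by blast
    then have sy: "s \<in> inversions (s \<odot> y)" "len (s \<odot> y) = Suc (len y)" "s \<odot> y \<in> carrier W"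
      using gen_inversion_iff len_left_gen(2) s yK by auto
    have zero: "Poly_Mapping.lookup (?C x) z = 0" if "x \<in> K" "z \<noteq> x" "len x \<le> len z" for x z
      using kl_element_lower(2)[of x z P] that KW by fastforce
    have coeff: "Poly_Mapping.lookup (?M \<star> ?C x) (s \<odot> y) = Poly_Mapping.lookup (?C x) y + q * Poly_Mapping.lookup (?C x) (s \<odot> y)"
      if "x \<in> K" for x
    proof -
      have xH: "?C x \<in> H" using that CH KW by auto
      then have "Poly_Mapping.lookup (?M \<star> ?C x) (s \<odot> y) = Poly_Mapping.lookup (?C x) (s \<odot> y) + Poly_Mapping.lookup (lgen s (?C x)) (s \<odot> y)"
        using s by (simp add: star_simps gen_star lookup_add)
      then show ?thesis using lookup_lgen[OF s(1) xH sy(3)] sy(1) s yK by (simp add: algebra_simps)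
    qed
    have "n x * Poly_Mapping.lookup (?M \<star> ?C x) (s \<odot> y) = (if x = y then n y * Poly_Mapping.lookup (?C y) y else 0)"
      if "x \<in> K" for x
    proof (cases "x = y")
      case True
      have "Poly_Mapping.lookup (?C y) (s \<odot> y) = 0" using zero[OF yK(1), of "s \<odot> y"] sy by force
      then show ?thesis using True coeff[OF yK(1)] by simp
    next
      case False
      show ?thesis
      proof (cases "n x = 0")
        case nx: False
        then have l: "len x \<le> len y" using max that by (simp add: N_def)
        moreover have "s \<odot> y \<noteq> x" using l sy(2) by auto
        ultimately have "Poly_Mapping.lookup (?C x) y = 0" "Poly_Mapping.lookup (?C x) (s \<odot> y) = 0"
          using zero[OF that, of y] zero[OF that, of "s \<odot> y"] False sy(2) by auto
        then show ?thesis using coeff[OF that] False by simp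
      qed (use False in simp)
    qed
    then have "(\<Sum>x\<in>K. n x * Poly_Mapping.lookup (?M \<star> ?C x) (s \<odot> y))
       = (\<Sum>x\<in>K. if x = y then n y * Poly_Mapping.lookup (?C y) y else 0)" by (intro sum.cong) simp_all
    also have "\<dots> = n y * Poly_Mapping.lookup (?C y) y" using finK yK(1) by simp
    finally have "n y * Poly_Mapping.lookup (?C y) y = Poly_Mapping.lookup (\<Sum>x\<in>K. hscale (n x) (?M \<star> ?C x)) (s \<odot> y)"
      by (simp add: lookup_sum lookup_hscale)
    then have "n y * Poly_Mapping.lookup (?C y) y = 0" unfolding M0 by simp
    then have "Poly_Mapping.lookup (?C y) y = 0" using yK(2) by simp
    then show False using kl(1)[OF yK(3)] by (simp add: normalised_def)
  qed
  then have "h = 0" unfolding h_eq by simp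
  then have "hscale (qh 1) h = 0" by simp
  then show ?thesis unfolding h_def by (simp add: qh_mult)
qed

section \<open>The generalized Temperley--Lieb algebra\<close>

lemma ring_tl: "ring (tl X)"
  unfolding tl_def by (rule ideal.quotient_is_ring[OF ideal_J])

lemma tl_proj_hom: "tl_proj X \<in> ring_hom (hecke X) (tl X)"
  using ideal.rcos_ring_hom[OF ideal_J] by (simp add: tl_def tl_proj_def[abs_def])

lemma a_minus_hecke: "f \<in> H \<Longrightarrow> g \<in> H \<Longrightarrow> f \<ominus>\<^bsub>hecke X\<^esub> g = f - g"
proof -
  interpret ring "hecke X" by (rule ring_hecke)
  assume fg: "f \<in> H" "g \<in> H"
  have "\<ominus>\<^bsub>hecke X\<^esub> g = - g" using fg by (intro minus_equality) auto
  then show ?thesis by (simp add: a_minus_def)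
qed

lemma tl_proj_eq_iff: "f \<in> H \<Longrightarrow> g \<in> H \<Longrightarrow> tl_proj X f = tl_proj X g \<longleftrightarrow> f - g \<in> J"
  using ring.quotient_eq_iff_same_a_r_cos[OF ring_hecke ideal_J] a_minus_hecke by (simp add: tl_proj_def)

lemma tl_proj_0: "tl_proj X 0 = \<zero>\<^bsub>tl X\<^esub>"
  using ring_hom_zero[OF tl_proj_hom ring_hecke ring_tl] by simp

lemma tl_proj_closed: "f \<in> H \<Longrightarrow> tl_proj X f \<in> carrier (tl X)"
  using ring_hom_closed[OF tl_proj_hom] .

lemma tl_scale_proj: "f \<in> H \<Longrightarrow> tl_scale X a (tl_proj X f) = tl_proj X (hscale a f)"
  using ring_hom_mult[OF tl_proj_hom, of "hscale a (hT e)" f] scalar_star[of f a]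
  by (simp add: tl_scale_def)

lemma tl_proj_sum:
  assumes "finite A" "\<And>x. x \<in> A \<Longrightarrow> F x \<in> H"
  shows "tl_proj X (\<Sum>x\<in>A. F x) = (\<Oplus>\<^bsub>tl X\<^esub>x\<in>A. tl_proj X (F x))"
  using assms
proof (induction A rule: finite_induct)
  case empty
  interpret ring "tl X" by (rule ring_tl)
  show ?case by (simp add: tl_proj_0)
next
  case (insert x A)
  interpret ring "tl X" by (rule ring_tl)
  have "tl_proj X (F x + (\<Sum>x\<in>A. F x)) = tl_proj X (F x) \<oplus>\<^bsub>tl X\<^esub> tl_proj X (\<Sum>x\<in>A. F x)"
    using ring_hom_add[OF tl_proj_hom, of "F x" "\<Sum>x\<in>A. F x"] insert.prems H_sum[of A F] by simp
  then show ?case using insert tl_proj_closed by simp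
qed

text \<open>
  The representative of \<open>c\<^sub>w\<close> in the Hecke algebra that is supported on fully commutative elements.
\<close>

definition tl_lift :: "('s list set \<Rightarrow> 's list set \<Rightarrow> laurent) \<Rightarrow> 's list set \<Rightarrow> 's hecke" where
  "tl_lift L w = (\<Sum>x | x \<in> fc \<and> bruhat_le X x w. hscale (qh (- int (len x)) * L x w) (hT x))"

lemma fc_W: "fc \<subseteq> carrier W"
  by (auto simp: fully_commutative_def)

lemma finite_fc_below: "w \<in> carrier W \<Longrightarrow> finite {x \<in> fc. bruhat_le X x w}"
  using finite_bruhat[of w] by (auto elim: rev_finite_subset)

lemma lookup_tl_lift_if:
  assumes "w \<in> fc"
  shows "Poly_Mapping.lookup (tl_lift L w) x =
    (if x \<in> fc \<and> bruhat_le X x w then qh (- int (len x)) * L x w else 0)"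
  using finite_fc_below[of w] assms fc_W
  by (auto simp: tl_lift_def lookup_sum lookup_hscale lookup_hT if_distrib cong: if_cong)

lemma keys_tl_lift: "w \<in> fc \<Longrightarrow> Poly_Mapping.keys (tl_lift L w) \<subseteq> fc"
  by (auto simp: in_keys_iff lookup_tl_lift_if split: if_splits)

lemma keys_fc_H: "Poly_Mapping.keys f \<subseteq> fc \<Longrightarrow> f \<in> H"
  using fc_W by (auto simp: H_iff)

context
  fixes c L
  assumes canonical: "tl_canonical_basis X c L"
begin

lemma L_props:
  assumes "w \<in> fc"
  shows "L w w = 1" "x \<in> fc \<Longrightarrow> x \<noteq> w \<Longrightarrow> neg_laurent (L x w)" "x \<in> fc \<Longrightarrow> \<not> bruhat_le X x w \<Longrightarrow> L x w = 0"
  using canonical assms unfolding tl_canonical_basis_def neg_laurent_iff by blast+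

lemma ex_canonical_involution:
  "\<exists>\<iota>. bar_involution X (tl X) (tl_proj X) \<iota> \<and> (\<forall>w\<in>fc. \<iota> (c w) = c w)"
  by (rule ex_forward[OF canonical[unfolded tl_canonical_basis_def, THEN conjunct2]], erule conjE,
      intro conjI ballI, assumption, drule (1) bspec, erule conjE)

lemma lookup_tl_lift:
  "w \<in> fc \<Longrightarrow> x \<in> fc \<Longrightarrow> Poly_Mapping.lookup (tl_lift L w) x = qh (- int (len x)) * L x w"
  by (simp add: lookup_tl_lift_if L_props)

lemma tl_lift_H: "w \<in> fc \<Longrightarrow> tl_lift L w \<in> H"
  using keys_tl_lift keys_fc_H by blast

lemma proj_tl_lift:
  assumes "w \<in> fc"
  shows "tl_proj X (tl_lift L w) = c w"
proof -
  interpret ring "tl X" by (rule ring_tl)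
  have A: "finite {x \<in> fc. bruhat_le X x w}" using finite_fc_below assms fc_W by blast
  have in_H: "hT x \<in> H" if "x \<in> fc" for x using that fc_W by auto
  have "c w = (\<Oplus>\<^bsub>tl X\<^esub>x\<in>{x \<in> fc. bruhat_le X x w}. tl_scale X (qh (- int (len x)) * L x w) (tl_t X x))"
    using canonical assms unfolding tl_canonical_basis_def by blast
  also have "\<dots> = (\<Oplus>\<^bsub>tl X\<^esub>x\<in>{x \<in> fc. bruhat_le X x w}. tl_proj X (hscale (qh (- int (len x)) * L x w) (hT x)))"
    using in_H by (intro finsum_cong') (auto simp: tl_t_def tl_scale_proj tl_proj_closed)
  also have "\<dots> = tl_proj X (tl_lift L w)"
    unfolding tl_lift_def using in_H A by (intro tl_proj_sum[symmetric]) auto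
  finally show ?thesis ..
qed

lemma tl_lift_triangular:
  assumes "w \<in> fc"
  shows "tl_lift L w - hscale (qh (- int (len w))) (hT w) \<in> low (len w)"
proof -
  have "y \<in> carrier W \<and> len y < len w"
    if "Poly_Mapping.lookup (tl_lift L w - hscale (qh (- int (len w))) (hT w)) y \<noteq> 0" for y
  proof -
    have "y \<noteq> w" using that lookup_tl_lift[OF assms assms] L_props(1)[OF assms]
      by (auto simp: lookup_minus lookup_hscale lookup_hT)
    moreover from this have "y \<in> fc" "bruhat_le X y w"
      using that by (auto simp: lookup_minus lookup_hscale lookup_hT lookup_tl_lift_if[OF assms] split: if_splits)
    ultimately show ?thesis using bruhat_le_cases[of y w] assms fc_W by auto
  qed
  then show ?thesis by (auto simp: low_def in_keys_iff)
qed

lemma tl_lift_spans: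
  assumes "Poly_Mapping.keys f \<subseteq> fc"
  shows "\<exists>a. Poly_Mapping.keys a \<subseteq> fc \<and> f = lin_ext (tl_lift L) a"
proof -
  let ?A = "lin_ext (tl_lift L) ` {a. Poly_Mapping.keys a \<subseteq> fc}"
  have sub: "hmod.subspace ?A"
    by (rule module_hom.subspace_image[OF hlinear_lin_ext subspace_keys])
  have fcA: "hT w \<in> ?A" if "w \<in> fc" for w
    using that
  proof (induction "len w" arbitrary: w rule: less_induct)
    case less
    let ?C = "tl_lift L w"
    define d where "d = ?C - hscale (qh (- int (len w))) (hT w)"
    have "d \<in> {f. Poly_Mapping.keys f \<subseteq> fc}"
      unfolding d_def
      by (intro hmod.subspace_diff[OF subspace_keys] hmod.subspace_scale[OF subspace_keys])
        (use keys_tl_lift[OF less.prems] less.prems in simp_all)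
    then have keysd: "Poly_Mapping.keys d \<subseteq> fc" by simp
    have "d \<in> ?A"
    proof (rule subspace_keysI[OF sub])
      fix y assume "y \<in> Poly_Mapping.keys d"
      then have "y \<in> fc" "len y < len w"
        using keysd tl_lift_triangular[OF less.prems] by (auto simp: d_def low_def)
      then show "hT y \<in> ?A" using less.hyps by blast
    qed
    moreover have "?C \<in> ?A" using less.prems by (intro image_eqI[of _ _ "hT w"]) auto
    ultimately have "hscale (qh (int (len w))) (?C - d) \<in> ?A"
      by (intro hmod.subspace_scale[OF sub] hmod.subspace_diff[OF sub])
    then show ?case by (simp add: d_def qh_mult)
  qed
  have "f \<in> ?A"
    by (rule subspace_keysI[OF sub], rule fcA, rule subsetD[OF assms])
  then show ?thesis by blast
qed

text \<open>
  The linear independence of the \<open>t\<^sub>w\<close> over fully commutative \<open>w\<close> is inherited from that of the basis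
  \<open>c\<^sub>w\<close>, to which they are related unitriangularly.
\<close>

lemma fc_independent:
  assumes "Poly_Mapping.keys f \<subseteq> fc" "f \<in> J"
  shows "f = 0"
proof -
  interpret ring "tl X" by (rule ring_tl)
  obtain a where a: "Poly_Mapping.keys a \<subseteq> fc" "f = lin_ext (tl_lift L) a"
    using tl_lift_spans assms by blast
  define rep where "rep y a \<longleftrightarrow> Poly_Mapping.keys a \<subseteq> fc \<and>
      y = (\<Oplus>\<^bsub>tl X\<^esub>w\<in>Poly_Mapping.keys a. tl_scale X (Poly_Mapping.lookup a w) (c w))" for y a
  have "\<forall>y\<in>carrier (tl X). \<exists>!a. rep y a"
    using canonical unfolding tl_canonical_basis_def tl_basis_def rep_def by (elim conjE)
  then have unique: "\<exists>!a. rep \<zero>\<^bsub>tl X\<^esub> a" by (rule bspec) (rule zero_closed)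
  have "tl_proj X f = tl_proj X 0" using tl_proj_eq_iff[of f 0] assms J_H by simp
  then have "\<zero>\<^bsub>tl X\<^esub> = tl_proj X f" by (simp add: tl_proj_0)
  also have "\<dots> = (\<Oplus>\<^bsub>tl X\<^esub>w\<in>Poly_Mapping.keys a. tl_proj X (hscale (Poly_Mapping.lookup a w) (tl_lift L w)))"
    unfolding a(2) lin_ext_def using a(1) tl_lift_H by (intro tl_proj_sum) auto
  also have "\<dots> = (\<Oplus>\<^bsub>tl X\<^esub>w\<in>Poly_Mapping.keys a. tl_scale X (Poly_Mapping.lookup a w) (c w))"
    using a(1) tl_lift_H
    by (intro finsum_cong') (auto simp: tl_scale_proj subset_iff tl_proj_closed simp flip: proj_tl_lift)
  finally have "rep \<zero>\<^bsub>tl X\<^esub> a" unfolding rep_def using a(1) by simp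
  moreover have "rep \<zero>\<^bsub>tl X\<^esub> 0" by (simp add: rep_def)
  ultimately have "a = 0" using unique by blast
  then show ?thesis using a(2) by (simp add: lin_ext_def)
qed

end

text \<open>
  The difference of the two lifts is bar invariant for the common involution and has only negative
  exponents, since the leading coefficients cancel.
\<close>

lemma canonical_basis_unique:
  assumes "tl_canonical_basis X c L" "tl_canonical_basis X c' L'" "w \<in> fc" "x \<in> fc"
  shows "L x w = L' x w"
proof -
  obtain \<iota> where \<iota>: "bar_involution X (tl X) (tl_proj X) \<iota>" "\<forall>w\<in>fc. \<iota> (c w) = c w"
    using ex_canonical_involution[OF assms(1)] by blast
  obtain \<kappa> where \<kappa>: "bar_involution X (tl X) (tl_proj X) \<kappa>" "\<forall>w\<in>fc. \<kappa> (c' w) = c' w"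
    using ex_canonical_involution[OF assms(2)] by blast
  have i: "bar_setting X (tl X) (tl_proj X) \<iota>" and k: "bar_setting X (tl X) (tl_proj X) \<kappa>"
    by (intro bar_setting.intro bar_setting_axioms.intro coxeter_axioms ring_tl tl_proj_hom \<iota>(1) \<kappa>(1))+
  interpret b: bar_setting X "tl X" "tl_proj X" \<iota> by (rule i)
  note l = tl_lift_H[OF assms(1)] and l' = tl_lift_H[OF assms(2)]
  have 1: "b.bar_rel (tl_lift L w) (tl_lift L w)" if "w \<in> fc" for w
    using that \<iota>(2) proj_tl_lift[OF assms(1)] l by (simp add: b.bar_rel_def)
  have 2: "b.bar_rel (tl_lift L' w) (tl_lift L' w)" if "w \<in> fc" for w
    using that \<kappa>(2) proj_tl_lift[OF assms(2) that] l'[OF that] bar_involution_unique[OF i k l'[OF that]]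
    by (simp add: b.bar_rel_def)
  define h where "h = tl_lift L w - tl_lift L' w"
  have hx: "qh (int (len x)) * Poly_Mapping.lookup h x = L x w - L' x w" if "x \<in> fc" for x
    using lookup_tl_lift[OF assms(1,3) that] lookup_tl_lift[OF assms(2,3) that]
    by (simp add: h_def lookup_minus right_diff_distrib qh_mult_assoc)
  have "h = 0"
  proof (rule b.bar_invariant_neg_eq_0[of fc "tl_lift L"])
    show "b.bar_rel h h" unfolding h_def using b.bar_rel_diff 1 2 assms(3) by blast
    show "Poly_Mapping.keys h \<subseteq> fc"
      using keys_tl_lift[OF assms(3), of L] keys_tl_lift[OF assms(3), of L']
        keys_diff[of "tl_lift L w" "tl_lift L' w"] unfolding h_def by blast
    show "g = 0" if "Poly_Mapping.keys g \<subseteq> fc" "tl_proj X g = \<zero>\<^bsub>tl X\<^esub>" for g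
      using fc_independent[OF assms(1) that(1)] tl_proj_eq_iff[of g 0] keys_fc_H[OF that(1)] that(2)
      by (simp add: tl_proj_0)
    show "neg_laurent (qh (int (len y)) * Poly_Mapping.lookup h y)" if "y \<in> fc" for y
    proof (cases "y = w")
      case True
      then show ?thesis
        using hx[OF that] L_props(1)[OF assms(1,3)] L_props(1)[OF assms(2,3)]
        by (simp add: neg_laurent_simps)
    next
      case False
      then show ?thesis
        unfolding hx[OF that] using L_props(2)[OF assms(1,3) that] L_props(2)[OF assms(2,3) that]
        by (intro neg_laurent_simps)
    qed
  qed (use 1 fc_W keys_tl_lift tl_lift_triangular[OF assms(1)] in auto)
  then show ?thesis using hx[OF assms(4)] by simp
qed

text \<open>
  Modulo the ideal, \<open>(1 + q) c\<^sub>w\<close> is \<open>(1 + T\<^sub>s) C'\<^sub>w\<close> and hence congruent to a symmetric combination. By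
  linear independence it equals that combination, and \<open>1 + q\<close> can be cancelled.
\<close>

lemma L_descent:
  assumes "projection_property X" "tl_canonical_basis X c L"
    and x: "x \<in> fc" "s \<odot> x \<in> fc" and w: "w \<in> fc" and s: "s \<in> S" "s \<in> inversions w" "s \<notin> inversions x"
  shows "L x w = qh (- 1) * L (s \<odot> x) w"
proof -
  obtain P c' L' where P: "kazhdan_lusztig_polys X P" "tl_canonical_basis X c' L'"
    "\<And>w. w \<in> fc \<Longrightarrow> tl_proj X (kl_element X P w) = c' w"
    using assms(1) unfolding projection_property_def by blast
  have W: "w \<in> carrier W" "x \<in> carrier W" using w x fc_W by auto
  let ?M = "hT e + hT s" and ?C = "kl_element X P w" and ?D = "tl_lift L' w"
  have DH: "?D \<in> H" using tl_lift_H[OF P(2) w] .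
  have CH: "?C \<in> H" using kl_element_H W by blast
  have "?C - ?D \<in> J" using tl_proj_eq_iff[OF CH DH] P(3)[OF w] proj_tl_lift[OF P(2) w] by simp
  then have "hscale (1 + q) (?C - ?D) \<in> J" by (rule J_simps(5))
  then have 1: "hscale (1 + q) ?C - hscale (1 + q) ?D \<in> J" by (simp only: hmod.scale_right_diff_distrib)
  obtain g where g: "g \<in> symmetric_part s" "?M \<star> ?C - g \<in> J" using H_symmetrizable[OF s(1) CH] by blast
  then have "hscale (1 + q) ?C - g \<in> J" using kl_element_descent[OF P(1) W(1) s(1,2)] by simp
  then have "(hscale (1 + q) ?C - g) - (hscale (1 + q) ?C - hscale (1 + q) ?D) \<in> J"
    using 1 by (rule J_simps(3))
  then have "hscale (1 + q) ?D - g \<in> J" by simp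
  moreover have "Poly_Mapping.keys (hscale (1 + q) ?D - g) \<subseteq> fc"
    using keys_tl_lift[OF w, of L'] g(1) keys_diff[of "hscale (1 + q) ?D" g]
      keys_hscale[of "1 + q" ?D] unfolding symmetric_part_def by blast
  ultimately have "hscale (1 + q) ?D - g = 0" using fc_independent[OF P(2)] by blast
  then have g_eq: "g = hscale (1 + q) ?D" by simp
  have "Poly_Mapping.lookup g x = Poly_Mapping.lookup g (s \<odot> x)"
    using g(1) x s(3) by (simp add: symmetric_part_def)
  then have "(1 + q) * Poly_Mapping.lookup ?D x = (1 + q) * Poly_Mapping.lookup ?D (s \<odot> x)"
    unfolding g_eq by (simp add: lookup_hscale)
  moreover have "1 + q \<noteq> 0"
  proof
    assume "1 + q = 0"
    then have "Poly_Mapping.lookup (1 + q) 2 = 0" by simp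
    then show False by (simp add: lookup_add lookup_one qh_def lookup_single)
  qed
  ultimately have "Poly_Mapping.lookup ?D x = Poly_Mapping.lookup ?D (s \<odot> x)" by simp
  then have "qh (- int (len x)) * L' x w = qh (- int (len (s \<odot> x))) * L' (s \<odot> x) w"
    using lookup_tl_lift[OF P(2) w] x by simp
  then have "qh (int (len x)) * (qh (- int (len x)) * L' x w) = qh (int (len x)) * (qh (- int (len (s \<odot> x))) * L' (s \<odot> x) w)"
    by simp
  then have "L' x w = qh (- 1) * L' (s \<odot> x) w"
    using len_left_gen(2)[OF s(1) W(2) s(3)] by (simp add: qh_mult_assoc)
  then show ?thesis using canonical_basis_unique[OF assms(2) P(2) w] x by simp
qed

end

theorem theorem3p7:
  fixes X :: "'s coxeter_graph"
    and c :: "'s list set \<Rightarrow> 's hecke set"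
    and L :: "'s list set \<Rightarrow> 's list set \<Rightarrow> laurent"
  assumes "is_coxeter_graph X"
    and "projection_property X"
    and "tl_canonical_basis X c L"
    and "x \<in> fully_commutative X"
    and "w \<in> fully_commutative X"
    and "bruhat_less X x w"
    and "s \<in> cox_gens X"
    and "bruhat_less X (s \<otimes>\<^bsub>coxeter_group X\<^esub> w) w"
    and "bruhat_less X x (s \<otimes>\<^bsub>coxeter_group X\<^esub> x)"
    and "s \<otimes>\<^bsub>coxeter_group X\<^esub> x \<in> fully_commutative X"
  shows "L x w = qh (- 1) * L (s \<otimes>\<^bsub>coxeter_group X\<^esub> x) w"
proof -
  interpret coxeter X by (rule coxeter.intro) (rule assms(1))
  have W: "w \<in> carrier W" "x \<in> carrier W" "s \<odot> x \<in> carrier W" using assms(4,5,10) fc_W by auto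
  have "len (s \<odot> w) < len w" "len x < len (s \<odot> x)"
    using bruhat_le_cases[of "s \<odot> w" w] bruhat_le_cases[of x "s \<odot> x"] W assms(8,9)
    by (auto simp: bruhat_less_def)
  then show ?thesis
    using L_descent[OF assms(2,3,4,10,5,7)] len_left_less_iff assms(7) W by blast
qed

end
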